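(* Let $G$ be an étale, Hausdorff, locally compact, second countable, topologically principal groupoid that is minimal and purely infinite, and such that $G^{(0)}$ is homeomorphic to the Cantor set. Let $p$ be a prime number and let $\alpha:\mathbb{Z}_p\curvearrowright C^*_r(G)$ be an action. Then the following are equivalent: (i) $C(G^{(0)}) \subseteq C^*_r(G)\rtimes_\alpha \mathbb{Z}_p$ is not a masa. (ii) $\alpha$ is exterior equivalent to a $\mathbb{Z}_p$-action on $C^*_r(G)$ fixing $C(G^{(0)})$ pointwise.
   Context: $\mathbb{Z}_p=\mathbb{Z}/p\mathbb{Z}$. A masa is a maximal abelian sub-C*-algebra. $C^*_r(G)$ is the reduced groupoid C*-algebra, $C(G^{(0)})\subseteq C^*_r(G)$ is the canonical embedding, and $C^*_r(G)$ is viewed as a sub-C*-algebra of the crossed product. Groupoid notions: $r,s$ are the range and source maps. A topological groupoid $G$ is étale if $r$ and $s$ are local homeomorphisms from $G$ onto $G^{(0)}$. $G$ is topologically principal if the set of $x\in G^{(0)}$ with trivial isotropy, i.e. $\{g\in G: r(g)=s(g)=x\}=\{x\}$, is dense in $G^{(0)}$. $G$ is minimal if for every $x\in G^{(0)}$ the orbit $r(s^{-1}(x))$ is dense in $G^{(0)}$. $G$ (with Cantor unit space) is purely infinite in the sense of Matui if for every clopen $Y\subseteq G^{(0)}$ there are compact open bisections $U,V\subseteq G$ (compact open subsets on which $r$ and $s$ are injective) with $s(U)=s(V)=Y$, $r(U)\cup r(V)\subseteq Y$ and $r(U)\cap r(V)=\emptyset$. Exterior equivalence: for a discrete group action $\alpha:\Gamma\curvearrowright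 A$, an $\alpha$-cocycle is a map $u:\Gamma\to\mathcal{U}(\mathcal{M}(A))$ (unitaries of the multiplier algebra) with $u_{\gamma\gamma'}=u_\gamma\alpha_\gamma(u_{\gamma'})$ for all $\gamma,\gamma'\in\Gamma$. The perturbed action is $\alpha^u_\gamma=\mathrm{Ad}(u_\gamma)\circ\alpha_\gamma$. Two actions $\alpha,\beta$ of $\Gamma$ on $A$ are exterior equivalent if $\beta=\alpha^u$ for some $\alpha$-cocycle $u$. *)

theory Defs
  imports "HOL-Analysis.Analysis" "HOL-Algebra.Elementary_Groups" "HOL-Computational_Algebra.Primes"
begin

section \<open>The Hilbert space of square-summable complex functions\<close>

typedef 'x ell2 = "{f :: 'x \<Rightarrow> complex. (\<lambda>x. (cmod (f x))\<^sup>2) summable_on UNIV}"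
  by (rule exI[of _ "\<lambda>_. 0"]) simp

setup_lifting type_definition_ell2

lemma ell2_summable: "(\<lambda>x. (cmod (Rep_ell2 f x))\<^sup>2) summable_on UNIV"
  using Rep_ell2[of f] by simp

lemma cmod_add_sq_le: "(cmod (a + b))\<^sup>2 \<le> 2 * (cmod a)\<^sup>2 + 2 * (cmod b)\<^sup>2"
proof -
  have "(cmod (a + b))\<^sup>2 \<le> (cmod a + cmod b)\<^sup>2"
    by (intro power_mono norm_triangle_ineq) auto
  also have "\<dots> \<le> 2 * (cmod a)\<^sup>2 + 2 * (cmod b)\<^sup>2"
    using sum_squares_bound[of "cmod a" "cmod b"] by (simp add: power2_sum)
  finally show ?thesis .
qed

lemma ell2_summable_add:
  fixes f g :: "'x \<Rightarrow> complex"
  assumes "(\<lambda>x. (cmod (f x))\<^sup>2) summable_on UNIV" "(\<lambda>x. (cmod (g x))\<^sup>2) summable_on UNIV"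
  shows "(\<lambda>x. (cmod (f x + g x))\<^sup>2) summable_on UNIV"
proof (rule summable_on_comparison_test)
  show "(\<lambda>x. 2 * (cmod (f x))\<^sup>2 + 2 * (cmod (g x))\<^sup>2) summable_on UNIV"
    by (intro summable_on_add summable_on_cmult_right assms)
qed (auto simp: cmod_add_sq_le)

instantiation ell2 :: (type) real_vector
begin

lift_definition zero_ell2 :: "'a ell2" is "\<lambda>_. 0" by simp
lift_definition plus_ell2 :: "'a ell2 \<Rightarrow> 'a ell2 \<Rightarrow> 'a ell2" is "\<lambda>f g x. f x + g x"
  by (rule ell2_summable_add)
lift_definition uminus_ell2 :: "'a ell2 \<Rightarrow> 'a ell2" is "\<lambda>f x. - f x" by simp
lift_definition minus_ell2 :: "'a ell2 \<Rightarrow> 'a ell2 \<Rightarrow> 'a ell2" is "\<lambda>f g x. f x - g x"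
  using ell2_summable_add[of _ "\<lambda>x. - _ x"] by simp
lift_definition scaleR_ell2 :: "real \<Rightarrow> 'a ell2 \<Rightarrow> 'a ell2" is "\<lambda>r f x. r *\<^sub>R f x"
  by (simp add: power_mult_distrib summable_on_cmult_right)

instance
  by standard (transfer; simp add: fun_eq_iff algebra_simps)+

end

lift_definition scaleC_ell2 :: "complex \<Rightarrow> 'x ell2 \<Rightarrow> 'x ell2" is "\<lambda>c f x. c * f x"
  by (simp add: norm_mult power_mult_distrib summable_on_cmult_right)

text \<open>The inner product is conjugate-linear in the first argument.\<close>

definition cinner_ell2 :: "'x ell2 \<Rightarrow> 'x ell2 \<Rightarrow> complex" where
  "cinner_ell2 \<xi> \<eta> = (\<Sum>\<^sub>\<infinity>x. cnj (Rep_ell2 \<xi> x) * Rep_ell2 \<eta> x)"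

lemma cinner_ell2_abs_summable:
  "(\<lambda>x. cmod (cnj (Rep_ell2 \<xi> x) * Rep_ell2 \<eta> x)) summable_on UNIV"
proof (rule abs_summable_product)
  show "(\<lambda>x. cmod (cnj (Rep_ell2 \<xi> x) * cnj (Rep_ell2 \<xi> x))) summable_on UNIV"
    using ell2_summable[of \<xi>] by (simp add: norm_mult power2_eq_square)
  show "(\<lambda>x. cmod (Rep_ell2 \<eta> x * Rep_ell2 \<eta> x)) summable_on UNIV"
    using ell2_summable[of \<eta>] by (simp add: norm_mult power2_eq_square)
qed

lemma cinner_ell2_summable: "(\<lambda>x. cnj (Rep_ell2 \<xi> x) * Rep_ell2 \<eta> x) summable_on UNIV"
  using cinner_ell2_abs_summable by (rule abs_summable_summable)

lemma cinner_ell2_add_left: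
  "cinner_ell2 (\<xi> + \<xi>') \<eta> = cinner_ell2 \<xi> \<eta> + cinner_ell2 \<xi>' \<eta>"
  unfolding cinner_ell2_def plus_ell2.rep_eq
  by (simp add: distrib_right infsum_add cinner_ell2_summable)

lemma cinner_ell2_scaleR_left:
  "cinner_ell2 (r *\<^sub>R \<xi>) \<eta> = r *\<^sub>R cinner_ell2 \<xi> \<eta>"
  unfolding cinner_ell2_def scaleR_ell2.rep_eq
  by (simp add: infsum_scaleR_right)

lemma cinner_ell2_commute: "cinner_ell2 \<xi> \<eta> = cnj (cinner_ell2 \<eta> \<xi>)"
  unfolding cinner_ell2_def by (simp add: mult.commute flip: infsum_cnj)

lemma cinner_ell2_self:
  "cinner_ell2 \<xi> \<xi> = complex_of_real (\<Sum>\<^sub>\<infinity>x. (cmod (Rep_ell2 \<xi> x))\<^sup>2)"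
proof -
  have "cnj z * z = complex_of_real ((cmod z)\<^sup>2)" for z
    by (metis complex_norm_square mult.commute)
  then have "cinner_ell2 \<xi> \<xi> = (\<Sum>\<^sub>\<infinity>x. complex_of_real ((cmod (Rep_ell2 \<xi> x))\<^sup>2))"
    unfolding cinner_ell2_def by simp
  then show ?thesis
    using infsumI[OF has_sum_of_real[OF has_sum_infsum[OF ell2_summable[of \<xi>]]]] by simp
qed

instantiation ell2 :: (type) real_inner
begin

definition inner_ell2 :: "'a ell2 \<Rightarrow> 'a ell2 \<Rightarrow> real" where
  "inner_ell2 \<xi> \<eta> = Re (cinner_ell2 \<xi> \<eta>)"
definition norm_ell2 :: "'a ell2 \<Rightarrow> real" where
  "norm_ell2 \<xi> = sqrt (inner \<xi> \<xi>)"
definition dist_ell2 :: "'a ell2 \<Rightarrow> 'a ell2 \<Rightarrow> real" where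
  "dist_ell2 \<xi> \<eta> = norm (\<xi> - \<eta>)"
definition sgn_ell2 :: "'a ell2 \<Rightarrow> 'a ell2" where
  "sgn_ell2 \<xi> = \<xi> /\<^sub>R norm \<xi>"
definition uniformity_ell2 :: "('a ell2 \<times> 'a ell2) filter" where
  "uniformity_ell2 = (INF e\<in>{0 <..}. principal {(x, y). dist x y < e})"
definition open_ell2 :: "'a ell2 set \<Rightarrow> bool" where
  "open_ell2 U = (\<forall>x\<in>U. eventually (\<lambda>(x', y). x' = x \<longrightarrow> y \<in> U) uniformity)"

instance
proof
  fix x y z :: "'a ell2" and r :: real
  show "dist x y = norm (x - y)" by (rule dist_ell2_def)
  show "sgn x = x /\<^sub>R norm x" by (rule sgn_ell2_def)
  show "(uniformity :: ('a ell2 \<times> 'a ell2) filter) = (INF e\<in>{0 <..}. principal {(x, y). dist x y < e})"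
    by (rule uniformity_ell2_def)
  show "open U = (\<forall>x\<in>U. eventually (\<lambda>(x', y). x' = x \<longrightarrow> y \<in> U) uniformity)" for U :: "'a ell2 set"
    by (rule open_ell2_def)
  show "inner x y = inner y x"
    unfolding inner_ell2_def by (subst cinner_ell2_commute) simp
  show "inner (x + y) z = inner x z + inner y z"
    by (simp add: inner_ell2_def cinner_ell2_add_left)
  show "inner (r *\<^sub>R x) y = r * inner x y"
    by (simp add: inner_ell2_def cinner_ell2_scaleR_left)
  show "0 \<le> inner x x"
    by (simp add: inner_ell2_def cinner_ell2_self infsum_nonneg)
  show "(inner x x = 0) = (x = 0)"
  proof
    assume "inner x x = 0"
    then have 0: "(\<Sum>\<^sub>\<infinity>y. (cmod (Rep_ell2 x y))\<^sup>2) = 0"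
      by (simp add: inner_ell2_def cinner_ell2_self)
    have "(cmod (Rep_ell2 x y))\<^sup>2 = 0" for y
      by (rule nonneg_infsum_le_0D[where A = UNIV]) (use 0 ell2_summable[of x] in auto)
    then show "x = 0"
      by (simp add: Rep_ell2_inject[symmetric] zero_ell2.rep_eq fun_eq_iff)
  qed (simp add: inner_ell2_def cinner_ell2_self zero_ell2.rep_eq)
  show "norm x = sqrt (inner x x)" by (rule norm_ell2_def)
qed

end

lemma norm_ell2_sq: "(norm \<xi>)\<^sup>2 = (\<Sum>\<^sub>\<infinity>x. (cmod (Rep_ell2 \<xi> x))\<^sup>2)"
  by (simp add: power2_norm_eq_inner inner_ell2_def cinner_ell2_self)

lemma sum_le_norm_ell2: "finite F \<Longrightarrow> (\<Sum>x\<in>F. (cmod (Rep_ell2 \<xi> x))\<^sup>2) \<le> (norm \<xi>)\<^sup>2"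
  unfolding norm_ell2_sq by (rule finite_sum_le_infsum) (auto simp: ell2_summable)

lemma cmod_le_norm_ell2: "cmod (Rep_ell2 \<xi> x) \<le> norm \<xi>"
  using sum_le_norm_ell2[of "{x}" \<xi>] by (simp add: power2_le_iff_abs_le)

instance ell2 :: (type) banach
proof
  fix X :: "nat \<Rightarrow> 'a ell2"
  assume X: "Cauchy X"
  have "Cauchy (\<lambda>n. Rep_ell2 (X n) x)" for x
  proof (rule metric_CauchyI)
    fix e :: real assume "0 < e"
    then obtain M where "\<forall>m\<ge>M. \<forall>n\<ge>M. dist (X m) (X n) < e"
      using X metric_CauchyD by blast
    moreover have "dist (Rep_ell2 (X m) x) (Rep_ell2 (X n) x) \<le> dist (X m) (X n)" for m n
      using cmod_le_norm_ell2[of "X m - X n" x] by (simp add: dist_norm minus_ell2.rep_eq)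
    ultimately show "\<exists>M. \<forall>m\<ge>M. \<forall>n\<ge>M. dist (Rep_ell2 (X m) x) (Rep_ell2 (X n) x) < e"
      by (meson order_le_less_trans)
  qed
  then have "\<exists>l. (\<lambda>n. Rep_ell2 (X n) x) \<longlonglongrightarrow> l" for x
    by (simp add: Cauchy_convergent convergentD)
  then obtain L where L: "\<And>x. (\<lambda>n. Rep_ell2 (X n) x) \<longlonglongrightarrow> L x"
    by metis
  have fin: "(\<Sum>x\<in>F. (cmod (Rep_ell2 (X m) x - L x))\<^sup>2) \<le> e\<^sup>2"
    if F: "finite F" and M: "\<forall>n\<ge>M. dist (X m) (X n) < e" for F m M and e :: real
  proof (rule tendsto_upperbound)
    show "(\<lambda>n. \<Sum>x\<in>F. (cmod (Rep_ell2 (X m) x - Rep_ell2 (X n) x))\<^sup>2)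
        \<longlonglongrightarrow> (\<Sum>x\<in>F. (cmod (Rep_ell2 (X m) x - L x))\<^sup>2)"
      by (intro tendsto_intros L)
    show "\<forall>\<^sub>F n in sequentially.
        (\<Sum>x\<in>F. (cmod (Rep_ell2 (X m) x - Rep_ell2 (X n) x))\<^sup>2) \<le> e\<^sup>2"
      unfolding eventually_sequentially
    proof (intro exI allI impI)
      fix n assume "M \<le> n"
      then have "(norm (X m - X n))\<^sup>2 \<le> e\<^sup>2"
        using M by (intro power_mono) (auto simp: dist_norm intro: less_imp_le)
      then show "(\<Sum>x\<in>F. (cmod (Rep_ell2 (X m) x - Rep_ell2 (X n) x))\<^sup>2) \<le> e\<^sup>2"
        using sum_le_norm_ell2[OF F, of "X m - X n"] by (simp add: minus_ell2.rep_eq)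
    qed
  qed simp
  have mem: "(\<lambda>x. (cmod (Rep_ell2 (X m) x - L x))\<^sup>2) summable_on UNIV"
    if M: "\<forall>n\<ge>M. dist (X m) (X n) < e" for m M and e :: real
    using fin[OF _ M] by (intro nonneg_bdd_above_summable_on) (auto intro!: bdd_aboveI2)
  obtain M1 where M1: "\<forall>m\<ge>M1. \<forall>n\<ge>M1. dist (X m) (X n) < 1"
    using metric_CauchyD[OF X, of 1] by auto
  have "(\<lambda>x. (cmod (Rep_ell2 (X M1) x + - (Rep_ell2 (X M1) x - L x)))\<^sup>2) summable_on UNIV"
  proof (rule ell2_summable_add[OF ell2_summable])
    show "(\<lambda>x. (cmod (- (Rep_ell2 (X M1) x - L x)))\<^sup>2) summable_on UNIV"
      unfolding norm_minus_cancel by (rule mem) (use M1 in blast)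
  qed
  then have "L \<in> {f. (\<lambda>x. (cmod (f x))\<^sup>2) summable_on UNIV}"
    by simp
  then have RepL: "Rep_ell2 (Abs_ell2 L) = L"
    by (rule Abs_ell2_inverse)
  have "X \<longlonglongrightarrow> Abs_ell2 L"
  proof (rule metric_LIMSEQ_I)
    fix r :: real assume "0 < r"
    then obtain M where M: "\<forall>m\<ge>M. \<forall>n\<ge>M. dist (X m) (X n) < r / 2"
      using metric_CauchyD[OF X, of "r / 2"] by auto
    have "dist (X n) (Abs_ell2 L) < r" if "n \<ge> M" for n
    proof -
      have n: "\<forall>k\<ge>M. dist (X n) (X k) < r / 2"
        using M that by blast
      have "(norm (X n - Abs_ell2 L))\<^sup>2 \<le> (r / 2)\<^sup>2"
        unfolding norm_ell2_sq minus_ell2.rep_eq RepL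
        by (rule infsum_le_finite_sums[OF mem[OF n]]) (rule fin[OF _ n])
      then have "norm (X n - Abs_ell2 L) \<le> r / 2"
        by (rule power2_le_imp_le) (use \<open>0 < r\<close> in simp)
      then show ?thesis
        using \<open>0 < r\<close> by (simp add: dist_norm)
    qed
    then show "\<exists>no. \<forall>n\<ge>no. dist (X n) (Abs_ell2 L) < r" by blast
  qed
  then show "convergent X"
    by (rule convergentI)
qed

section \<open>C*-algebras of operators\<close>

text \<open>
  C*-algebras are represented concretely, as norm-closed *-algebras of bounded operators. The type
  of bounded operators consists of real-linear ones, so complex linearity is required separately;
  the real operator norm of a complex-linear operator is its usual operator norm.
\<close>

type_synonym 'x oper = "'x ell2 \<Rightarrow>\<^sub>L 'x ell2"

definition complex_linear :: "'x oper \<Rightarrow> bool" where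
  "complex_linear T \<longleftrightarrow> (\<forall>c \<xi>. blinfun_apply T (scaleC_ell2 c \<xi>) = scaleC_ell2 c (blinfun_apply T \<xi>))"

lift_definition scalar_op :: "complex \<Rightarrow> 'x oper" is scaleC_ell2
proof (rule bounded_linear_intro)
  fix c r and \<xi> \<eta> :: "'x ell2"
  show "scaleC_ell2 c (\<xi> + \<eta>) = scaleC_ell2 c \<xi> + scaleC_ell2 c \<eta>"
    by transfer (simp add: distrib_left)
  show "scaleC_ell2 c (r *\<^sub>R \<xi>) = r *\<^sub>R scaleC_ell2 c \<xi>"
    by transfer (simp add: fun_eq_iff)
  have "(norm (scaleC_ell2 c \<xi>))\<^sup>2 = (norm \<xi> * cmod c)\<^sup>2"
    unfolding norm_ell2_sq power_mult_distrib scaleC_ell2.rep_eq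
    by (simp add: norm_mult power_mult_distrib infsum_cmult_right' mult.commute)
  then show "norm (scaleC_ell2 c \<xi>) \<le> norm \<xi> * cmod c"
    by simp
qed

text \<open>The Hilbert space adjoint; it exists and is unique for complex-linear \<open>T\<close>.\<close>

definition adj :: "'x oper \<Rightarrow> 'x oper" where
  "adj T = (THE S. \<forall>\<xi> \<eta>. cinner_ell2 (blinfun_apply S \<xi>) \<eta> = cinner_ell2 \<xi> (blinfun_apply T \<eta>))"

definition cstar_algebra :: "'x oper set \<Rightarrow> bool" where
  "cstar_algebra A \<longleftrightarrow>
     (\<forall>a\<in>A. complex_linear a) \<and> 0 \<in> A \<and> closed A \<and>
     (\<forall>a\<in>A. \<forall>b\<in>A. a + b \<in> A \<and> a o\<^sub>L b \<in> A) \<and>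
     (\<forall>c. \<forall>a\<in>A. scalar_op c o\<^sub>L a \<in> A) \<and>
     (\<forall>a\<in>A. adj a \<in> A)"

definition abelian :: "'x oper set \<Rightarrow> bool" where
  "abelian A \<longleftrightarrow> (\<forall>a\<in>A. \<forall>b\<in>A. a o\<^sub>L b = b o\<^sub>L a)"

definition is_masa :: "'x oper set \<Rightarrow> 'x oper set \<Rightarrow> bool" where
  "is_masa D A \<longleftrightarrow>
     D \<subseteq> A \<and> cstar_algebra D \<and> abelian D \<and>
     (\<forall>B. B \<subseteq> A \<longrightarrow> cstar_algebra B \<longrightarrow> abelian B \<longrightarrow> D \<subseteq> B \<longrightarrow> B = D)"

definition star_automorphism :: "'x oper set \<Rightarrow> ('x oper \<Rightarrow> 'x oper) \<Rightarrow> bool" where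
  "star_automorphism A \<phi> \<longleftrightarrow>
     bij_betw \<phi> A A \<and>
     (\<forall>a\<in>A. \<forall>b\<in>A. \<phi> (a + b) = \<phi> a + \<phi> b \<and> \<phi> (a o\<^sub>L b) = \<phi> a o\<^sub>L \<phi> b) \<and>
     (\<forall>c. \<forall>a\<in>A. \<phi> (scalar_op c o\<^sub>L a) = scalar_op c o\<^sub>L \<phi> a) \<and>
     (\<forall>a\<in>A. \<phi> (adj a) = adj (\<phi> a))"

text \<open>Only the values of an action on group elements and on elements of the algebra matter.\<close>

definition cstar_action ::
    "'k monoid \<Rightarrow> 'x oper set \<Rightarrow> ('k \<Rightarrow> 'x oper \<Rightarrow> 'x oper) \<Rightarrow> bool" where
  "cstar_action \<Gamma> A \<alpha> \<longleftrightarrow>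
     (\<forall>\<gamma>\<in>carrier \<Gamma>. star_automorphism A (\<alpha> \<gamma>)) \<and>
     (\<forall>a\<in>A. \<alpha> \<one>\<^bsub>\<Gamma>\<^esub> a = a) \<and>
     (\<forall>\<gamma>\<in>carrier \<Gamma>. \<forall>\<delta>\<in>carrier \<Gamma>. \<forall>a\<in>A. \<alpha> (\<gamma> \<otimes>\<^bsub>\<Gamma>\<^esub> \<delta>) a = \<alpha> \<gamma> (\<alpha> \<delta> a))"

section \<open>Exterior equivalence\<close>

text \<open>
  For a C*-algebra acting nondegenerately on its Hilbert space, the multiplier algebra is the
  idealizer, and an automorphism extends uniquely to multipliers.
\<close>

definition multiplier_algebra :: "'x oper set \<Rightarrow> 'x oper set" where
  "multiplier_algebra A = {T. complex_linear T \<and> (\<forall>a\<in>A. T o\<^sub>L a \<in> A \<and> a o\<^sub>L T \<in> A)}"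

definition multiplier_ext :: "'x oper set \<Rightarrow> ('x oper \<Rightarrow> 'x oper) \<Rightarrow> 'x oper \<Rightarrow> 'x oper" where
  "multiplier_ext A \<phi> m =
     (THE n. n \<in> multiplier_algebra A \<and> (\<forall>a\<in>A. n o\<^sub>L \<phi> a = \<phi> (m o\<^sub>L a) \<and> \<phi> a o\<^sub>L n = \<phi> (a o\<^sub>L m)))"

definition multiplier_unitary :: "'x oper set \<Rightarrow> 'x oper \<Rightarrow> bool" where
  "multiplier_unitary A u \<longleftrightarrow>
     u \<in> multiplier_algebra A \<and> adj u o\<^sub>L u = id_blinfun \<and> u o\<^sub>L adj u = id_blinfun"

definition action_cocycle ::
    "'k monoid \<Rightarrow> 'x oper set \<Rightarrow> ('k \<Rightarrow> 'x oper \<Rightarrow> 'x oper) \<Rightarrow> ('k \<Rightarrow> 'x oper) \<Rightarrow> bool" where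
  "action_cocycle \<Gamma> A \<alpha> u \<longleftrightarrow>
     (\<forall>\<gamma>\<in>carrier \<Gamma>. multiplier_unitary A (u \<gamma>)) \<and>
     (\<forall>\<gamma>\<in>carrier \<Gamma>. \<forall>\<delta>\<in>carrier \<Gamma>.
        u (\<gamma> \<otimes>\<^bsub>\<Gamma>\<^esub> \<delta>) = u \<gamma> o\<^sub>L multiplier_ext A (\<alpha> \<gamma>) (u \<delta>))"

definition exterior_equivalent ::
    "'k monoid \<Rightarrow> 'x oper set \<Rightarrow> ('k \<Rightarrow> 'x oper \<Rightarrow> 'x oper) \<Rightarrow> ('k \<Rightarrow> 'x oper \<Rightarrow> 'x oper) \<Rightarrow> bool" where
  "exterior_equivalent \<Gamma> A \<alpha> \<beta> \<longleftrightarrow>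
     (\<exists>u. action_cocycle \<Gamma> A \<alpha> u \<and>
        (\<forall>\<gamma>\<in>carrier \<Gamma>. \<forall>a\<in>A. \<beta> \<gamma> a = u \<gamma> o\<^sub>L \<alpha> \<gamma> a o\<^sub>L adj (u \<gamma>)))"

section \<open>Crossed products by discrete groups\<close>

lift_definition slice :: "('k \<times> 'x) ell2 \<Rightarrow> 'k \<Rightarrow> 'x ell2" is "\<lambda>\<xi> \<gamma> x. \<xi> (\<gamma>, x)"
proof -
  fix \<xi> :: "'k \<times> 'x \<Rightarrow> complex" and \<gamma>
  assume "(\<lambda>z. (cmod (\<xi> z))\<^sup>2) summable_on UNIV"
  then have "(\<lambda>z. (cmod (\<xi> z))\<^sup>2) summable_on Pair \<gamma> ` UNIV"
    by (rule summable_on_subset) auto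
  then show "(\<lambda>x. (cmod (\<xi> (\<gamma>, x)))\<^sup>2) summable_on UNIV"
    by (subst (asm) summable_on_reindex) (auto simp: o_def inj_on_def)
qed

text \<open>
  The operator \<open>T\<close> is the image of the finitely supported function \<open>\<Sum>\<^sub>\<delta> a\<^sub>\<delta> \<delta>\<close> on \<open>\<Gamma>\<close> under the regular
  covariant representation \<open>(\<pi>(a)\<xi>)(\<gamma>) = \<alpha>\<^sub>\<gamma>\<^sup>-\<^sup>1(a) \<xi>(\<gamma>)\<close>, \<open>(\<lambda>\<^sub>\<delta>\<xi>)(\<gamma>) = \<xi>(\<delta>\<^sup>-\<^sup>1\<gamma>)\<close> on the square-summable
  functions \<open>\<Gamma> \<rightarrow> \<ell>\<^sup>2(X)\<close>. These are identified with functions on \<open>'k \<times> 'x\<close> vanishing off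
  \<open>carrier \<Gamma>\<close>; operators are extended by \<open>0\<close> on the orthogonal complement.
\<close>

definition is_crossed_rep ::
    "'k monoid \<Rightarrow> ('k \<Rightarrow> 'x oper \<Rightarrow> 'x oper) \<Rightarrow> ('k \<Rightarrow> 'x oper) \<Rightarrow> ('k \<times> 'x) oper \<Rightarrow> bool" where
  "is_crossed_rep \<Gamma> \<alpha> a T \<longleftrightarrow>
     (\<forall>\<xi> \<gamma>. slice (blinfun_apply T \<xi>) \<gamma> =
        (if \<gamma> \<in> carrier \<Gamma>
         then \<Sum>\<delta> | \<delta> \<in> carrier \<Gamma> \<and> a \<delta> \<noteq> 0.
           blinfun_apply (\<alpha> (inv\<^bsub>\<Gamma>\<^esub> \<gamma>) (a \<delta>)) (slice \<xi> (inv\<^bsub>\<Gamma>\<^esub> \<delta> \<otimes>\<^bsub>\<Gamma>\<^esub> \<gamma>))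
         else 0))"

text \<open>This is the reduced crossed product; for finite \<open>\<Gamma>\<close> it coincides with the full one.\<close>

definition crossed_product ::
    "'k monoid \<Rightarrow> 'x oper set \<Rightarrow> ('k \<Rightarrow> 'x oper \<Rightarrow> 'x oper) \<Rightarrow> ('k \<times> 'x) oper set" where
  "crossed_product \<Gamma> A \<alpha> =
     closure {T. \<exists>a. (\<forall>\<delta>\<in>carrier \<Gamma>. a \<delta> \<in> A) \<and> finite {\<delta>\<in>carrier \<Gamma>. a \<delta> \<noteq> 0} \<and>
                  is_crossed_rep \<Gamma> \<alpha> a T}"

text \<open>The image of \<open>D \<subseteq> A\<close> under the canonical embedding of \<open>A\<close> into the crossed product.\<close>

definition crossed_image ::
    "'k monoid \<Rightarrow> ('k \<Rightarrow> 'x oper \<Rightarrow> 'x oper) \<Rightarrow> 'x oper set \<Rightarrow> ('k \<times> 'x) oper set" where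
  "crossed_image \<Gamma> \<alpha> D =
     {T. \<exists>a\<in>D. is_crossed_rep \<Gamma> \<alpha> (\<lambda>\<delta>. if \<delta> = \<one>\<^bsub>\<Gamma>\<^esub> then a else 0) T}"

section \<open>Topological groupoids\<close>

text \<open>
  The arrows of a groupoid form a whole type and units are identified with identity arrows.
  The product \<open>gmult G g h\<close> is only meaningful if \<open>src G g = rng G h\<close>.
\<close>

record 'g gpd =
  rng :: "'g \<Rightarrow> 'g"
  src :: "'g \<Rightarrow> 'g"
  gmult :: "'g \<Rightarrow> 'g \<Rightarrow> 'g"
  ginv :: "'g \<Rightarrow> 'g"

definition units :: "'g gpd \<Rightarrow> 'g set" where
  "units G = range (rng G)"

locale topological_groupoid =
  fixes G :: "'g::topological_space gpd"
  assumes rng_rng: "rng G (rng G g) = rng G g"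
    and src_rng: "src G (rng G g) = rng G g"
    and rng_src: "rng G (src G g) = src G g"
    and src_src: "src G (src G g) = src G g"
    and rng_mult: "src G g = rng G h \<Longrightarrow> rng G (gmult G g h) = rng G g"
    and src_mult: "src G g = rng G h \<Longrightarrow> src G (gmult G g h) = src G h"
    and mult_assoc: "src G g = rng G h \<Longrightarrow> src G h = rng G k \<Longrightarrow>
          gmult G (gmult G g h) k = gmult G g (gmult G h k)"
    and mult_rng: "gmult G (rng G g) g = g"
    and mult_src: "gmult G g (src G g) = g"
    and rng_inv: "rng G (ginv G g) = src G g"
    and src_inv: "src G (ginv G g) = rng G g"
    and mult_inv: "gmult G g (ginv G g) = rng G g"
    and inv_mult: "gmult G (ginv G g) g = src G g"
    and continuous_mult: "continuous_on {(g, h). src G g = rng G h} (\<lambda>(g, h). gmult G g h)"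
    and continuous_inv: "continuous_on UNIV (ginv G)"

definition local_homeomorphism_onto ::
    "('a::topological_space \<Rightarrow> 'b::topological_space) \<Rightarrow> 'b set \<Rightarrow> bool" where
  "local_homeomorphism_onto f Z \<longleftrightarrow>
     range f = Z \<and>
     (\<forall>x. \<exists>U f'. open U \<and> x \<in> U \<and> openin (top_of_set Z) (f ` U) \<and> homeomorphism U (f ` U) f f')"

definition etale_groupoid :: "'g::topological_space gpd \<Rightarrow> bool" where
  "etale_groupoid G \<longleftrightarrow>
     topological_groupoid G \<and>
     local_homeomorphism_onto (rng G) (units G) \<and> local_homeomorphism_onto (src G) (units G)"

definition topologically_principal :: "'g::topological_space gpd \<Rightarrow> bool" where
  "topologically_principal G \<longleftrightarrow>
     units G \<subseteq> closure {x \<in> units G. {g. rng G g = x \<and> src G g = x} = {x}}"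

definition minimal_groupoid :: "'g::topological_space gpd \<Rightarrow> bool" where
  "minimal_groupoid G \<longleftrightarrow> (\<forall>x\<in>units G. units G \<subseteq> closure (rng G ` {g. src G g = x}))"

definition compact_open_bisection :: "'g::topological_space gpd \<Rightarrow> 'g set \<Rightarrow> bool" where
  "compact_open_bisection G U \<longleftrightarrow> compact U \<and> open U \<and> inj_on (rng G) U \<and> inj_on (src G) U"

definition purely_infinite :: "'g::topological_space gpd \<Rightarrow> bool" where
  "purely_infinite G \<longleftrightarrow>
     (\<forall>Y. openin (top_of_set (units G)) Y \<and> closedin (top_of_set (units G)) Y \<longrightarrow>
        (\<exists>U V. compact_open_bisection G U \<and> compact_open_bisection G V \<and>
               src G ` U = Y \<and> src G ` V = Y \<and> rng G ` U \<union> rng G ` V \<subseteq> Y \<and>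
               rng G ` U \<inter> rng G ` V = {}))"

section \<open>The reduced groupoid C*-algebra\<close>

definition Cc :: "'g::topological_space gpd \<Rightarrow> ('g \<Rightarrow> complex) set" where
  "Cc G = {f. continuous_on UNIV f \<and> compact (closure {g. f g \<noteq> 0})}"

text \<open>
  \<open>\<ell>\<^sup>2(G)\<close> is the direct sum of the spaces \<open>\<ell>\<^sup>2(G\<^sub>x)\<close> over the source fibres \<open>G\<^sub>x\<close>, so \<open>T\<close> below is the
  direct sum of the regular representations \<open>\<lambda>\<^sub>x(f)\<close> over all units \<open>x\<close>, and its norm is the
  reduced norm of \<open>f\<close>.
\<close>

definition is_regular_rep ::
    "'g::topological_space gpd \<Rightarrow> ('g \<Rightarrow> complex) \<Rightarrow> 'g oper \<Rightarrow> bool" where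
  "is_regular_rep G f T \<longleftrightarrow>
     (\<forall>\<xi> g. Rep_ell2 (blinfun_apply T \<xi>) g =
        (\<Sum>\<^sub>\<infinity>h | src G h = src G g. f (gmult G g (ginv G h)) * Rep_ell2 \<xi> h))"

definition reduced_cstar :: "'g::topological_space gpd \<Rightarrow> 'g oper set" where
  "reduced_cstar G = closure {T. \<exists>f\<in>Cc G. is_regular_rep G f T}"

text \<open>
  The image of \<open>C(G\<^sup>0)\<close> in the reduced C*-algebra, for an etale groupoid with compact unit space:
  functions on the clopen unit space are extended by \<open>0\<close>.
\<close>

definition unit_functions :: "'g::topological_space gpd \<Rightarrow> 'g oper set" where
  "unit_functions G =
     {T. \<exists>\<phi>. continuous_on (units G) \<phi> \<and>
             is_regular_rep G (\<lambda>g. if g \<in> units G then \<phi> g else 0) T}"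

end

(*
Elements of the crossed product are block matrices built from coefficients a_g in A, and commuting
with D = C(G^0) means d a_g = a_g alpha_g(d) for all d in D. As G is topologically principal, D is its
own commutant in A, so D fails to be a masa exactly when some a_g with g not the identity is nonzero.

Given such an a = a_g, the element a a^* lies in D, and cutting down by a clopen set makes a a partial
isometry v with v v^* = 1_Y and v^* v = alpha_g(1_Y). Minimality and pure infiniteness provide an
isometry w in A normalizing D with range projection below 1_Y; then u = w^* v alpha_g(w) is a unitary
with u alpha_g(d) u^* = d on D. The product u alpha_g(u) ... alpha_g^(p-1)(u) commutes with D, hence is
a unitary of D, and on the Cantor set it has a p-th root in D by which u can be corrected so that the
product becomes 1. As g generates Z_p, the corrected u extends to a cocycle. Conversely, if the action
perturbed by a cocycle u fixes D, the elements d u_g lambda_g span an abelian algebra larger than D.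
*)
theory Submission
  imports Defs "HOL-Number_Theory.Cong"
begin

section \<open>Operators on square-summable functions\<close>

text \<open>The locale \<open>regular_masa\<close> isolates what the groupoid contributes; the
  arguments about the action see only an abstract pair of algebras. The partial isometry
  \<open>v\<close> alone does not suffice, because a cocycle consists of unitaries: \<open>v\<close>
  identifies the corner at \<open>\<phi> e\<close> with the corner at \<open>e\<close>, and
  compressing by \<open>w\<close> on one side and by \<open>\<phi> w\<close> on the other turns both
  corners into the whole algebra. Correcting \<open>u\<close> by a root works because
  \<open>Ad u o \<phi>\<close> fixes \<open>D\<close>: factors from \<open>D\<close> can be pulled
  to the front of the product, so replacing \<open>u\<close> by \<open>c u\<close> multiplies the
  n-fold product by \<open>c^n\<close>. Primality enters through the invertibility of every nonzero
  residue, since there is no control over the degree in which a nonzero coefficient occurs. The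
  analytic point behind all coefficient arguments is that automorphisms are contractive. It makes
  the operator matrices of a finite crossed product a norm-closed set, so every element has honest
  coefficients; it is proved by playing a Neumann series against an approximate eigenvector.\<close>

lift_definition ket :: "'x \<Rightarrow> 'x ell2" is "\<lambda>x y. if y = x then 1 else 0"
proof -
  fix x :: 'x
  have "(\<lambda>y. (cmod (if y = x then 1 else 0))\<^sup>2) summable_on {x}" by simp
  then show "(\<lambda>y. (cmod (if y = x then 1 else 0))\<^sup>2) summable_on UNIV"
    by (rule summable_on_cong_neutral[THEN iffD1, rotated -1]) auto
qed

lemma ell2_eqI: "(\<And>x. Rep_ell2 \<xi> x = Rep_ell2 \<eta> x) \<Longrightarrow> \<xi> = \<eta>"
  by (simp add: Rep_ell2_inject[symmetric] fun_eq_iff)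

lemma Rep_ell2_linear [simp]:
  "Rep_ell2 (\<xi> + \<eta>) x = Rep_ell2 \<xi> x + Rep_ell2 \<eta> x"
  "Rep_ell2 (\<xi> - \<eta>) x = Rep_ell2 \<xi> x - Rep_ell2 \<eta> x"
  "Rep_ell2 (- \<xi>) x = - Rep_ell2 \<xi> x"
  "Rep_ell2 0 x = 0"
  "Rep_ell2 (r *\<^sub>R \<xi>) x = r *\<^sub>R Rep_ell2 \<xi> x"
  "Rep_ell2 (scaleC_ell2 c \<xi>) x = c * Rep_ell2 \<xi> x"
  by (simp_all add: plus_ell2.rep_eq minus_ell2.rep_eq uminus_ell2.rep_eq zero_ell2.rep_eq
      scaleR_ell2.rep_eq scaleC_ell2.rep_eq)

lemma Rep_ell2_sum [simp]: "Rep_ell2 (sum f F) x = (\<Sum>i\<in>F. Rep_ell2 (f i) x)"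
  by (induction F rule: infinite_finite_induct) auto

lemma Rep_ket [simp]: "Rep_ell2 (ket x) y = (if y = x then 1 else 0)"
  by (simp add: ket.rep_eq)

lemma scaleC_add: "scaleC_ell2 c (\<xi> + \<eta>) = scaleC_ell2 c \<xi> + scaleC_ell2 c \<eta>"
  by (rule ell2_eqI) (simp add: algebra_simps)

lemma scaleC_zero [simp]: "scaleC_ell2 c 0 = 0"
  by (auto intro!: ell2_eqI)

lemma scaleC_of_real: "scaleC_ell2 (of_real r) \<xi> = r *\<^sub>R \<xi>"
  by (rule ell2_eqI) (simp add: scaleR_conv_of_real)

lemma cinner_add_right: "cinner_ell2 \<xi> (\<eta> + \<eta>') = cinner_ell2 \<xi> \<eta> + cinner_ell2 \<xi> \<eta>'"
  by (subst (1 2 3) cinner_ell2_commute) (simp add: cinner_ell2_add_left)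

lemma cinner_zero [simp]: "cinner_ell2 0 \<xi> = 0" "cinner_ell2 \<xi> 0 = 0"
  by (simp_all add: cinner_ell2_def)

lemma cinner_scaleC_right [simp]: "cinner_ell2 \<xi> (scaleC_ell2 c \<eta>) = c * cinner_ell2 \<xi> \<eta>"
  unfolding cinner_ell2_def Rep_ell2_linear
  by (simp add: infsum_cmult_right' mult.left_commute)

lemma cinner_scaleC_left [simp]: "cinner_ell2 (scaleC_ell2 c \<xi>) \<eta> = cnj c * cinner_ell2 \<xi> \<eta>"
  by (subst (1 2) cinner_ell2_commute) simp

lemma cinner_minus_right: "cinner_ell2 \<xi> (\<eta> - \<eta>') = cinner_ell2 \<xi> \<eta> - cinner_ell2 \<xi> \<eta>'"
  using cinner_add_right[of \<xi> "\<eta> - \<eta>'" \<eta>'] by simp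

lemma cinner_minus_left: "cinner_ell2 (\<xi> - \<xi>') \<eta> = cinner_ell2 \<xi> \<eta> - cinner_ell2 \<xi>' \<eta>"
  using cinner_ell2_add_left[of "\<xi> - \<xi>'" \<xi>' \<eta>] by simp

lemma cinner_sum_right: "cinner_ell2 \<xi> (sum f F) = (\<Sum>i\<in>F. cinner_ell2 \<xi> (f i))"
  by (induction F rule: infinite_finite_induct) (auto simp: cinner_add_right)

lemma cinner_sum_left: "cinner_ell2 (sum f F) \<eta> = (\<Sum>i\<in>F. cinner_ell2 (f i) \<eta>)"
  by (induction F rule: infinite_finite_induct) (auto simp: cinner_ell2_add_left)

lemma cinner_self_norm: "cinner_ell2 \<xi> \<xi> = of_real ((norm \<xi>)\<^sup>2)"
  by (simp add: cinner_ell2_self norm_ell2_sq)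

lemma norm_scaleC [simp]: "norm (scaleC_ell2 c \<xi>) = cmod c * norm \<xi>"
proof -
  have "complex_of_real ((norm (scaleC_ell2 c \<xi>))\<^sup>2) = of_real ((cmod c * norm \<xi>)\<^sup>2)"
    unfolding cinner_self_norm[symmetric] cinner_scaleC_left cinner_scaleC_right
    by (simp add: cinner_self_norm power_mult_distrib complex_norm_square algebra_simps
        del: of_real_power)
  then have "(norm (scaleC_ell2 c \<xi>))\<^sup>2 = (cmod c * norm \<xi>)\<^sup>2"
    using of_real_eq_iff by blast
  then show ?thesis
    by (simp add: power2_eq_iff_nonneg)
qed

text \<open>Multiplying \<eta> by a phase makes the complex inner product real and nonnegative, so
  the inequality of the underlying real inner product space applies.\<close>

lemma cinner_Cauchy_Schwarz: "cmod (cinner_ell2 \<xi> \<eta>) \<le> norm \<xi> * norm \<eta>"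
proof (cases "cinner_ell2 \<xi> \<eta> = 0")
  case False
  define z where "z = cinner_ell2 \<xi> \<eta>"
  define c where "c = cnj z / cmod z"
  have c: "cmod c = 1" using False by (simp add: c_def z_def norm_divide)
  have "c * z = of_real (cmod z)"
    using False complex_norm_square[of z] by (simp add: c_def z_def power2_eq_square field_simps)
  then have "cmod z = inner \<xi> (scaleC_ell2 c \<eta>)"
    by (simp add: inner_ell2_def z_def)
  also have "\<dots> \<le> norm \<xi> * norm (scaleC_ell2 c \<eta>)"
    by (rule norm_cauchy_schwarz)
  finally show ?thesis by (simp add: z_def c)
qed auto

lemma cinner_ket_left [simp]: "cinner_ell2 (ket x) \<xi> = Rep_ell2 \<xi> x"
proof -
  have "cinner_ell2 (ket x) \<xi> = (\<Sum>\<^sub>\<infinity>y\<in>{x}. Rep_ell2 \<xi> y)"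
    unfolding cinner_ell2_def by (rule infsum_cong_neutral) auto
  then show ?thesis by simp
qed

lemma cinner_ket_right [simp]: "cinner_ell2 \<xi> (ket x) = cnj (Rep_ell2 \<xi> x)"
  by (subst cinner_ell2_commute) simp

lemma cinner_eqI_right: "(\<And>\<xi>. cinner_ell2 \<xi> \<eta> = cinner_ell2 \<xi> \<eta>') \<Longrightarrow> \<eta> = \<eta>'"
  by (metis cinner_ket_left ell2_eqI)

lemma cinner_eqI_left: "(\<And>\<eta>. cinner_ell2 \<xi> \<eta> = cinner_ell2 \<xi>' \<eta>) \<Longrightarrow> \<xi> = \<xi>'"
  by (metis cinner_ell2_commute cinner_eqI_right)

lemma norm_ket [simp]: "norm (ket x) = 1"
proof -
  have "complex_of_real ((norm (ket x))\<^sup>2) = of_real 1"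
    unfolding cinner_self_norm[symmetric] by simp
  then show ?thesis
    unfolding of_real_eq_iff by (simp add: power2_eq_1_iff) (use norm_ge_zero[of "ket x"] in linarith)
qed

lemma bounded_linear_Rep_ell2: "bounded_linear (\<lambda>\<xi>. Rep_ell2 \<xi> x)"
  by (rule bounded_linear_intro[where K = 1]) (auto simp: cmod_le_norm_ell2)

lemma bounded_linear_cinner_left: "bounded_linear (\<lambda>\<xi>. cinner_ell2 \<xi> \<eta>)"
  by (rule bounded_linear_intro[where K = "norm \<eta>"])
    (auto simp: cinner_ell2_add_left cinner_Cauchy_Schwarz mult.commute cinner_ell2_scaleR_left)

lemma bounded_linear_scaleC: "bounded_linear (scaleC_ell2 c)"
  by (rule bounded_linear_intro[where K = "cmod c"])
    (auto simp: scaleC_add intro!: ell2_eqI)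

section \<open>Complex linearity and adjoints\<close>

lemma complex_linearD: "complex_linear T \<Longrightarrow> T (scaleC_ell2 c \<xi>) = scaleC_ell2 c (T \<xi>)"
  by (simp add: complex_linear_def)

text \<open>The function \<open>x \<mapsto> \<langle>T e\<^sub>x, \<xi>\<rangle>\<close> will be the adjoint of \<open>T\<close> applied to \<open>\<xi>\<close>.\<close>

lemma adj_coefficients:
  assumes T: "complex_linear T"
  shows "finite F \<Longrightarrow> (\<Sum>x\<in>F. (cmod (cinner_ell2 (T (ket x)) \<xi>))\<^sup>2) \<le> (norm T * norm \<xi>)\<^sup>2"
proof -
  assume F: "finite F"
  define c where "c x = cinner_ell2 (T (ket x)) \<xi>" for x
  \<comment> \<open>This vector is the truncation to \<open>F\<close> of the future adjoint vector.
    Pairing \<open>T \<eta>\<close> with \<xi> gives \<open>S\<close>, which is also the squared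
    norm of \<eta>, so one factor of that norm cancels from the Cauchy-Schwarz estimate.\<close>
  define \<eta> where "\<eta> = (\<Sum>x\<in>F. scaleC_ell2 (c x) (ket x))"
  define S where "S = (\<Sum>x\<in>F. (cmod (c x))\<^sup>2)"
  have Rep: "Rep_ell2 \<eta> x = (if x \<in> F then c x else 0)" for x
    using F by (simp add: \<eta>_def if_distrib cong: if_cong)
  have sq: "cnj z * z = complex_of_real ((cmod z)\<^sup>2)" for z
    by (metis complex_norm_square mult.commute)
  have "cinner_ell2 \<eta> \<eta> = (\<Sum>x\<in>F. cnj (c x) * Rep_ell2 \<eta> x)"
    by (subst (1) \<eta>_def) (simp add: cinner_sum_left)
  also have "\<dots> = of_real S"
    by (simp add: Rep S_def sq del: of_real_power)
  finally have n: "(norm \<eta>)\<^sup>2 = S"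
    by (simp add: cinner_self_norm of_real_eq_iff del: of_real_power)
  have "cinner_ell2 (T \<eta>) \<xi> = of_real S"
    by (simp add: \<eta>_def blinfun.sum_right complex_linearD[OF T] cinner_sum_left S_def sq
        flip: c_def del: of_real_power)
  then have "\<bar>S\<bar> \<le> norm (T \<eta>) * norm \<xi>"
    using cinner_Cauchy_Schwarz[of "T \<eta>" \<xi>] by simp
  also have "\<dots> \<le> norm T * norm \<eta> * norm \<xi>"
    by (intro mult_right_mono norm_blinfun) auto
  finally have "(norm \<eta>)\<^sup>2 \<le> (norm T * norm \<xi>) * norm \<eta>"
    using n by (simp add: mult_ac)
  then have "norm \<eta> \<le> norm T * norm \<xi>"
    by (cases "norm \<eta> = 0") (auto simp: power2_eq_square)
  then have "(norm \<eta>)\<^sup>2 \<le> (norm T * norm \<xi>)\<^sup>2"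
    by (intro power_mono) auto
  then show ?thesis by (simp add: n S_def c_def)
qed

text \<open>The coordinates of the adjoint vector are forced by testing against basis vectors, and
  the bound on finite partial sums shows that they are square-summable and depend boundedly on
  \<xi>.\<close>

lemma adj_ex:
  assumes T: "complex_linear T"
  shows "\<exists>S :: 'x oper. \<forall>\<xi> \<eta>. cinner_ell2 (S \<xi>) \<eta> = cinner_ell2 \<xi> (T \<eta>)"
proof -
  define c where "c \<xi> x = cinner_ell2 (T (ket x)) \<xi>" for \<xi> x
  have summ: "(\<lambda>x. (cmod (c \<xi> x))\<^sup>2) summable_on UNIV" for \<xi>
    by (rule nonneg_bdd_above_summable_on)
      (auto simp: c_def intro!: bdd_aboveI2 adj_coefficients[OF T])
  define S where "S \<xi> = Abs_ell2 (c \<xi>)" for \<xi>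
  have Rep: "Rep_ell2 (S \<xi>) x = cinner_ell2 (T (ket x)) \<xi>" for \<xi> x
    unfolding S_def using summ[of \<xi>] by (simp add: Abs_ell2_inverse c_def)
  have bl: "bounded_linear S"
  proof (rule bounded_linear_intro)
    show "S (\<xi> + \<eta>) = S \<xi> + S \<eta>" for \<xi> \<eta>
      by (rule ell2_eqI) (simp add: Rep cinner_add_right)
    show "S (r *\<^sub>R \<xi>) = r *\<^sub>R S \<xi>" for r \<xi>
      by (rule ell2_eqI) (simp add: Rep scaleR_conv_of_real flip: scaleC_of_real)
    show "norm (S \<xi>) \<le> norm \<xi> * norm T" for \<xi>
    proof (rule power2_le_imp_le)
      show "(norm (S \<xi>))\<^sup>2 \<le> (norm \<xi> * norm T)\<^sup>2"
        unfolding norm_ell2_sq Rep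
        using summ[of \<xi>] adj_coefficients[OF T, of _ \<xi>]
        by (intro infsum_le_finite_sums) (auto simp: c_def mult.commute)
    qed simp
  qed
  define B where "B = Blinfun S"
  have B: "blinfun_apply B = S" unfolding B_def by (rule bounded_linear_Blinfun_apply[OF bl])
  have Bc: "S (scaleC_ell2 c \<xi>) = scaleC_ell2 c (S \<xi>)" for c \<xi>
    by (rule ell2_eqI) (simp add: Rep)
  \<comment> \<open>For finite combinations of basis vectors the identity is immediate; both sides
    are continuous along the truncations of \<eta>, which converge to \<eta> in norm.\<close>
  have main: "cinner_ell2 \<eta> (S \<xi>) = cinner_ell2 (T \<eta>) \<xi>" for \<xi> \<eta>
  proof -
    have "((\<lambda>x. cnj (Rep_ell2 \<eta> x) * Rep_ell2 (S \<xi>) x) has_sum cinner_ell2 \<eta> (S \<xi>)) UNIV"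
      unfolding cinner_ell2_def by (rule has_sum_infsum[OF cinner_ell2_summable])
    then have lim1: "((\<lambda>F. cinner_ell2 (\<Sum>x\<in>F. scaleC_ell2 (Rep_ell2 \<eta> x) (ket x)) (S \<xi>))
        \<longlongrightarrow> cinner_ell2 \<eta> (S \<xi>)) (finite_subsets_at_top UNIV)"
      unfolding has_sum_def by (simp add: cinner_sum_left)
    have eq: "cinner_ell2 (\<Sum>x\<in>F. scaleC_ell2 (Rep_ell2 \<eta> x) (ket x)) (S \<xi>)
        = cinner_ell2 (T (\<Sum>x\<in>F. scaleC_ell2 (Rep_ell2 \<eta> x) (ket x))) \<xi>" for F
      by (simp add: cinner_sum_left blinfun.sum_right complex_linearD[OF T] Rep)
    have "((\<lambda>F. \<Sum>x\<in>F. scaleC_ell2 (Rep_ell2 \<eta> x) (ket x)) \<longlongrightarrow> \<eta>) (finite_subsets_at_top UNIV)"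
    proof (rule tendsto_norm_zero_iff[THEN iffD1, THEN Lim_null[THEN iffD2]])
      have "((\<lambda>x. (cmod (Rep_ell2 \<eta> x))\<^sup>2) has_sum (norm \<eta>)\<^sup>2) UNIV"
        unfolding norm_ell2_sq by (rule has_sum_infsum[OF ell2_summable])
      then have L0: "((\<lambda>F. (norm \<eta>)\<^sup>2 - (\<Sum>x\<in>F. (cmod (Rep_ell2 \<eta> x))\<^sup>2)) \<longlongrightarrow> 0)
          (finite_subsets_at_top UNIV)"
        unfolding has_sum_def
        using tendsto_diff[OF tendsto_const[of "(norm \<eta>)\<^sup>2"]] by fastforce
      \<comment> \<open>Pythagoras: the squared distance from \<eta> to its truncation is the
        remaining tail of the norm series.\<close>
      have L1: "(norm \<eta>)\<^sup>2 - (\<Sum>x\<in>F. (cmod (Rep_ell2 \<eta> x))\<^sup>2)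
          = (norm ((\<Sum>x\<in>F. scaleC_ell2 (Rep_ell2 \<eta> x) (ket x)) - \<eta>))\<^sup>2" if F: "finite F" for F
      proof -
        define \<zeta> where "\<zeta> = (\<Sum>x\<in>F. scaleC_ell2 (Rep_ell2 \<eta> x) (ket x))"
        have R: "Rep_ell2 \<zeta> x = (if x \<in> F then Rep_ell2 \<eta> x else 0)" for x
          using F by (simp add: \<zeta>_def if_distrib cong: if_cong)
        have sq: "cnj z * z = complex_of_real ((cmod z)\<^sup>2)" for z
          by (metis complex_norm_square mult.commute)
        define s where "s = (\<Sum>x\<in>F. (cmod (Rep_ell2 \<eta> x))\<^sup>2)"
        have 1: "cinner_ell2 \<zeta> \<omega> = (\<Sum>x\<in>F. cnj (Rep_ell2 \<eta> x) * Rep_ell2 \<omega> x)" for \<omega>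
          by (simp add: \<zeta>_def cinner_sum_left)
        have 2: "cinner_ell2 \<zeta> \<zeta> = of_real s" "cinner_ell2 \<zeta> \<eta> = of_real s"
          unfolding 1 by (simp_all add: R sq s_def del: of_real_power)
        have 3: "cinner_ell2 \<eta> \<zeta> = of_real s"
          by (subst cinner_ell2_commute) (simp add: 2)
        have "complex_of_real ((norm (\<zeta> - \<eta>))\<^sup>2) = of_real ((norm \<eta>)\<^sup>2 - s)"
          unfolding cinner_self_norm[symmetric] cinner_minus_left cinner_minus_right 2 3
          by (simp add: cinner_self_norm)
        then show ?thesis
          unfolding of_real_eq_iff s_def \<zeta>_def by simp
      qed
      have "((\<lambda>F. (norm ((\<Sum>x\<in>F. scaleC_ell2 (Rep_ell2 \<eta> x) (ket x)) - \<eta>))\<^sup>2) \<longlongrightarrow> 0)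
          (finite_subsets_at_top UNIV)"
        by (rule Lim_transform_eventually[OF L0])
          (auto intro!: eventually_finite_subsets_at_top_weakI simp: L1)
      then show "((\<lambda>F. norm ((\<Sum>x\<in>F. scaleC_ell2 (Rep_ell2 \<eta> x) (ket x)) - \<eta>)) \<longlongrightarrow> 0)
          (finite_subsets_at_top UNIV)"
        using tendsto_real_sqrt by fastforce
    qed
    then have lim2: "((\<lambda>F. cinner_ell2 (T (\<Sum>x\<in>F. scaleC_ell2 (Rep_ell2 \<eta> x) (ket x))) \<xi>)
        \<longlongrightarrow> cinner_ell2 (T \<eta>) \<xi>) (finite_subsets_at_top UNIV)"
      by (intro bounded_linear.tendsto[OF bounded_linear_cinner_left]
          bounded_linear.tendsto[OF blinfun.bounded_linear_right])
    show ?thesis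
      using tendsto_unique[OF _ lim1[unfolded eq] lim2] by simp
  qed
  have "cinner_ell2 (B \<xi>) \<eta> = cinner_ell2 \<xi> (T \<eta>)" for \<xi> \<eta>
    by (metis B main cinner_ell2_commute)
  then show ?thesis by blast
qed

lemma adj_eqI:
  fixes S T :: "'x oper"
  assumes "\<And>\<xi> \<eta>. cinner_ell2 (S \<xi>) \<eta> = cinner_ell2 \<xi> (T \<eta>)"
  shows "adj T = S"
  unfolding adj_def
proof (rule the_equality)
  fix S' :: "'x oper"
  assume "\<forall>\<xi> \<eta>. cinner_ell2 (S' \<xi>) \<eta> = cinner_ell2 \<xi> (T \<eta>)"
  then show "S' = S"
    using assms by (intro blinfun_eqI cinner_eqI_left) auto
qed (use assms in auto)

lemma cinner_adj_left:
  assumes "complex_linear T"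
  shows "cinner_ell2 (adj T \<xi>) \<eta> = cinner_ell2 \<xi> (T \<eta>)"
  using adj_ex[OF assms] adj_eqI by metis

lemma cinner_adj_right:
  assumes "complex_linear T"
  shows "cinner_ell2 \<xi> (adj T \<eta>) = cinner_ell2 (T \<xi>) \<eta>"
  by (metis assms cinner_adj_left cinner_ell2_commute)

lemma complex_linear_adj:
  assumes "complex_linear T"
  shows "complex_linear (adj T)"
  unfolding complex_linear_def
  by (auto intro!: cinner_eqI_right simp: cinner_adj_right[OF assms])

lemma adj_adj [simp]: "complex_linear T \<Longrightarrow> adj (adj T) = T"
  by (rule adj_eqI) (simp add: cinner_adj_right)

lemma complex_linear_intros:
  "complex_linear id_blinfun" "complex_linear 0" "complex_linear (scalar_op c)"
  "complex_linear S \<Longrightarrow> complex_linear T \<Longrightarrow> complex_linear (S + T)"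
  "complex_linear S \<Longrightarrow> complex_linear T \<Longrightarrow> complex_linear (S - T)"
  "complex_linear S \<Longrightarrow> complex_linear T \<Longrightarrow> complex_linear (S o\<^sub>L T)"
  "complex_linear S \<Longrightarrow> complex_linear (r *\<^sub>R S)"
  by (auto simp: complex_linear_def scalar_op.rep_eq blinfun.add_left blinfun.diff_left
      blinfun.scaleR_left mult_ac algebra_simps intro!: ell2_eqI)

lemma adj_id [simp]: "adj id_blinfun = id_blinfun"
  and adj_zero [simp]: "adj 0 = 0"
  by (auto intro!: adj_eqI)

lemma adj_add: "complex_linear S \<Longrightarrow> complex_linear T \<Longrightarrow> adj (S + T) = adj S + adj T"
  and adj_diff: "complex_linear S \<Longrightarrow> complex_linear T \<Longrightarrow> adj (S - T) = adj S - adj T"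
  and adj_compose: "complex_linear S \<Longrightarrow> complex_linear T \<Longrightarrow> adj (S o\<^sub>L T) = adj T o\<^sub>L adj S"
  by (auto intro!: adj_eqI simp: blinfun.add_left blinfun.diff_left cinner_ell2_add_left
      cinner_add_right cinner_minus_left cinner_minus_right cinner_adj_left)

lemma norm_adj_le:
  assumes "complex_linear T"
  shows "norm (adj T) \<le> norm T"
proof (rule norm_blinfun_bound)
  fix \<xi>
  have "(norm (adj T \<xi>))\<^sup>2 = cmod (cinner_ell2 \<xi> (T (adj T \<xi>)))"
    unfolding cinner_adj_left[OF assms, symmetric] cinner_self_norm by (simp del: of_real_power)
  also have "\<dots> \<le> norm \<xi> * norm (T (adj T \<xi>))"
    by (rule cinner_Cauchy_Schwarz)
  also have "\<dots> \<le> norm \<xi> * (norm T * norm (adj T \<xi>))"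
    by (intro mult_left_mono norm_blinfun) auto
  finally show "norm (adj T \<xi>) \<le> norm T * norm \<xi>"
    by (cases "norm (adj T \<xi>) = 0") (auto simp: power2_eq_square mult_ac)
qed simp

section \<open>Norm limits, and operators given by their coordinates\<close>

lemma closed_complex_linear: "closed {T. complex_linear T}"
proof -
  have "{T :: 'a oper. complex_linear T} =
      (\<Inter>c \<xi>. {T. blinfun_apply T (scaleC_ell2 c \<xi>) = scaleC_ell2 c (blinfun_apply T \<xi>)})"
    by (auto simp: complex_linear_def)
  also have "closed \<dots>"
    by (intro closed_INT ballI closed_Collect_eq
        linear_continuous_on bounded_linear_compose[OF bounded_linear_scaleC] blinfun.bounded_linear_left)
  finally show ?thesis .
qed

lemma tendsto_complex_linear:
  assumes "X \<longlonglongrightarrow> T" "\<And>n::nat. complex_linear (X n)"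
  shows "complex_linear T"
  using closed_sequentially[OF closed_complex_linear, of X T] assms by auto

lemma tendsto_adj:
  assumes "X \<longlonglongrightarrow> T" "\<And>n::nat. complex_linear (X n)"
  shows "(\<lambda>n. adj (X n)) \<longlonglongrightarrow> adj T"
proof -
  have T: "complex_linear T" by (rule tendsto_complex_linear) fact+
  have "(\<lambda>n. norm (X n - T)) \<longlonglongrightarrow> 0"
    using assms(1) by (simp add: LIM_zero tendsto_norm_zero)
  then have "(\<lambda>n. adj (X n) - adj T) \<longlonglongrightarrow> 0"
    by (rule Lim_null_comparison[rotated])
      (auto simp: norm_adj_le complex_linear_intros assms T simp flip: adj_diff)
  then show ?thesis by (rule LIM_zero_cancel)
qed

lemma tendsto_compose_oper:
  fixes S T :: "'x oper"
  assumes "(X \<longlongrightarrow> S) F" "(Y \<longlongrightarrow> T) F"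
  shows "((\<lambda>n. X n o\<^sub>L Y n) \<longlongrightarrow> S o\<^sub>L T) F"
  by (rule bounded_bilinear.tendsto[OF bounded_bilinear_blinfun_compose assms])

lemma oper_eqI: "(\<And>\<xi> g. Rep_ell2 (blinfun_apply S \<xi>) g = Rep_ell2 (blinfun_apply T \<xi>) g) \<Longrightarrow> S = T"
  by (intro blinfun_eqI ell2_eqI)

text \<open>Injectivity of \<tau> where \<open>m\<close> is nonzero prevents any coordinate of \<xi>
  from being counted twice, which gives the norm bound \<open>B\<close>. Multiplication by functions
  on the diagonal and the partial isometries of bisections are both of this form.\<close>

lemma weighted_composition_op:
  fixes m :: "'x \<Rightarrow> complex" and \<tau> :: "'x \<Rightarrow> 'x"
  assumes B: "\<And>g. cmod (m g) \<le> B" and inj: "inj_on \<tau> {g. m g \<noteq> 0}"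
  shows "\<exists>T :: 'x oper. complex_linear T \<and> (\<forall>\<xi> g. Rep_ell2 (T \<xi>) g = m g * Rep_ell2 \<xi> (\<tau> g))"
proof -
  have B0: "B \<ge> 0" using B norm_ge_zero order_trans by blast
  define c where "c \<xi> g = m g * Rep_ell2 \<xi> (\<tau> g)" for \<xi> g
  have bound: "(\<Sum>g\<in>F. (cmod (c \<xi> g))\<^sup>2) \<le> (norm \<xi> * B)\<^sup>2" if F: "finite F" for F \<xi>
  proof -
    define F' where "F' = F \<inter> {g. m g \<noteq> 0}"
    have F': "finite F'" "inj_on \<tau> F'" using F inj by (auto simp: F'_def inj_on_def)
    have "(\<Sum>g\<in>F. (cmod (c \<xi> g))\<^sup>2) = (\<Sum>g\<in>F'. (cmod (c \<xi> g))\<^sup>2)"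
      using F by (intro sum.mono_neutral_right) (auto simp: F'_def c_def)
    also have "\<dots> \<le> (\<Sum>g\<in>F'. B\<^sup>2 * (cmod (Rep_ell2 \<xi> (\<tau> g)))\<^sup>2)"
      unfolding c_def norm_mult power_mult_distrib
      by (intro sum_mono mult_right_mono power_mono B) auto
    also have "\<dots> = B\<^sup>2 * (\<Sum>h\<in>\<tau> ` F'. (cmod (Rep_ell2 \<xi> h))\<^sup>2)"
      using F'(2) by (simp add: sum.reindex sum_distrib_left)
    also have "\<dots> \<le> B\<^sup>2 * (norm \<xi>)\<^sup>2"
      using F'(1) by (intro mult_left_mono sum_le_norm_ell2) auto
    finally show ?thesis by (simp add: power_mult_distrib mult.commute)
  qed
  have summ: "(\<lambda>g. (cmod (c \<xi> g))\<^sup>2) summable_on UNIV" for \<xi>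
    by (rule nonneg_bdd_above_summable_on) (auto intro!: bdd_aboveI2 bound)
  define S where "S \<xi> = Abs_ell2 (c \<xi>)" for \<xi>
  have Rep: "Rep_ell2 (S \<xi>) g = m g * Rep_ell2 \<xi> (\<tau> g)" for \<xi> g
    unfolding S_def using summ[of \<xi>] by (simp add: Abs_ell2_inverse c_def)
  have bl: "bounded_linear S"
  proof (rule bounded_linear_intro)
    show "S (\<xi> + \<eta>) = S \<xi> + S \<eta>" for \<xi> \<eta>
      by (rule ell2_eqI) (simp add: Rep distrib_left)
    show "S (t *\<^sub>R \<xi>) = t *\<^sub>R S \<xi>" for t \<xi>
      by (rule ell2_eqI) (simp add: Rep)
    show "norm (S \<xi>) \<le> norm \<xi> * B" for \<xi>
    proof (rule power2_le_imp_le)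
      show "(norm (S \<xi>))\<^sup>2 \<le> (norm \<xi> * B)\<^sup>2"
        unfolding norm_ell2_sq[of "S \<xi>"] Rep
        using summ[of \<xi>] bound[of _ \<xi>]
        by (intro infsum_le_finite_sums) (auto simp: c_def)
    qed (use B0 in simp)
  qed
  have app: "blinfun_apply (Blinfun S) = S" by (rule bounded_linear_Blinfun_apply[OF bl])
  have "complex_linear (Blinfun S)"
    unfolding complex_linear_def app by (auto intro!: ell2_eqI simp: Rep)
  then show ?thesis using app Rep by metis
qed

text \<open>Agreement on basis vectors fixes every coordinate of the adjoints at an arbitrary
  vector, so passing through adjoints replaces a density argument.\<close>

lemma oper_ext:
  assumes "complex_linear S" "complex_linear T"
    and "\<And>g h. Rep_ell2 (S (ket h)) g = Rep_ell2 (T (ket h)) g"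
  shows "S = T"
proof -
  have "S (ket h) = T (ket h)" for h
    by (rule ell2_eqI) (rule assms)
  then have "adj S \<xi> = adj T \<xi>" for \<xi>
    by (metis assms(1,2) cinner_adj_right cinner_ket_left ell2_eqI)
  then have "adj S = adj T" by (rule blinfun_eqI)
  then show ?thesis using assms by (metis adj_adj)
qed

lemma Rep_oper:
  assumes "complex_linear T"
  shows "Rep_ell2 (T \<xi>) g = (\<Sum>\<^sub>\<infinity>h. Rep_ell2 (T (ket h)) g * Rep_ell2 \<xi> h)"
proof -
  have "Rep_ell2 (T \<xi>) g = cinner_ell2 (adj T (ket g)) \<xi>"
    by (simp add: cinner_adj_left[OF assms])
  also have "\<dots> = (\<Sum>\<^sub>\<infinity>h. cnj (cinner_ell2 (ket h) (adj T (ket g))) * Rep_ell2 \<xi> h)"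
    by (simp only: cinner_ket_left) (simp add: cinner_ell2_def)
  also have "\<dots> = (\<Sum>\<^sub>\<infinity>h. Rep_ell2 (T (ket h)) g * Rep_ell2 \<xi> h)"
    unfolding cinner_adj_right[OF assms] by simp
  finally show ?thesis .
qed

lemma Rep_adj:
  assumes "complex_linear T"
  shows "Rep_ell2 (adj T (ket h)) g = cnj (Rep_ell2 (T (ket g)) h)"
  using cinner_adj_right[OF assms, of "ket g" "ket h"] by simp

text \<open>This turns relations between projections into relations such as
  \<open>e o\<^sub>L v = v\<close>: the difference \<open>x\<close> of both sides is shown to
  satisfy \<open>adj x o\<^sub>L x = 0\<close>.\<close>

lemma adj_compose_self_eq_0:
  assumes T: "complex_linear T" and "adj T o\<^sub>L T = 0"
  shows "T = 0"
proof (rule blinfun_eqI)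
  fix \<xi>
  have "cinner_ell2 (T \<xi>) (T \<xi>) = cinner_ell2 \<xi> ((adj T o\<^sub>L T) \<xi>)"
    by (simp add: cinner_adj_right[OF T])
  then show "T \<xi> = blinfun_apply 0 \<xi>"
    by (simp add: assms cinner_self_norm)
qed

lemma scalar_op_of_real: "scalar_op (of_real r) = r *\<^sub>R id_blinfun"
  by (rule blinfun_eqI) (simp add: scalar_op.rep_eq scaleC_of_real blinfun.scaleR_left)

lemma compose_scalar_op: "complex_linear T \<Longrightarrow> T o\<^sub>L scalar_op c = scalar_op c o\<^sub>L T"
  by (rule blinfun_eqI) (simp add: scalar_op.rep_eq complex_linearD)

lemma id_neq_zero: "(id_blinfun :: 'x oper) \<noteq> 0"
proof
  assume "(id_blinfun :: 'x oper) = 0"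
  then have "blinfun_apply (id_blinfun :: 'x oper) (ket undefined) = blinfun_apply 0 (ket undefined)" by simp
  then have "norm (ket (undefined :: 'x)) = 0" by simp
  then show False by simp
qed

lemma compose_id [simp]: "a o\<^sub>L id_blinfun = a" "id_blinfun o\<^sub>L a = a"
  by (rule blinfun_eqI; simp)+

lemma compose_zero [simp]: "a o\<^sub>L 0 = 0" "0 o\<^sub>L a = 0"
  by (rule blinfun_eqI; simp)+

lemma comp_assoc: "(a o\<^sub>L b) o\<^sub>L c = a o\<^sub>L (b o\<^sub>L c)"
  by (rule blinfun_eqI) simp

lemmas comp_add_left = bounded_bilinear.add_left[OF bounded_bilinear_blinfun_compose]
lemmas comp_add_right = bounded_bilinear.add_right[OF bounded_bilinear_blinfun_compose]
lemmas comp_diff_left = bounded_bilinear.diff_left[OF bounded_bilinear_blinfun_compose]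
lemmas comp_diff_right = bounded_bilinear.diff_right[OF bounded_bilinear_blinfun_compose]
lemmas comp_sum_left = bounded_bilinear.sum_left[OF bounded_bilinear_blinfun_compose]
lemmas comp_scaleR_left = bounded_bilinear.scaleR_left[OF bounded_bilinear_blinfun_compose]

section \<open>Automorphisms of unital C*-algebras\<close>

lemma star_automorphismD:
  assumes "star_automorphism A \<phi>"
  shows "a \<in> A \<Longrightarrow> \<phi> a \<in> A"
    and "a \<in> A \<Longrightarrow> b \<in> A \<Longrightarrow> \<phi> (a + b) = \<phi> a + \<phi> b"
    and "a \<in> A \<Longrightarrow> b \<in> A \<Longrightarrow> \<phi> (a o\<^sub>L b) = \<phi> a o\<^sub>L \<phi> b"
    and "a \<in> A \<Longrightarrow> \<phi> (scalar_op c o\<^sub>L a) = scalar_op c o\<^sub>L \<phi> a"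
    and "a \<in> A \<Longrightarrow> \<phi> (adj a) = adj (\<phi> a)"
    and "b \<in> A \<Longrightarrow> \<exists>a\<in>A. \<phi> a = b"
    and "a \<in> A \<Longrightarrow> b \<in> A \<Longrightarrow> \<phi> a = \<phi> b \<longleftrightarrow> a = b"
proof -
  note * = assms[unfolded star_automorphism_def]
  note bij = *[THEN conjunct1] and 1 = *[THEN conjunct2, THEN conjunct1]
    and 2 = *[THEN conjunct2, THEN conjunct2, THEN conjunct1]
    and 3 = *[THEN conjunct2, THEN conjunct2, THEN conjunct2]
  show "a \<in> A \<Longrightarrow> \<phi> a \<in> A" using bij by (rule bij_betw_apply)
  show "a \<in> A \<Longrightarrow> b \<in> A \<Longrightarrow> \<phi> (a + b) = \<phi> a + \<phi> b" using 1 by blast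
  show "a \<in> A \<Longrightarrow> b \<in> A \<Longrightarrow> \<phi> (a o\<^sub>L b) = \<phi> a o\<^sub>L \<phi> b" using 1 by blast
  show "a \<in> A \<Longrightarrow> \<phi> (scalar_op c o\<^sub>L a) = scalar_op c o\<^sub>L \<phi> a" using 2 by blast
  show "a \<in> A \<Longrightarrow> \<phi> (adj a) = adj (\<phi> a)" using 3 by blast
  show "b \<in> A \<Longrightarrow> \<exists>a\<in>A. \<phi> a = b"     using bij_betw_imp_surj_on[OF bij] by (metis imageE)
  show "a \<in> A \<Longrightarrow> b \<in> A \<Longrightarrow> \<phi> a = \<phi> b \<longleftrightarrow> a = b"
    by (rule inj_on_eq_iff[OF bij_betw_imp_inj_on[OF bij]])
qed

text \<open>The unit is available because the Cantor unit space is compact. It identifies the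
  multiplier algebra with \<open>A\<close> itself.\<close>

locale unital_cstar =
  fixes A :: "'x oper set"
  assumes cstar: "cstar_algebra A" and id_mem [simp]: "id_blinfun \<in> A"
begin

lemma mem_linear [simp]: "a \<in> A \<Longrightarrow> complex_linear a"
  and zero_mem [simp]: "0 \<in> A"
  and add_mem [simp]: "a \<in> A \<Longrightarrow> b \<in> A \<Longrightarrow> a + b \<in> A"
  and comp_mem [simp]: "a \<in> A \<Longrightarrow> b \<in> A \<Longrightarrow> a o\<^sub>L b \<in> A"
  and adj_mem [simp]: "a \<in> A \<Longrightarrow> adj a \<in> A"
  and scalar_mem [simp]: "a \<in> A \<Longrightarrow> scalar_op c o\<^sub>L a \<in> A"
  and closed_mem: "closed A"
  using cstar by (auto simp: cstar_algebra_def)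

lemma scaleR_mem [simp]: "a \<in> A \<Longrightarrow> r *\<^sub>R a \<in> A"
  using scalar_mem[of a "of_real r"] by (simp add: scalar_op_of_real comp_scaleR_left)

lemma diff_mem [simp]: "a \<in> A \<Longrightarrow> b \<in> A \<Longrightarrow> a - b \<in> A"
  using add_mem[of a "(-1) *\<^sub>R b"] scaleR_mem[of b "-1"] by simp

lemma sum_mem: "(\<And>i. i \<in> F \<Longrightarrow> f i \<in> A) \<Longrightarrow> sum f F \<in> A"
  by (induction F rule: infinite_finite_induct) auto

text \<open>A left inverse inside \<open>A\<close> is enough: it can be pushed through an
  automorphism, and it contradicts \<open>no_left_inverse\<close> there. This takes the place of
  spectral radius arguments.\<close>

lemma neumann_inverse:
  assumes a: "a \<in> A" "norm a < 1"
  shows "\<exists>c\<in>A. c o\<^sub>L (id_blinfun - a) = id_blinfun"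
proof -
  define P where "P n = ((\<lambda>b. b o\<^sub>L a) ^^ n) id_blinfun" for n
  have P_Suc: "P (Suc n) = P n o\<^sub>L a" and P_0: "P 0 = id_blinfun" for n
    by (simp_all add: P_def)
  have P_mem: "P n \<in> A" for n
    by (induction n) (auto simp: P_0 P_Suc a)
  have P_norm: "norm (P n) \<le> norm a ^ n" for n
  proof (induction n)
    case (Suc n)
    have "norm (P (Suc n)) \<le> norm (P n) * norm a"
      unfolding P_Suc by (rule norm_blinfun_compose)
    also have "\<dots> \<le> norm a ^ n * norm a"
      using Suc by (intro mult_right_mono) auto
    finally show ?case by (simp add: mult.commute)
  qed (simp add: P_0 norm_blinfun_id_le)
  have summ: "summable (\<lambda>n. norm a ^ n)"
    using a by (intro summable_geometric) auto
  have "summable P"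
    by (rule summable_comparison_test'[OF summ]) (rule P_norm)
  then obtain c where c: "(\<lambda>N. \<Sum>n<N. P n) \<longlonglongrightarrow> c"
    unfolding summable_def sums_def by blast
  have tele: "(\<Sum>n<N. P n) o\<^sub>L (id_blinfun - a) = id_blinfun - P N" for N
  proof (induction N)
    case (Suc N)
    have "(\<Sum>n<Suc N. P n) o\<^sub>L (id_blinfun - a)
        = ((\<Sum>n<N. P n) o\<^sub>L (id_blinfun - a)) + (P N o\<^sub>L (id_blinfun - a))"
      by (simp add: comp_add_left)
    then show ?case
      unfolding Suc.IH by (simp add: comp_diff_right P_Suc)
  qed (simp add: P_0)
  have "P \<longlonglongrightarrow> 0"
    by (rule Lim_null_comparison[OF _ summable_LIMSEQ_zero[OF summ]]) (simp add: P_norm)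
  then have "(\<lambda>N. id_blinfun - P N) \<longlonglongrightarrow> id_blinfun - 0"
    by (intro tendsto_intros)
  moreover have "(\<lambda>N. (\<Sum>n<N. P n) o\<^sub>L (id_blinfun - a)) \<longlonglongrightarrow> (c o\<^sub>L (id_blinfun - a))"
    by (intro tendsto_compose_oper c tendsto_const)
  ultimately have "c o\<^sub>L (id_blinfun - a) = id_blinfun"
    unfolding tele using LIMSEQ_unique by fastforce
  moreover have "c \<in> A"
    using closed_sequentially[OF closed_mem _ c] by (simp add: sum_mem P_mem)
  ultimately show ?thesis by blast
qed

end

text \<open>This holds because \<open>\<parallel>b\<parallel>\<^sup>2\<close> is an approximate eigenvalue of \<open>b\<^sup>*b\<close>.\<close>

lemma no_left_inverse:
  assumes b: "complex_linear b" "norm b > 0"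
  shows "c o\<^sub>L (id_blinfun - (1 / (norm b)\<^sup>2) *\<^sub>R (adj b o\<^sub>L b)) \<noteq> id_blinfun"
proof
  assume inv: "c o\<^sub>L (id_blinfun - (1 / (norm b)\<^sup>2) *\<^sub>R (adj b o\<^sub>L b)) = id_blinfun"
  define M where "M = (norm b)\<^sup>2"
  define K where "K = (norm c)\<^sup>2"
  \<comment> \<open>The value is chosen so that \<open>K * (1 - t) < 1\<close>. A vector \<xi>
    nearly attaining the norm of \<open>b\<close> satisfies
    \<open>(norm (\<xi> - y))\<^sup>2 < (1 - t) * (norm \<xi>)\<^sup>2\<close>, while the left
    inverse \<open>c\<close> gives
    \<open>(norm \<xi>)\<^sup>2 \<le> K * (norm (\<xi> - y))\<^sup>2\<close>.\<close>
  define t where "t = 1 - 1 / (K + 1)"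
  define r where "r = norm b * sqrt t"
  have M: "M > 0" using b by (simp add: M_def)
  have K: "K \<ge> 0" by (simp add: K_def)
  have t: "0 \<le> t" "t < 1" using K by (auto simp: t_def)
  have "r < norm b * 1"
    unfolding r_def using t b by (intro mult_strict_left_mono) auto
  have "r \<ge> 0" using t b by (simp add: r_def)
  have "\<exists>\<xi>. norm (b \<xi>) > r * norm \<xi>"
  proof (rule ccontr)
    assume "\<not> ?thesis"
    then have "norm b \<le> r"
      using \<open>r \<ge> 0\<close> by (intro norm_blinfun_bound) (auto simp: not_less)
    then show False using \<open>r < norm b * 1\<close> by simp
  qed
  then obtain \<xi> where \<xi>: "norm (b \<xi>) > r * norm \<xi>" by blast
  have "(norm (b \<xi>))\<^sup>2 > (r * norm \<xi>)\<^sup>2"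
    using \<xi> \<open>r \<ge> 0\<close> by (intro power_strict_mono) auto
  then have bx: "(norm (b \<xi>))\<^sup>2 > M * t * (norm \<xi>)\<^sup>2"
    using t by (simp add: r_def M_def power_mult_distrib)
  define y where "y = (1 / M) *\<^sub>R adj b (b \<xi>)"
  have "inner \<xi> (adj b (b \<xi>)) = (norm (b \<xi>))\<^sup>2"
    by (simp add: inner_ell2_def cinner_adj_right[OF b(1)] cinner_self_norm del: of_real_power)
  then have iy: "inner \<xi> y = (norm (b \<xi>))\<^sup>2 / M"
    by (simp add: y_def)
  have "norm (adj b (b \<xi>)) \<le> norm b * norm (b \<xi>)"
    by (rule order_trans[OF norm_blinfun]) (auto intro!: mult_right_mono norm_adj_le b)
  then have "(norm (adj b (b \<xi>)))\<^sup>2 \<le> (norm b * norm (b \<xi>))\<^sup>2"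
    by (intro power_mono) auto
  then have ny: "(norm y)\<^sup>2 \<le> (norm (b \<xi>))\<^sup>2 / M"
    using M by (simp add: y_def M_def power_mult_distrib power_divide field_simps power2_eq_square)
  have "(norm (\<xi> - y))\<^sup>2 = (norm \<xi>)\<^sup>2 - 2 * inner \<xi> y + (norm y)\<^sup>2"
    by (simp add: power2_norm_eq_inner inner_diff_left inner_diff_right inner_commute algebra_simps)
  also have "\<dots> \<le> (norm \<xi>)\<^sup>2 - (norm (b \<xi>))\<^sup>2 / M"
    using iy ny by simp
  also have "\<dots> < (norm \<xi>)\<^sup>2 - t * (norm \<xi>)\<^sup>2"
    using bx M by (simp add: field_simps)
  finally have 1: "(norm (\<xi> - y))\<^sup>2 < (norm \<xi>)\<^sup>2 / (K + 1)"
    by (simp add: t_def algebra_simps)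
  have "\<xi> = c (\<xi> - y)"
    using arg_cong[OF inv, of "\<lambda>T. blinfun_apply T \<xi>"]
    by (simp add: blinfun.diff_left blinfun.scaleR_left y_def M_def)
  then have "(norm \<xi>)\<^sup>2 \<le> (norm c * norm (\<xi> - y))\<^sup>2"
    by (intro power_mono) (metis norm_blinfun, simp)
  also have "\<dots> = K * (norm (\<xi> - y))\<^sup>2"
    by (simp add: K_def power_mult_distrib)
  also have "\<dots> \<le> K * ((norm \<xi>)\<^sup>2 / (K + 1))"
    using 1 K by (intro mult_left_mono) auto
  finally have "(norm \<xi>)\<^sup>2 * (K + 1) \<le> K * (norm \<xi>)\<^sup>2"
    using K by (simp add: field_simps)
  then have "(norm \<xi>)\<^sup>2 \<le> 0" by (simp add: algebra_simps)
  then show False using \<xi> by simp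
qed

context unital_cstar
begin

lemma auto_id:
  assumes \<phi>: "star_automorphism A \<phi>"
  shows "\<phi> id_blinfun = id_blinfun"
proof -
  obtain b where b: "b \<in> A" "\<phi> b = id_blinfun"
    using star_automorphismD(6)[OF \<phi> id_mem] by blast
  have "\<phi> id_blinfun o\<^sub>L \<phi> b = \<phi> b"
    using star_automorphismD(3)[OF \<phi> id_mem b(1)] by simp
  then show ?thesis by (simp add: b)
qed

lemma auto_zero:
  assumes \<phi>: "star_automorphism A \<phi>"
  shows "\<phi> 0 = 0"
  using star_automorphismD(2)[OF \<phi> zero_mem zero_mem] by (metis add_cancel_right_right add_0)

lemma auto_diff:
  assumes \<phi>: "star_automorphism A \<phi>" and "a \<in> A" "b \<in> A"
  shows "\<phi> (a - b) = \<phi> a - \<phi> b"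
proof -
  have "\<phi> ((a - b) + b) = \<phi> (a - b) + \<phi> b"
    using assms(2,3) by (intro star_automorphismD(2)[OF \<phi>]) auto
  then show ?thesis by (simp add: algebra_simps)
qed

lemma auto_scaleR:
  assumes \<phi>: "star_automorphism A \<phi>" and "a \<in> A"
  shows "\<phi> (r *\<^sub>R a) = r *\<^sub>R \<phi> a"
proof -
  have "scalar_op (of_real r) o\<^sub>L b = r *\<^sub>R b" for b :: "'x oper"
    by (simp add: scalar_op_of_real comp_scaleR_left)
  then show ?thesis
    using star_automorphismD(4)[OF \<phi> assms(2)] by metis
qed

lemma auto_sum:
  assumes \<phi>: "star_automorphism A \<phi>" and "\<And>i. i \<in> F \<Longrightarrow> f i \<in> A"
  shows "\<phi> (sum f F) = (\<Sum>i\<in>F. \<phi> (f i))"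
  using assms(2)
proof (induction F rule: infinite_finite_induct)
  case (insert x F)
  have "\<phi> (f x + sum f F) = \<phi> (f x) + \<phi> (sum f F)"
    using insert.prems by (intro star_automorphismD(2)[OF \<phi>] sum_mem) auto
  then show ?case using insert by simp
qed (simp_all add: auto_zero[OF \<phi>])

text \<open>If \<phi> increased the norm of \<open>a\<close>, then \<open>adj a o\<^sub>L a\<close>
  divided by the square of the norm of \<open>b = \<phi> a\<close> would have norm below 1, and the
  left inverse from the Neumann series would be carried by \<phi> to a left inverse that cannot
  exist. The conclusion provides the continuity of automorphisms.\<close>

lemma norm_auto_le:
  assumes \<phi>: "star_automorphism A \<phi>" and a: "a \<in> A"
  shows "norm (\<phi> a) \<le> norm a"
proof (rule ccontr)
  assume "\<not> ?thesis"
  then have less: "norm a < norm (\<phi> a)" by simp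
  define b where "b = \<phi> a"
  define x where "x = (1 / (norm b)\<^sup>2) *\<^sub>R (adj a o\<^sub>L a)"
  have b: "b \<in> A" using star_automorphismD(1)[OF \<phi> a] by (simp add: b_def)
  have pos: "norm b > 0" using less norm_ge_zero[of a] unfolding b_def by linarith
  have x: "x \<in> A" using a by (simp add: x_def)
  have "norm (adj a o\<^sub>L a) \<le> norm (adj a) * norm a"
    by (rule norm_blinfun_compose)
  also have "\<dots> \<le> norm a * norm a"
    using a by (intro mult_right_mono norm_adj_le) auto
  also have "\<dots> < (norm b)\<^sup>2"
    using less power_strict_mono[of "norm a" "norm b" 2] by (simp add: b_def power2_eq_square)
  finally have "norm x < 1"
    using pos by (simp add: x_def field_simps)
  then obtain c where c: "c \<in> A" "c o\<^sub>L (id_blinfun - x) = id_blinfun"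
    using neumann_inverse[OF x] by blast
  have "\<phi> c o\<^sub>L (id_blinfun - \<phi> x) = id_blinfun"
    using arg_cong[OF c(2), of \<phi>] c(1) x
    by (simp add: star_automorphismD(3)[OF \<phi>] auto_id[OF \<phi>] auto_diff[OF \<phi>])
  moreover have "\<phi> x = (1 / (norm b)\<^sup>2) *\<^sub>R (adj b o\<^sub>L b)"
    using a unfolding x_def b_def
    by (simp add: auto_scaleR[OF \<phi>] star_automorphismD(3,5)[OF \<phi>])
  ultimately show False
    using no_left_inverse[OF mem_linear[OF b] pos] by metis
qed

lemma tendsto_auto:
  assumes \<phi>: "star_automorphism A \<phi>" and X: "\<And>n::nat. X n \<in> A" "X \<longlonglongrightarrow> T"
  shows "(\<lambda>n. \<phi> (X n)) \<longlonglongrightarrow> \<phi> T"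
proof -
  have T: "T \<in> A" using closed_sequentially[OF closed_mem] X by blast
  have "(\<lambda>n. norm (X n - T)) \<longlonglongrightarrow> 0"
    using X(2) by (simp add: LIM_zero tendsto_norm_zero)
  then have "(\<lambda>n. \<phi> (X n) - \<phi> T) \<longlonglongrightarrow> 0"
    by (rule Lim_null_comparison[rotated])
      (auto simp: X T norm_auto_le[OF \<phi>] simp flip: auto_diff[OF \<phi>])
  then show ?thesis by (rule LIM_zero_cancel)
qed

end

section \<open>Block matrices and crossed products\<close>

lemma Rep_slice [simp]: "Rep_ell2 (slice \<xi> \<gamma>) x = Rep_ell2 \<xi> (\<gamma>, x)"
  by (simp add: slice.rep_eq)

lemma slice_eqI: "(\<And>\<gamma>. slice \<xi> \<gamma> = slice \<eta> \<gamma>) \<Longrightarrow> \<xi> = \<eta>"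
  by (rule ell2_eqI) (metis Rep_slice surj_pair)

lift_definition embed_slice :: "'k \<Rightarrow> 'x ell2 \<Rightarrow> ('k \<times> 'x) ell2" is
  "\<lambda>\<gamma> f (\<delta>, x). if \<delta> = \<gamma> then f x else 0"
proof -
  fix \<gamma> :: 'k and f :: "'x \<Rightarrow> complex"
  assume f: "(\<lambda>x. (cmod (f x))\<^sup>2) summable_on UNIV"
  have "(\<lambda>z. (cmod (f (snd z)))\<^sup>2) summable_on Pair \<gamma> ` UNIV"
    by (subst summable_on_reindex) (auto simp: o_def inj_on_def f)
  then show "(\<lambda>z. (cmod (case z of (\<delta>, x) \<Rightarrow> if \<delta> = \<gamma> then f x else 0))\<^sup>2) summable_on UNIV"
    by (rule summable_on_cong_neutral[THEN iffD1, rotated -1]) auto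
qed

lemma Rep_embed_slice [simp]:
  "Rep_ell2 (embed_slice \<gamma> \<xi>) (\<delta>, x) = (if \<delta> = \<gamma> then Rep_ell2 \<xi> x else 0)"
  by (simp add: embed_slice.rep_eq)

lemma slice_embed_slice [simp]: "slice (embed_slice \<gamma> \<xi>) \<delta> = (if \<delta> = \<gamma> then \<xi> else 0)"
  by (auto intro!: ell2_eqI)

lemma slice_add [simp]: "slice (\<xi> + \<eta>) \<gamma> = slice \<xi> \<gamma> + slice \<eta> \<gamma>"
  and slice_zero [simp]: "slice 0 \<gamma> = 0"
  and slice_scaleC [simp]: "slice (scaleC_ell2 c \<xi>) \<gamma> = scaleC_ell2 c (slice \<xi> \<gamma>)"
  and slice_scaleR [simp]: "slice (r *\<^sub>R \<xi>) \<gamma> = r *\<^sub>R slice \<xi> \<gamma>"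
  by (auto intro!: ell2_eqI)

lemma slice_sum [simp]: "slice (sum f F) \<gamma> = (\<Sum>i\<in>F. slice (f i) \<gamma>)"
  by (induction F rule: infinite_finite_induct) auto

lemma cinner_embed_slice_left: "cinner_ell2 (embed_slice \<gamma> \<xi>) \<eta> = cinner_ell2 \<xi> (slice \<eta> \<gamma>)"
proof -
  have "cinner_ell2 (embed_slice \<gamma> \<xi>) \<eta> =
      (\<Sum>\<^sub>\<infinity>z\<in>Pair \<gamma> ` UNIV. cnj (Rep_ell2 \<xi> (snd z)) * Rep_ell2 \<eta> z)"
    unfolding cinner_ell2_def by (rule infsum_cong_neutral) auto
  also have "\<dots> = cinner_ell2 \<xi> (slice \<eta> \<gamma>)"
    unfolding cinner_ell2_def by (subst infsum_reindex) (auto simp: o_def inj_on_def)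
  finally show ?thesis .
qed

lemma norm_embed_slice [simp]: "norm (embed_slice \<gamma> \<xi>) = norm \<xi>"
proof -
  have "cinner_ell2 (embed_slice \<gamma> \<xi>) (embed_slice \<gamma> \<xi>) = cinner_ell2 \<xi> \<xi>"
    by (simp add: cinner_embed_slice_left)
  then have "(norm (embed_slice \<gamma> \<xi>))\<^sup>2 = (norm \<xi>)\<^sup>2"
    unfolding cinner_self_norm of_real_eq_iff .
  then show ?thesis by simp
qed

lemma norm_slice_le: "norm (slice \<xi> \<gamma>) \<le> norm \<xi>"
proof -
  have "(norm (slice \<xi> \<gamma>))\<^sup>2 = cmod (cinner_ell2 (embed_slice \<gamma> (slice \<xi> \<gamma>)) \<xi>)"
    unfolding cinner_embed_slice_left cinner_self_norm by (simp del: of_real_power)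
  also have "\<dots> \<le> norm (slice \<xi> \<gamma>) * norm \<xi>"
    using cinner_Cauchy_Schwarz[of "embed_slice \<gamma> (slice \<xi> \<gamma>)" \<xi>] by simp
  finally show ?thesis
    by (cases "norm (slice \<xi> \<gamma>) = 0") (auto simp: power2_eq_square)
qed

lift_definition embed_op :: "'k \<Rightarrow> 'x ell2 \<Rightarrow>\<^sub>L ('k \<times> 'x) ell2" is embed_slice
  by (rule bounded_linear_intro[where K = 1]) (auto intro!: slice_eqI)

lift_definition slice_op :: "'k \<Rightarrow> ('k \<times> 'x) ell2 \<Rightarrow>\<^sub>L 'x ell2" is "\<lambda>\<gamma> \<xi>. slice \<xi> \<gamma>"
  by (rule bounded_linear_intro[where K = 1]) (auto simp: norm_slice_le)

declare embed_op.rep_eq [simp] slice_op.rep_eq [simp]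

definition block_op :: "'k set \<Rightarrow> ('k \<Rightarrow> 'k \<Rightarrow> 'x oper) \<Rightarrow> ('k \<times> 'x) oper" where
  "block_op K X = (\<Sum>\<gamma>\<in>K. \<Sum>\<delta>\<in>K. embed_op \<gamma> o\<^sub>L X \<gamma> \<delta> o\<^sub>L slice_op \<delta>)"

text \<open>Compression to one entry is norm continuous, which makes the entries of a convergent
  sequence of operator matrices converge.\<close>

definition block :: "'k \<Rightarrow> 'k \<Rightarrow> ('k \<times> 'x) oper \<Rightarrow> 'x oper" where
  "block \<gamma> \<delta> T = slice_op \<gamma> o\<^sub>L T o\<^sub>L embed_op \<delta>"

lemma block_op_apply:
  "block_op K X \<xi> = (\<Sum>\<gamma>\<in>K. \<Sum>\<delta>\<in>K. embed_slice \<gamma> (X \<gamma> \<delta> (slice \<xi> \<delta>)))"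
  by (simp add: block_op_def blinfun.sum_left)

lemma slice_block_op:
  assumes "finite K"
  shows "slice (block_op K X \<xi>) \<gamma> = (if \<gamma> \<in> K then \<Sum>\<delta>\<in>K. X \<gamma> \<delta> (slice \<xi> \<delta>) else 0)"
proof -
  have "slice (block_op K X \<xi>) \<gamma> =
      (\<Sum>\<gamma>'\<in>K. if \<gamma> = \<gamma>' then \<Sum>\<delta>\<in>K. X \<gamma>' \<delta> (slice \<xi> \<delta>) else 0)"
    unfolding block_op_apply slice_sum by (intro sum.cong) auto
  then show ?thesis using assms by simp
qed

lemma slice_oper_eqI: "(\<And>\<xi> \<gamma>. slice (blinfun_apply S \<xi>) \<gamma> = slice (blinfun_apply T \<xi>) \<gamma>) \<Longrightarrow> S = T"
  by (intro blinfun_eqI slice_eqI)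

lemma block_block_op:
  assumes "finite K" "\<gamma> \<in> K" "\<delta> \<in> K"
  shows "block \<gamma> \<delta> (block_op K X) = X \<gamma> \<delta>"
  using assms
  by (intro blinfun_eqI)
    (simp add: block_def slice_block_op if_distrib[of "blinfun_apply _"] cong: if_cong)

lemma tendsto_block: "(Y \<longlongrightarrow> T) F \<Longrightarrow> ((\<lambda>n. block \<gamma> \<delta> (Y n)) \<longlongrightarrow> block \<gamma> \<delta> T) F"
  unfolding block_def
  by (intro bounded_bilinear.tendsto[OF bounded_bilinear_blinfun_compose] tendsto_const)

lemma block_op_cong: "(\<And>\<gamma> \<delta>. \<gamma> \<in> K \<Longrightarrow> \<delta> \<in> K \<Longrightarrow> X \<gamma> \<delta> = Y \<gamma> \<delta>) \<Longrightarrow> block_op K X = block_op K Y"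
  by (simp add: block_op_def cong: sum.cong)

lemma block_op_comp:
  assumes K: "finite K"
  shows "block_op K X o\<^sub>L block_op K Y = block_op K (\<lambda>\<gamma> \<epsilon>. \<Sum>\<delta>\<in>K. X \<gamma> \<delta> o\<^sub>L Y \<delta> \<epsilon>)"
proof (rule slice_oper_eqI)
  fix \<xi> \<gamma>
  have "(\<Sum>\<delta>\<in>K. X \<gamma> \<delta> (\<Sum>\<epsilon>\<in>K. Y \<delta> \<epsilon> (slice \<xi> \<epsilon>))) =
      (\<Sum>\<epsilon>\<in>K. (\<Sum>\<delta>\<in>K. X \<gamma> \<delta> o\<^sub>L Y \<delta> \<epsilon>) (slice \<xi> \<epsilon>))"
    by (simp add: blinfun.sum_left blinfun.sum_right) (rule sum.swap)
  then show "slice ((block_op K X o\<^sub>L block_op K Y) \<xi>) \<gamma> =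
      slice (block_op K (\<lambda>\<gamma> \<epsilon>. \<Sum>\<delta>\<in>K. X \<gamma> \<delta> o\<^sub>L Y \<delta> \<epsilon>) \<xi>) \<gamma>"
    by (simp add: slice_block_op[OF K] cong: sum.cong)
qed

lemma block_op_add: "block_op K X + block_op K Y = block_op K (\<lambda>\<gamma> \<delta>. X \<gamma> \<delta> + Y \<gamma> \<delta>)"
  by (simp add: block_op_def comp_add_left comp_add_right sum.distrib)

lemma complex_linear_block_op:
  assumes "\<And>\<gamma> \<delta>. \<gamma> \<in> K \<Longrightarrow> \<delta> \<in> K \<Longrightarrow> complex_linear (X \<gamma> \<delta>)"
  shows "complex_linear (block_op K X)"
proof -
  have "scaleC_ell2 c (sum f F) = (\<Sum>i\<in>F. scaleC_ell2 c (f i))" for c and f :: "'a \<Rightarrow> ('a \<times> 'b) ell2" and F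
    by (induction F rule: infinite_finite_induct) (auto simp: scaleC_add)
  moreover have "embed_slice \<gamma> (scaleC_ell2 c \<xi>) = scaleC_ell2 c (embed_slice \<gamma> \<xi>)"
    for c and \<gamma> :: 'a and \<xi> :: "'b ell2"
    by (rule slice_eqI) auto
  ultimately show ?thesis
    unfolding complex_linear_def block_op_apply
    by (auto simp: complex_linearD[OF assms] intro!: sum.cong)
qed

lemma adj_block_op:
  assumes X: "\<And>\<gamma> \<delta>. \<gamma> \<in> K \<Longrightarrow> \<delta> \<in> K \<Longrightarrow> complex_linear (X \<gamma> \<delta>)"
  shows "adj (block_op K X) = block_op K (\<lambda>\<gamma> \<delta>. adj (X \<delta> \<gamma>))"
proof (rule adj_eqI)
  fix \<xi> \<eta>
  have "cinner_ell2 (block_op K (\<lambda>\<gamma> \<delta>. adj (X \<delta> \<gamma>)) \<xi>) \<eta> =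
      (\<Sum>\<gamma>\<in>K. \<Sum>\<delta>\<in>K. cinner_ell2 (slice \<xi> \<delta>) (X \<delta> \<gamma> (slice \<eta> \<gamma>)))"
    by (simp add: block_op_apply cinner_sum_left cinner_embed_slice_left cinner_adj_left[OF X]
        cong: sum.cong)
  also have "\<dots> = (\<Sum>\<delta>\<in>K. \<Sum>\<gamma>\<in>K. cinner_ell2 (slice \<xi> \<delta>) (X \<delta> \<gamma> (slice \<eta> \<gamma>)))"
    by (rule sum.swap)
  also have "\<dots> = cinner_ell2 \<xi> (block_op K X \<eta>)"
  proof -
    have "cinner_ell2 \<xi> (embed_slice \<gamma> \<zeta>) = cinner_ell2 (slice \<xi> \<gamma>) \<zeta>" for \<gamma> and \<zeta> :: "'b ell2"
      by (subst (1 2) cinner_ell2_commute) (simp add: cinner_embed_slice_left)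
    then show ?thesis by (simp add: block_op_apply cinner_sum_right)
  qed
  finally show "cinner_ell2 (block_op K (\<lambda>\<gamma> \<delta>. adj (X \<delta> \<gamma>)) \<xi>) \<eta> = cinner_ell2 \<xi> (block_op K X \<eta>)" .
qed

lemma scalar_block_op:
  assumes K: "finite K"
  shows "scalar_op c o\<^sub>L block_op K X = block_op K (\<lambda>\<gamma> \<delta>. scalar_op c o\<^sub>L X \<gamma> \<delta>)"
proof (rule slice_oper_eqI)
  have "scaleC_ell2 c (sum f F) = (\<Sum>i\<in>F. scaleC_ell2 c (f i))" for f :: "'a \<Rightarrow> 'b ell2" and F
    by (induction F rule: infinite_finite_induct) (auto simp: scaleC_add)
  then show "slice ((scalar_op c o\<^sub>L block_op K X) \<xi>) \<gamma> =
      slice (block_op K (\<lambda>\<gamma> \<delta>. scalar_op c o\<^sub>L X \<gamma> \<delta>) \<xi>) \<gamma>" for \<xi> \<gamma>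
    by (simp add: slice_block_op[OF K] scalar_op.rep_eq)
qed

lemma tendsto_block_op:
  assumes "\<And>\<gamma> \<delta>. \<gamma> \<in> K \<Longrightarrow> \<delta> \<in> K \<Longrightarrow> ((\<lambda>n. X n \<gamma> \<delta>) \<longlongrightarrow> Y \<gamma> \<delta>) F"
  shows "((\<lambda>n. block_op K (X n)) \<longlongrightarrow> block_op K Y) F"
  unfolding block_op_def
  by (intro tendsto_sum bounded_bilinear.tendsto[OF bounded_bilinear_blinfun_compose]
      tendsto_const assms)

section \<open>Coefficients of elements of a crossed product by a finite abelian group\<close>

locale finite_cstar_action = unital_cstar A + comm_group \<Gamma>
  for A :: "'x oper set" and \<Gamma> :: "'k monoid" (structure) +
  fixes \<alpha> :: "'k \<Rightarrow> 'x oper \<Rightarrow> 'x oper"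
  assumes fin: "finite (carrier \<Gamma>)" and action: "cstar_action \<Gamma> A \<alpha>"
begin

lemma auto: "\<gamma> \<in> carrier \<Gamma> \<Longrightarrow> star_automorphism A (\<alpha> \<gamma>)"
  and act_one: "a \<in> A \<Longrightarrow> \<alpha> \<one> a = a"
  and act_mult: "\<gamma> \<in> carrier \<Gamma> \<Longrightarrow> \<delta> \<in> carrier \<Gamma> \<Longrightarrow> a \<in> A \<Longrightarrow> \<alpha> (\<gamma> \<otimes> \<delta>) a = \<alpha> \<gamma> (\<alpha> \<delta> a)"
  using action by (auto simp: cstar_action_def)

lemmas act_mem [simp] = star_automorphismD(1)[OF auto]
lemmas act_add = star_automorphismD(2)[OF auto]
lemmas act_comp = star_automorphismD(3)[OF auto]
lemmas act_scalar = star_automorphismD(4)[OF auto]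
lemmas act_adj = star_automorphismD(5)[OF auto]
lemmas act_zero [simp] = auto_zero[OF auto]
lemmas act_sum = auto_sum[OF auto]

lemma act_inv1 [simp]: "\<gamma> \<in> carrier \<Gamma> \<Longrightarrow> a \<in> A \<Longrightarrow> \<alpha> (inv \<gamma>) (\<alpha> \<gamma> a) = a"
  and act_inv2 [simp]: "\<gamma> \<in> carrier \<Gamma> \<Longrightarrow> a \<in> A \<Longrightarrow> \<alpha> \<gamma> (\<alpha> (inv \<gamma>) a) = a"
  by (simp_all add: act_one flip: act_mult)

text \<open>This is the matrix of the sum of all
  \<open>\<pi> (a \<delta>) \<lambda>\<^sub>\<delta>\<close> in the regular covariant
  representation. The row of the identity is untwisted, so the coefficients can be read off
  there.\<close>

definition crossed_op :: "('k \<Rightarrow> 'x oper) \<Rightarrow> ('k \<times> 'x) oper" where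
  "crossed_op a = block_op (carrier \<Gamma>) (\<lambda>\<gamma> \<delta>. \<alpha> (inv \<gamma>) (a (\<gamma> \<otimes> inv \<delta>)))"

text \<open>The whole crossed product, the copy of \<open>D\<close>, and the abelian algebra
  generated by \<open>D\<close> and a cocycle are all described by prescribing a space of
  coefficients in each degree; a common format lets them share one proof of the C*-axioms.\<close>

definition graded :: "('k \<Rightarrow> 'x oper set) \<Rightarrow> ('k \<times> 'x) oper set" where
  "graded E = {T. \<exists>a. (\<forall>\<delta>\<in>carrier \<Gamma>. a \<delta> \<in> E \<delta>) \<and> T = crossed_op a}"

lemma gradedI: "(\<And>\<delta>. \<delta> \<in> carrier \<Gamma> \<Longrightarrow> a \<delta> \<in> E \<delta>) \<Longrightarrow> crossed_op a \<in> graded E"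
  unfolding graded_def by blast

lemma gradedE:
  assumes "T \<in> graded E"
  obtains a where "\<And>\<delta>. \<delta> \<in> carrier \<Gamma> \<Longrightarrow> a \<delta> \<in> E \<delta>" "T = crossed_op a"
  using assms unfolding graded_def by blast

lemma bij_quotient: "\<gamma> \<in> carrier \<Gamma> \<Longrightarrow> bij_betw (\<lambda>\<delta>. \<gamma> \<otimes> inv \<delta>) (carrier \<Gamma>) (carrier \<Gamma>)"
proof (rule bij_betwI[where g = "\<lambda>\<delta>. inv \<delta> \<otimes> \<gamma>"])
  show "inv (\<gamma> \<otimes> inv x) \<otimes> \<gamma> = x" if "\<gamma> \<in> carrier \<Gamma>" "x \<in> carrier \<Gamma>" for x
    using that by (simp add: inv_mult_group m_assoc)
  show "\<gamma> \<otimes> inv (inv y \<otimes> \<gamma>) = y" if "\<gamma> \<in> carrier \<Gamma>" "y \<in> carrier \<Gamma>" for y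
    using that by (simp add: inv_mult_group flip: m_assoc)
qed auto

lemma is_crossed_rep_iff:
  assumes a: "\<And>\<delta>. \<delta> \<in> carrier \<Gamma> \<Longrightarrow> a \<delta> \<in> A"
  shows "is_crossed_rep \<Gamma> \<alpha> a T \<longleftrightarrow> T = crossed_op a"
proof -
  have "(\<Sum>\<delta> | \<delta> \<in> carrier \<Gamma> \<and> a \<delta> \<noteq> 0. blinfun_apply (\<alpha> (inv \<gamma>) (a \<delta>)) (slice \<xi> (inv \<delta> \<otimes> \<gamma>)))
      = (\<Sum>\<delta>\<in>carrier \<Gamma>. blinfun_apply (\<alpha> (inv \<gamma>) (a (\<gamma> \<otimes> inv \<delta>))) (slice \<xi> \<delta>))"
    if \<gamma>: "\<gamma> \<in> carrier \<Gamma>" for \<gamma> and \<xi> :: "('k \<times> 'x) ell2"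
  proof -
    have "(\<Sum>\<delta> | \<delta> \<in> carrier \<Gamma> \<and> a \<delta> \<noteq> 0. blinfun_apply (\<alpha> (inv \<gamma>) (a \<delta>)) (slice \<xi> (inv \<delta> \<otimes> \<gamma>)))
        = (\<Sum>\<delta>\<in>carrier \<Gamma>. blinfun_apply (\<alpha> (inv \<gamma>) (a \<delta>)) (slice \<xi> (inv \<delta> \<otimes> \<gamma>)))"
      using \<gamma> by (intro sum.mono_neutral_left fin) auto
    also have "\<dots> = (\<Sum>\<delta>\<in>carrier \<Gamma>. blinfun_apply (\<alpha> (inv \<gamma>) (a (\<gamma> \<otimes> inv \<delta>)))
        (slice \<xi> (inv (\<gamma> \<otimes> inv \<delta>) \<otimes> \<gamma>)))"
      by (rule sum.reindex_bij_betw[OF bij_quotient[OF \<gamma>], symmetric])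
    also have "\<dots> = (\<Sum>\<delta>\<in>carrier \<Gamma>. blinfun_apply (\<alpha> (inv \<gamma>) (a (\<gamma> \<otimes> inv \<delta>))) (slice \<xi> \<delta>))"
      using \<gamma> by (intro sum.cong) (auto simp: inv_mult_group m_assoc)
    finally show ?thesis .
  qed
  then have "is_crossed_rep \<Gamma> \<alpha> a T \<longleftrightarrow>
      (\<forall>\<xi> \<gamma>. slice (blinfun_apply T \<xi>) \<gamma> = slice (blinfun_apply (crossed_op a) \<xi>) \<gamma>)"
    unfolding is_crossed_rep_def crossed_op_def by (auto simp: slice_block_op[OF fin])
  then show ?thesis using slice_oper_eqI by blast
qed

lemma block_crossed_op:
  assumes "\<gamma> \<in> carrier \<Gamma>" "\<delta> \<in> carrier \<Gamma>"
  shows "block \<gamma> \<delta> (crossed_op a) = \<alpha> (inv \<gamma>) (a (\<gamma> \<otimes> inv \<delta>))"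
  using assms by (simp add: crossed_op_def block_block_op fin)

lemma coeff_crossed_op:
  assumes "\<delta> \<in> carrier \<Gamma>" "a \<delta> \<in> A"
  shows "block \<one> (inv \<delta>) (crossed_op a) = a \<delta>"
  using assms by (simp add: block_crossed_op act_one)

lemma crossed_op_cong: "(\<And>\<delta>. \<delta> \<in> carrier \<Gamma> \<Longrightarrow> a \<delta> = b \<delta>) \<Longrightarrow> crossed_op a = crossed_op b"
  unfolding crossed_op_def by (rule block_op_cong) simp

lemma crossed_op_comp:
  assumes a: "\<And>\<delta>. \<delta> \<in> carrier \<Gamma> \<Longrightarrow> a \<delta> \<in> A" and b: "\<And>\<delta>. \<delta> \<in> carrier \<Gamma> \<Longrightarrow> b \<delta> \<in> A"
  shows "crossed_op a o\<^sub>L crossed_op b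
    = crossed_op (\<lambda>\<epsilon>. \<Sum>\<delta>\<in>carrier \<Gamma>. a \<delta> o\<^sub>L \<alpha> \<delta> (b (inv \<delta> \<otimes> \<epsilon>)))"
  unfolding crossed_op_def block_op_comp[OF fin]
proof (rule block_op_cong)
  fix \<gamma> \<epsilon> assume \<gamma>: "\<gamma> \<in> carrier \<Gamma>" and \<epsilon>: "\<epsilon> \<in> carrier \<Gamma>"
  \<comment> \<open>Pulling \<open>\<alpha> (inv \<gamma>)\<close> out of both factors leaves the
    second one twisted by \<open>\<gamma> \<otimes> inv \<delta>\<close>, which becomes the
    summation variable of the twisted convolution.\<close>
  have "(\<Sum>\<delta>\<in>carrier \<Gamma>. \<alpha> (inv \<gamma>) (a (\<gamma> \<otimes> inv \<delta>)) o\<^sub>L \<alpha> (inv \<delta>) (b (\<delta> \<otimes> inv \<epsilon>)))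
      = (\<Sum>\<delta>\<in>carrier \<Gamma>. \<alpha> (inv \<gamma>) (a (\<gamma> \<otimes> inv \<delta>) o\<^sub>L
          \<alpha> (\<gamma> \<otimes> inv \<delta>) (b (inv (\<gamma> \<otimes> inv \<delta>) \<otimes> (\<gamma> \<otimes> inv \<epsilon>)))))"
  proof (rule sum.cong)
    fix \<delta> assume \<delta>: "\<delta> \<in> carrier \<Gamma>"
    have 1: "inv (\<gamma> \<otimes> inv \<delta>) \<otimes> (\<gamma> \<otimes> inv \<epsilon>) = \<delta> \<otimes> inv \<epsilon>"
      using \<gamma> \<delta> \<epsilon> by (simp add: inv_mult_group m_assoc) (simp flip: m_assoc)
    have 2: "\<alpha> (inv \<gamma>) (\<alpha> (\<gamma> \<otimes> inv \<delta>) c) = \<alpha> (inv \<delta>) c" if "c \<in> A" for c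
      using \<gamma> \<delta> that by (simp flip: act_mult m_assoc)
    show "\<alpha> (inv \<gamma>) (a (\<gamma> \<otimes> inv \<delta>)) o\<^sub>L \<alpha> (inv \<delta>) (b (\<delta> \<otimes> inv \<epsilon>)) =
      \<alpha> (inv \<gamma>) (a (\<gamma> \<otimes> inv \<delta>) o\<^sub>L \<alpha> (\<gamma> \<otimes> inv \<delta>) (b (inv (\<gamma> \<otimes> inv \<delta>) \<otimes> (\<gamma> \<otimes> inv \<epsilon>))))"
      unfolding 1 using \<gamma> \<delta> \<epsilon> by (subst act_comp) (simp_all add: a b 2)
  qed simp
  also have "\<dots> = (\<Sum>\<delta>\<in>carrier \<Gamma>. \<alpha> (inv \<gamma>) (a \<delta> o\<^sub>L \<alpha> \<delta> (b (inv \<delta> \<otimes> (\<gamma> \<otimes> inv \<epsilon>)))))"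
    by (rule sum.reindex_bij_betw[OF bij_quotient[OF \<gamma>]])
  also have "\<dots> = \<alpha> (inv \<gamma>) (\<Sum>\<delta>\<in>carrier \<Gamma>. a \<delta> o\<^sub>L \<alpha> \<delta> (b (inv \<delta> \<otimes> (\<gamma> \<otimes> inv \<epsilon>))))"
    using \<gamma> \<epsilon> by (subst act_sum) (simp_all add: a b)
  finally show "(\<Sum>\<delta>\<in>carrier \<Gamma>. \<alpha> (inv \<gamma>) (a (\<gamma> \<otimes> inv \<delta>)) o\<^sub>L \<alpha> (inv \<delta>) (b (\<delta> \<otimes> inv \<epsilon>))) = \<dots>" .
qed

lemma crossed_op_adj:
  assumes a: "\<And>\<delta>. \<delta> \<in> carrier \<Gamma> \<Longrightarrow> a \<delta> \<in> A"
  shows "adj (crossed_op a) = crossed_op (\<lambda>\<delta>. \<alpha> \<delta> (adj (a (inv \<delta>))))"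
proof -
  have "adj (crossed_op a) = block_op (carrier \<Gamma>) (\<lambda>\<gamma> \<delta>. adj (\<alpha> (inv \<delta>) (a (\<delta> \<otimes> inv \<gamma>))))"
    unfolding crossed_op_def by (rule adj_block_op) (simp add: a)
  also have "\<dots> = crossed_op (\<lambda>\<delta>. \<alpha> \<delta> (adj (a (inv \<delta>))))"
    unfolding crossed_op_def
  proof (rule block_op_cong)
    fix \<gamma> \<delta> assume \<gamma>: "\<gamma> \<in> carrier \<Gamma>" and \<delta>: "\<delta> \<in> carrier \<Gamma>"
    have 1: "\<alpha> (inv \<gamma>) (\<alpha> (\<gamma> \<otimes> inv \<delta>) c) = \<alpha> (inv \<delta>) c" if "c \<in> A" for c
      using \<gamma> \<delta> that by (simp flip: act_mult m_assoc)
    have 2: "inv (\<gamma> \<otimes> inv \<delta>) = \<delta> \<otimes> inv \<gamma>"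
      using \<gamma> \<delta> by (simp add: inv_mult_group)
    show "adj (\<alpha> (inv \<delta>) (a (\<delta> \<otimes> inv \<gamma>)))
        = \<alpha> (inv \<gamma>) (\<alpha> (\<gamma> \<otimes> inv \<delta>) (adj (a (inv (\<gamma> \<otimes> inv \<delta>)))))"
      unfolding 2 using \<gamma> \<delta> by (simp add: 1 a act_adj)
  qed
  finally show ?thesis .
qed

text \<open>Coefficients are entries in the identity row, so they converge along \<open>Y\<close>;
  continuity of the automorphisms then makes all other entries converge to those built from the
  limit coefficients. With all of \<open>A\<close> in every degree this shows that the closure in
  \<open>crossed_product\<close> adds nothing for a finite group.\<close>

lemma closed_graded:
  assumes E: "\<And>\<delta>. \<delta> \<in> carrier \<Gamma> \<Longrightarrow> E \<delta> \<subseteq> A \<and> closed (E \<delta>)"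
  shows "closed (graded E)"
  unfolding closed_sequential_limits
proof (intro allI impI, elim conjE)
  fix Y T assume Y: "\<forall>n. Y n \<in> graded E" and lim: "Y \<longlonglongrightarrow> T"
  from Y obtain a where a: "\<And>n \<delta>. \<delta> \<in> carrier \<Gamma> \<Longrightarrow> a n \<delta> \<in> E \<delta>"
    and Ya: "\<And>n. Y n = crossed_op (a n)"
    unfolding graded_def by simp metis
  define b where "b \<delta> = block \<one> (inv \<delta>) T" for \<delta>
  have aA: "\<delta> \<in> carrier \<Gamma> \<Longrightarrow> a n \<delta> \<in> A" for n \<delta>
    using a E by blast
  have ab: "(\<lambda>n. a n \<delta>) \<longlonglongrightarrow> b \<delta>" if "\<delta> \<in> carrier \<Gamma>" for \<delta>
    using tendsto_block[OF lim, of \<one> "inv \<delta>"] that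
    unfolding Ya b_def by (simp add: coeff_crossed_op aA)
  have b: "b \<delta> \<in> E \<delta>" if "\<delta> \<in> carrier \<Gamma>" for \<delta>
    using closed_sequentially[OF _ _ ab[OF that]] E a that by blast
  have "Y \<longlonglongrightarrow> crossed_op b"
    unfolding Ya crossed_op_def
    by (intro tendsto_block_op tendsto_auto[OF auto] ab) (auto intro: aA)
  then have "T = crossed_op b"
    using lim LIMSEQ_unique by blast
  then show "T \<in> graded E"
    unfolding graded_def using b by blast
qed

text \<open>\<open>Em\<close> and \<open>Ead\<close> are the rules \<open>(a
  \<lambda>\<^sub>\<delta>) (b \<lambda>\<^sub>\<epsilon>) = a \<alpha>\<^sub>\<delta>(b)
  \<lambda>\<^sub>\<delta>\<^sub>\<epsilon>\<close> and \<open>adj (a \<lambda>\<^sub>\<delta>) =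
  \<alpha>\<^sub>\<delta>\<^sup>-\<^sup>1(adj a) \<lambda>\<^sub>\<delta>\<^sup>-\<^sup>1\<close>,
  stated on coefficients.\<close>

lemma cstar_graded:
  assumes EA: "\<And>\<delta>. \<delta> \<in> carrier \<Gamma> \<Longrightarrow> E \<delta> \<subseteq> A" and Ecl: "\<And>\<delta>. \<delta> \<in> carrier \<Gamma> \<Longrightarrow> closed (E \<delta>)"
    and E0: "\<And>\<delta>. \<delta> \<in> carrier \<Gamma> \<Longrightarrow> 0 \<in> E \<delta>"
    and Ea: "\<And>\<delta> a b. \<delta> \<in> carrier \<Gamma> \<Longrightarrow> a \<in> E \<delta> \<Longrightarrow> b \<in> E \<delta> \<Longrightarrow> a + b \<in> E \<delta>"
    and Es: "\<And>\<delta> a c. \<delta> \<in> carrier \<Gamma> \<Longrightarrow> a \<in> E \<delta> \<Longrightarrow> scalar_op c o\<^sub>L a \<in> E \<delta>"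
    and Em: "\<And>\<delta> \<epsilon> a b. \<delta> \<in> carrier \<Gamma> \<Longrightarrow> \<epsilon> \<in> carrier \<Gamma> \<Longrightarrow> a \<in> E \<delta> \<Longrightarrow> b \<in> E \<epsilon> \<Longrightarrow>
      a o\<^sub>L \<alpha> \<delta> b \<in> E (\<delta> \<otimes> \<epsilon>)"
    and Ead: "\<And>\<delta> a. \<delta> \<in> carrier \<Gamma> \<Longrightarrow> a \<in> E \<delta> \<Longrightarrow> \<alpha> (inv \<delta>) (adj a) \<in> E (inv \<delta>)"
  shows "cstar_algebra (graded E)"
proof -
  have EA': "a \<in> A" if "\<delta> \<in> carrier \<Gamma>" "a \<in> E \<delta>" for a \<delta>
    using EA that by blast
  have Esum: "sum f F \<in> E \<delta>" if "\<delta> \<in> carrier \<Gamma>" "\<And>i. i \<in> F \<Longrightarrow> f i \<in> E \<delta>" for f :: "'k \<Rightarrow> 'x oper" and F \<delta>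
    using that(2)
    by (induction F rule: infinite_finite_induct) (auto intro: E0 Ea that(1))
  have lin: "complex_linear T" if Tin: "T \<in> graded E" for T
  proof -
    obtain a where a: "\<And>\<delta>. \<delta> \<in> carrier \<Gamma> \<Longrightarrow> a \<delta> \<in> E \<delta>" and T: "T = crossed_op a"
      using Tin by (elim gradedE) blast
    have "a \<delta> \<in> A" if "\<delta> \<in> carrier \<Gamma>" for \<delta>
      using EA'[OF that a[OF that]] .
    then show ?thesis
      unfolding T crossed_op_def by (intro complex_linear_block_op mem_linear act_mem) auto
  qed
  have zero: "0 \<in> graded E"
  proof -
    have "crossed_op (\<lambda>_. 0) = 0"
      by (simp add: crossed_op_def block_op_def cong: sum.cong)
    then show ?thesis using gradedI[of "\<lambda>_. 0" E] E0 by simp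
  qed
  have add: "S + T \<in> graded E" and comp: "S o\<^sub>L T \<in> graded E"
    if ST: "S \<in> graded E" "T \<in> graded E" for S T
  proof -
    obtain a b where a: "\<And>\<delta>. \<delta> \<in> carrier \<Gamma> \<Longrightarrow> a \<delta> \<in> E \<delta>" and S: "S = crossed_op a"
      and b: "\<And>\<delta>. \<delta> \<in> carrier \<Gamma> \<Longrightarrow> b \<delta> \<in> E \<delta>" and T: "T = crossed_op b"
      using ST by (elim gradedE) blast
    have aA: "a \<delta> \<in> A" and bA: "b \<delta> \<in> A" if "\<delta> \<in> carrier \<Gamma>" for \<delta>
      using that EA'[OF that] a b by simp_all
    have "S + T = crossed_op (\<lambda>\<delta>. a \<delta> + b \<delta>)"
      unfolding S T crossed_op_def block_op_add
      by (rule block_op_cong) (simp add: act_add aA bA)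
    then show "S + T \<in> graded E"
      by (simp add: gradedI Ea a b)
    have eq: "S o\<^sub>L T = crossed_op (\<lambda>\<epsilon>. \<Sum>\<delta>\<in>carrier \<Gamma>. a \<delta> o\<^sub>L \<alpha> \<delta> (b (inv \<delta> \<otimes> \<epsilon>)))"
      unfolding S T by (intro crossed_op_comp aA bA)
    have "(\<Sum>\<delta>\<in>carrier \<Gamma>. a \<delta> o\<^sub>L \<alpha> \<delta> (b (inv \<delta> \<otimes> \<epsilon>))) \<in> E \<epsilon>" if \<epsilon>: "\<epsilon> \<in> carrier \<Gamma>" for \<epsilon>
    proof (rule Esum[OF \<epsilon>])
      fix \<delta> assume \<delta>: "\<delta> \<in> carrier \<Gamma>"
      have "a \<delta> o\<^sub>L \<alpha> \<delta> (b (inv \<delta> \<otimes> \<epsilon>)) \<in> E (\<delta> \<otimes> (inv \<delta> \<otimes> \<epsilon>))"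
        using \<delta> \<epsilon> by (intro Em a b) auto
      then show "a \<delta> o\<^sub>L \<alpha> \<delta> (b (inv \<delta> \<otimes> \<epsilon>)) \<in> E \<epsilon>"
        using \<delta> \<epsilon> by (simp flip: m_assoc)
    qed
    then show "S o\<^sub>L T \<in> graded E"
      unfolding eq by (rule gradedI)
  qed
  have scal: "scalar_op c o\<^sub>L T \<in> graded E" and adj: "adj T \<in> graded E"
    if Tin: "T \<in> graded E" for c T
  proof -
    obtain a where a: "\<And>\<delta>. \<delta> \<in> carrier \<Gamma> \<Longrightarrow> a \<delta> \<in> E \<delta>" and T: "T = crossed_op a"
      using Tin by (elim gradedE) blast
    have aA: "a \<delta> \<in> A" if "\<delta> \<in> carrier \<Gamma>" for \<delta>
      using that EA'[OF that] a by simp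
    have "scalar_op c o\<^sub>L T = crossed_op (\<lambda>\<delta>. scalar_op c o\<^sub>L a \<delta>)"
      unfolding T crossed_op_def scalar_block_op[OF fin]
      by (rule block_op_cong) (simp add: act_scalar aA)
    then show "scalar_op c o\<^sub>L T \<in> graded E"
      by (simp add: gradedI Es a)
    have "adj T = crossed_op (\<lambda>\<delta>. \<alpha> \<delta> (adj (a (inv \<delta>))))"
      unfolding T by (intro crossed_op_adj aA)
    moreover have "\<alpha> \<delta> (adj (a (inv \<delta>))) \<in> E \<delta>" if \<delta>: "\<delta> \<in> carrier \<Gamma>" for \<delta>
      using Ead[of "inv \<delta>" "a (inv \<delta>)"] a[of "inv \<delta>"] \<delta> by simp
    ultimately show "adj T \<in> graded E"
      by (simp add: gradedI)
  qed
  have "closed (graded E)"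
    by (rule closed_graded) (simp add: EA Ecl)
  then show ?thesis
    unfolding cstar_algebra_def by (simp add: lin zero add comp scal adj)
qed

lemma crossed_product_eq: "crossed_product \<Gamma> A \<alpha> = graded (\<lambda>_. A)"
proof -
  have "{T. \<exists>a. (\<forall>\<delta>\<in>carrier \<Gamma>. a \<delta> \<in> A) \<and> finite {\<delta> \<in> carrier \<Gamma>. a \<delta> \<noteq> 0} \<and> is_crossed_rep \<Gamma> \<alpha> a T}
      = graded (\<lambda>_. A)"
    unfolding graded_def
  proof (intro Collect_cong ex_cong1 conj_cong refl)
    fix T a assume "\<forall>\<delta>\<in>carrier \<Gamma>. a \<delta> \<in> A"
    then show "finite {\<delta> \<in> carrier \<Gamma>. a \<delta> \<noteq> 0} \<and> is_crossed_rep \<Gamma> \<alpha> a T \<longleftrightarrow> T = crossed_op a"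
      using is_crossed_rep_iff[of a T] fin by simp
  qed
  moreover have "closed (graded (\<lambda>_. A))"
    by (rule closed_graded) (simp add: closed_mem)
  ultimately show ?thesis
    unfolding crossed_product_def by simp
qed

lemma crossed_image_eq:
  assumes "D \<subseteq> A"
  shows "crossed_image \<Gamma> \<alpha> D = graded (\<lambda>\<delta>. if \<delta> = \<one> then D else {0})"
proof (intro equalityI subsetI)
  fix T assume "T \<in> crossed_image \<Gamma> \<alpha> D"
  then obtain a where a: "a \<in> D" "is_crossed_rep \<Gamma> \<alpha> (\<lambda>\<delta>. if \<delta> = \<one> then a else 0) T"
    unfolding crossed_image_def by blast
  then have "T = crossed_op (\<lambda>\<delta>. if \<delta> = \<one> then a else 0)"
    using assms by (subst (asm) is_crossed_rep_iff) auto
  then show "T \<in> graded (\<lambda>\<delta>. if \<delta> = \<one> then D else {0})"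
    unfolding graded_def using a(1) by (intro CollectI exI[of _ "\<lambda>\<delta>. if \<delta> = \<one> then a else 0"]) auto
next
  fix T assume "T \<in> graded (\<lambda>\<delta>. if \<delta> = \<one> then D else {0})"
  then obtain a where a: "\<And>\<delta>. \<delta> \<in> carrier \<Gamma> \<Longrightarrow> a \<delta> \<in> (if \<delta> = \<one> then D else {0})"
    and T: "T = crossed_op a"
    unfolding graded_def by blast
  have a1: "a \<one> \<in> D" using a[of \<one>] by simp
  have "T = crossed_op (\<lambda>\<delta>. if \<delta> = \<one> then a \<one> else 0)"
    unfolding T by (rule crossed_op_cong) (use a in \<open>force split: if_splits\<close>)
  then have "is_crossed_rep \<Gamma> \<alpha> (\<lambda>\<delta>. if \<delta> = \<one> then a \<one> else 0) T"
    using a1 assms by (subst is_crossed_rep_iff) auto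
  then show "T \<in> crossed_image \<Gamma> \<alpha> D"
    unfolding crossed_image_def using a1 by blast
qed

end

section \<open>Cocycle perturbations\<close>

lemma star_automorphism_id: "star_automorphism A (\<lambda>a. a)"
  by (simp add: star_automorphism_def bij_betw_def)

lemma star_automorphism_comp:
  assumes "star_automorphism A \<phi>" "star_automorphism A \<psi>"
  shows "star_automorphism A (\<lambda>a. \<phi> (\<psi> a))"
proof -
  have "bij_betw (\<phi> \<circ> \<psi>) A A"
    using assms bij_betw_trans unfolding star_automorphism_def by blast
  then have "bij_betw (\<lambda>a. \<phi> (\<psi> a)) A A" by (simp add: o_def)
  then show ?thesis
    unfolding star_automorphism_def
    by (simp add: star_automorphismD(1-5)[OF assms(1)] star_automorphismD(1-5)[OF assms(2)])
qed

lemma star_automorphism_funpow: "star_automorphism A \<phi> \<Longrightarrow> star_automorphism A (\<phi> ^^ n)"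
  by (induction n) (use star_automorphism_id star_automorphism_comp in \<open>auto simp: o_def id_def\<close>)

context unital_cstar
begin

lemma multiplier_algebra_eq: "multiplier_algebra A = A"
  unfolding multiplier_algebra_def
proof (intro equalityI subsetI)
  fix T assume "T \<in> {T. complex_linear T \<and> (\<forall>a\<in>A. T o\<^sub>L a \<in> A \<and> a o\<^sub>L T \<in> A)}"
  then have "T o\<^sub>L id_blinfun \<in> A" using id_mem by blast
  then show "T \<in> A" by simp
qed auto

lemma multiplier_ext_eq:
  assumes \<phi>: "star_automorphism A \<phi>" and m: "m \<in> A"
  shows "multiplier_ext A \<phi> m = \<phi> m"
  unfolding multiplier_ext_def multiplier_algebra_eq
proof (rule the_equality)
  show "\<phi> m \<in> A \<and> (\<forall>a\<in>A. \<phi> m o\<^sub>L \<phi> a = \<phi> (m o\<^sub>L a) \<and> \<phi> a o\<^sub>L \<phi> m = \<phi> (a o\<^sub>L m))"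
    using m by (auto simp: star_automorphismD(1,3)[OF \<phi>])
  fix n assume "n \<in> A \<and> (\<forall>a\<in>A. n o\<^sub>L \<phi> a = \<phi> (m o\<^sub>L a) \<and> \<phi> a o\<^sub>L n = \<phi> (a o\<^sub>L m))"
  then have "n o\<^sub>L \<phi> id_blinfun = \<phi> (m o\<^sub>L id_blinfun)" using id_mem by blast
  then show "n = \<phi> m" by (simp add: auto_id[OF \<phi>])
qed

definition unitary :: "'x oper \<Rightarrow> bool" where
  "unitary u \<longleftrightarrow> u \<in> A \<and> adj u o\<^sub>L u = id_blinfun \<and> u o\<^sub>L adj u = id_blinfun"

lemma multiplier_unitary_eq: "multiplier_unitary A u \<longleftrightarrow> unitary u"
  by (simp add: multiplier_unitary_def unitary_def multiplier_algebra_eq)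

lemma unitaryD:
  assumes "unitary u"
  shows "u \<in> A" "adj u o\<^sub>L u = id_blinfun" "u o\<^sub>L adj u = id_blinfun"
    "adj u o\<^sub>L (u o\<^sub>L a) = a" "u o\<^sub>L (adj u o\<^sub>L a) = a"
  using assms by (simp_all add: unitary_def flip: comp_assoc)

lemma unitary_id: "unitary id_blinfun"
  by (simp add: unitary_def)

lemma unitary_comp: "unitary u \<Longrightarrow> unitary v \<Longrightarrow> unitary (u o\<^sub>L v)"
  by (simp add: unitary_def adj_compose comp_assoc unitaryD(4,5)[of u] unitaryD(4,5)[of v])

lemma unitary_auto: "star_automorphism A \<phi> \<Longrightarrow> unitary u \<Longrightarrow> unitary (\<phi> u)"
  unfolding unitary_def
  by (simp add: star_automorphismD(1) auto_id star_automorphismD(3,5)[of A \<phi>, symmetric])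

lemma star_automorphism_conj:
  assumes u: "unitary u"
  shows "star_automorphism A (\<lambda>a. u o\<^sub>L a o\<^sub>L adj u)"
proof -
  note ud = unitaryD[OF u]
  have "bij_betw (\<lambda>a. u o\<^sub>L a o\<^sub>L adj u) A A"
    by (rule bij_betwI[where g = "\<lambda>a. adj u o\<^sub>L a o\<^sub>L u"]) (auto simp: comp_assoc ud)
  moreover have "u o\<^sub>L (scalar_op c o\<^sub>L x) = scalar_op c o\<^sub>L (u o\<^sub>L x)" for c x
    using compose_scalar_op[OF mem_linear[OF ud(1)], of c] by (simp flip: comp_assoc)
  ultimately show ?thesis
    unfolding star_automorphism_def using ud(1)
    by (auto simp: comp_assoc ud comp_add_left comp_add_right adj_compose complex_linear_intros)
qed

end

text \<open>
  The last two assumptions are the properties of \<open>C(G\<^sup>0)\<close> that come from pure infiniteness and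
  minimality (\<open>w\<close> is an isometry normalizing \<open>D\<close> with range projection below \<open>h b b\<^sup>* h\<^sup>*\<close>) and
  from total disconnectedness.
\<close>

locale regular_masa = unital_cstar A for A :: "'x oper set" +
  fixes D :: "'x oper set"
  assumes D_sub: "D \<subseteq> A"
    and D_adj: "d \<in> D \<Longrightarrow> adj d \<in> D"
    and D_commutant: "a \<in> A \<Longrightarrow> a \<in> D \<longleftrightarrow> (\<forall>d\<in>D. a o\<^sub>L d = d o\<^sub>L a)"
    and normalizing_isometry: "b \<in> A \<Longrightarrow> b o\<^sub>L adj b \<in> D \<Longrightarrow> b \<noteq> 0 \<Longrightarrow>
      \<exists>h\<in>D. \<exists>e. e = h o\<^sub>L b o\<^sub>L adj b o\<^sub>L adj h \<and> e o\<^sub>L e = e \<and>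
        (\<exists>w\<in>A. adj w o\<^sub>L w = id_blinfun \<and> (\<forall>d\<in>D. w o\<^sub>L d o\<^sub>L adj w \<in> D) \<and> e o\<^sub>L w = w)"
    and unitary_root: "d \<in> D \<Longrightarrow> adj d o\<^sub>L d = id_blinfun \<Longrightarrow> 0 < n \<Longrightarrow>
      \<exists>c\<in>D. adj c o\<^sub>L c = id_blinfun \<and> ((\<lambda>b. b o\<^sub>L c) ^^ n) id_blinfun = d"
begin

lemma D_mem [simp]: "d \<in> D \<Longrightarrow> d \<in> A"
  using D_sub by blast

lemma D_commute: "d \<in> D \<Longrightarrow> d' \<in> D \<Longrightarrow> d o\<^sub>L d' = d' o\<^sub>L d"
  using D_commutant D_mem by blast

lemma D_id [simp]: "id_blinfun \<in> D"
  by (simp add: D_commutant)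

lemma D_zero [simp]: "0 \<in> D"
  by (simp add: D_commutant)

lemma D_add: "d \<in> D \<Longrightarrow> d' \<in> D \<Longrightarrow> d + d' \<in> D"
  by (subst D_commutant) (auto simp: comp_add_left comp_add_right D_commute)

lemma D_comp: "d \<in> D \<Longrightarrow> d' \<in> D \<Longrightarrow> d o\<^sub>L d' \<in> D"
  by (subst D_commutant) (simp, metis D_commute comp_assoc)

lemma D_scalar: "d \<in> D \<Longrightarrow> scalar_op c o\<^sub>L d \<in> D"
  by (subst D_commutant)
    (simp, metis D_commute D_mem comp_assoc compose_scalar_op mem_linear)

text \<open>Like the algebraic closure properties above, this follows from \<open>D\<close> being
  its own commutant in \<open>A\<close>: commutation survives norm limits.\<close>

lemma closed_D: "closed D"
  unfolding closed_sequential_limits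
proof (intro allI impI, elim conjE)
  fix X T assume X: "\<forall>n. X n \<in> D" and lim: "X \<longlonglongrightarrow> T"
  have T: "T \<in> A" using closed_sequentially[OF closed_mem _ lim] X by auto
  have "T o\<^sub>L d = d o\<^sub>L T" if d: "d \<in> D" for d
  proof -
    have "(\<lambda>n. X n o\<^sub>L d) \<longlonglongrightarrow> (T o\<^sub>L d)" "(\<lambda>n. d o\<^sub>L X n) \<longlonglongrightarrow> (d o\<^sub>L T)"
      by (intro tendsto_compose_oper lim tendsto_const)+
    moreover have "X n o\<^sub>L d = d o\<^sub>L X n" for n
      using X d D_commute by blast
    ultimately show ?thesis using LIMSEQ_unique by fastforce
  qed
  then show "T \<in> D" using D_commutant[OF T] by blast
qed

text \<open>The relation assumed of \<open>b\<close> passes to \<open>v = h b\<close>, which is a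
  partial isometry from \<open>\<phi> e\<close> to \<open>e\<close>. The isometry \<open>w\<close>
  moves the unit under \<open>e\<close> and \<open>\<phi> w\<close> moves it under
  \<open>\<phi> e\<close>; since \<open>w\<close> normalizes \<open>D\<close>, the relation survives
  the compression.\<close>

lemma intertwining_unitary:
  assumes \<phi>: "star_automorphism A \<phi>"
    and b: "b \<in> A" "b \<noteq> 0" and int: "\<And>d. d \<in> D \<Longrightarrow> d o\<^sub>L b = b o\<^sub>L \<phi> d"
  shows "\<exists>u. unitary u \<and> (\<forall>d\<in>D. u o\<^sub>L \<phi> d = d o\<^sub>L u)"
proof -
  note mem = star_automorphismD(1)[OF \<phi>]
  note comp = star_automorphismD(3)[OF \<phi>]
  note adj = star_automorphismD(5)[OF \<phi>]
  have adj_int: "\<phi> d o\<^sub>L adj x = adj x o\<^sub>L d"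
    if d: "d \<in> D" and x: "x \<in> A" and i: "\<And>d. d \<in> D \<Longrightarrow> d o\<^sub>L x = x o\<^sub>L \<phi> d" for d x
  proof -
    have "adj (adj d o\<^sub>L x) = adj (x o\<^sub>L \<phi> (adj d))"
      using i[OF D_adj[OF d]] by simp
    then show ?thesis
      using d x by (simp add: adj_compose adj mem)
  qed
  have "b o\<^sub>L adj b o\<^sub>L d = d o\<^sub>L (b o\<^sub>L adj b)" if d: "d \<in> D" for d
    using adj_int[OF d b(1) int] int[OF d] by (metis comp_assoc)
  then have bb: "b o\<^sub>L adj b \<in> D"
    using b by (subst D_commutant) auto
  obtain h w where h: "h \<in> D" and ee: "(h o\<^sub>L b o\<^sub>L adj b o\<^sub>L adj h) o\<^sub>L (h o\<^sub>L b o\<^sub>L adj b o\<^sub>L adj h)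
        = h o\<^sub>L b o\<^sub>L adj b o\<^sub>L adj h"
    and w: "w \<in> A" "adj w o\<^sub>L w = id_blinfun" and wD: "\<And>d. d \<in> D \<Longrightarrow> w o\<^sub>L d o\<^sub>L adj w \<in> D"
    and ew: "(h o\<^sub>L b o\<^sub>L adj b o\<^sub>L adj h) o\<^sub>L w = w"
    using normalizing_isometry[OF b(1) bb b(2)] by blast
  define v where "v = h o\<^sub>L b"
  define e where "e = h o\<^sub>L b o\<^sub>L adj b o\<^sub>L adj h"
  define f where "f = w o\<^sub>L adj w"
  have v: "v \<in> A" using b h by (simp add: v_def)
  have e_vv: "v o\<^sub>L adj v = e" using b h by (simp add: v_def e_def adj_compose comp_assoc)
  have e: "e \<in> D"
    using D_comp[OF D_comp[OF h bb] D_adj[OF h]] by (simp add: e_def comp_assoc)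
  have eA: "e \<in> A" using e by simp
  have e2: "e o\<^sub>L e = e" using ee by (simp add: e_def)
  have ew: "e o\<^sub>L w = w" using ew by (simp add: e_def)
  have adj_e: "adj e = e" using v by (simp add: adj_compose flip: e_vv)
  have vint: "d o\<^sub>L v = v o\<^sub>L \<phi> d" if d: "d \<in> D" for d
    using D_commute[OF d h] int[OF d] by (simp add: v_def flip: comp_assoc) (simp add: comp_assoc)
  note vadj = adj_int[OF _ v vint]
  \<comment> \<open>The complement \<open>v - e v\<close> has zero product with its adjoint, because
    \<open>v o\<^sub>L adj v\<close> is the projection \<open>e\<close>.\<close>
  have ev: "e o\<^sub>L v = v"
  proof -
    define x where "x = v - (e o\<^sub>L v)"
    have x: "x \<in> A" using v eA by (simp add: x_def)
    have ax: "adj x = adj v - (adj v o\<^sub>L e)"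
      using v eA by (simp add: x_def adj_diff adj_compose adj_e)
    have "x o\<^sub>L adj x = e - (e o\<^sub>L e) - (e o\<^sub>L e) + ((e o\<^sub>L e) o\<^sub>L e)"
      unfolding ax unfolding x_def e_vv[symmetric]
      by (simp add: comp_diff_left comp_diff_right comp_assoc)
    then have "x o\<^sub>L adj x = 0" by (simp add: e2)
    then have "adj x = 0"
      using adj_compose_self_eq_0[of "adj x"] x by simp
    then have "x = 0" using x adj_adj[of x] by simp
    then show ?thesis by (simp add: x_def)
  qed
  \<comment> \<open>The initial projection of \<open>v\<close> is pulled back by \<phi>. Its
    preimage \<open>q\<close> commutes with \<open>D\<close>, hence lies in \<open>D\<close>, and
    the relation applies to it: \<open>q v = v \<phi>(q) = e v = v\<close> gives
    \<open>q e = e\<close>. Conversely \<open>\<phi>(q e) = adj v e v = \<phi>(q)\<close> gives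
    \<open>q e = q\<close>. So \<open>q = e\<close>.\<close>
  obtain q where q: "q \<in> A" "\<phi> q = adj v o\<^sub>L v"
    using star_automorphismD(6)[OF \<phi>, of "adj v o\<^sub>L v"] v by auto
  have "q o\<^sub>L d = d o\<^sub>L q" if d: "d \<in> D" for d
  proof -
    have "\<phi> (q o\<^sub>L d) = \<phi> (d o\<^sub>L q)"
      using d q(1) by (simp add: comp q(2) comp_assoc vint[OF d, symmetric])
        (simp add: vadj[OF d] flip: comp_assoc)
    then show ?thesis using star_automorphismD(7)[OF \<phi>] d q(1) by simp
  qed
  then have qD: "q \<in> D" using D_commutant[OF q(1)] by blast
  have "q o\<^sub>L v = v"
    using vint[OF qD] ev by (simp add: q(2) flip: comp_assoc) (simp add: e_vv)
  then have qe: "q o\<^sub>L e = e"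
    by (simp add: e_vv[symmetric] flip: comp_assoc)
  have "\<phi> (q o\<^sub>L e) = \<phi> q"
    using q(1) eA by (simp add: comp q(2) comp_assoc vint[OF e, symmetric] ev)
  then have "q o\<^sub>L e = q" using star_automorphismD(7)[OF \<phi>] q(1) eA by simp
  then have vv: "adj v o\<^sub>L v = \<phi> e" using qe q(2) by simp
  have fD: "f \<in> D" using wD[of id_blinfun] by (simp add: f_def)
  have fA: "f \<in> A" using fD by simp
  have ef: "e o\<^sub>L f = f" using ew by (simp add: f_def flip: comp_assoc)
  have fe: "f o\<^sub>L e = f" using ef D_commute[OF e fD] by simp
  have fw: "f o\<^sub>L w = w" using w by (simp add: f_def comp_assoc)
  have wf: "adj w o\<^sub>L f = adj w" using w by (simp add: f_def flip: comp_assoc)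
  \<comment> \<open>On both sides the range projection \<open>f\<close> of \<open>w\<close> can be
    moved across \<open>v\<close>. The remaining \<open>v o\<^sub>L adj v\<close> and
    \<open>adj v o\<^sub>L v\<close> are \<open>e\<close> and \<open>\<phi> e\<close>, which act as
    units on the ranges of \<open>w\<close> and \<open>\<phi> w\<close>.\<close>
  define u where "u = adj w o\<^sub>L v o\<^sub>L \<phi> w"
  have uA: "u \<in> A" using w v by (simp add: u_def mem)
  have au: "adj u = \<phi> (adj w) o\<^sub>L adj v o\<^sub>L w"
    using w v by (simp add: u_def adj_compose mem adj comp_assoc complex_linear_intros complex_linear_adj)
  have "\<phi> w o\<^sub>L \<phi> (adj w) = \<phi> f" using w by (simp add: comp[symmetric] f_def)
  moreover have "u o\<^sub>L adj u = adj w o\<^sub>L (v o\<^sub>L (\<phi> w o\<^sub>L \<phi> (adj w))) o\<^sub>L adj v o\<^sub>L w"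
    unfolding au by (simp add: u_def comp_assoc)
  ultimately have "u o\<^sub>L adj u = adj w o\<^sub>L (v o\<^sub>L \<phi> f) o\<^sub>L adj v o\<^sub>L w"
    by simp
  also have "\<dots> = adj w o\<^sub>L f o\<^sub>L (v o\<^sub>L adj v) o\<^sub>L w"
    by (simp add: vint[OF fD, symmetric] comp_assoc)
  also have "\<dots> = id_blinfun"
    by (simp add: e_vv wf comp_assoc ew w(2))
  finally have 1: "u o\<^sub>L adj u = id_blinfun" .
  have "adj u o\<^sub>L u = \<phi> (adj w) o\<^sub>L adj v o\<^sub>L (f o\<^sub>L v) o\<^sub>L \<phi> w"
    unfolding au by (simp add: u_def f_def comp_assoc)
  also have "\<dots> = \<phi> (adj w) o\<^sub>L (adj v o\<^sub>L v) o\<^sub>L \<phi> f o\<^sub>L \<phi> w"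
    by (simp add: vint[OF fD] comp_assoc)
  also have "\<dots> = \<phi> (adj w o\<^sub>L e o\<^sub>L f o\<^sub>L w)"
    unfolding vv using w fA eA by (simp add: comp)
  also have "adj w o\<^sub>L e o\<^sub>L f o\<^sub>L w = id_blinfun"
    by (simp add: comp_assoc fw ew w(2))
  finally have 2: "adj u o\<^sub>L u = id_blinfun" by (simp add: auto_id[OF \<phi>])
  have 3: "u o\<^sub>L \<phi> d = d o\<^sub>L u" if d: "d \<in> D" for d
  proof -
    \<comment> \<open>The element \<open>d\<close> is transported by \<open>w\<close> into the
      corner where \<open>v\<close> intertwines, and transported back by \<open>adj w\<close> after
      crossing \<open>v\<close>.\<close>
    define d' where "d' = w o\<^sub>L d o\<^sub>L adj w"
    have d': "d' \<in> D" using wD[OF d] by (simp add: d'_def)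
    have "w o\<^sub>L d = d' o\<^sub>L w" using w by (simp add: d'_def comp_assoc)
    then have "\<phi> w o\<^sub>L \<phi> d = \<phi> d' o\<^sub>L \<phi> w"
      using w d d' by (simp add: comp[symmetric])
    then have "u o\<^sub>L \<phi> d = adj w o\<^sub>L (v o\<^sub>L \<phi> d') o\<^sub>L \<phi> w"
      unfolding u_def by (simp add: comp_assoc)
    also have "\<dots> = adj w o\<^sub>L d' o\<^sub>L v o\<^sub>L \<phi> w"
      by (simp add: vint[OF d', symmetric] comp_assoc)
    also have "adj w o\<^sub>L d' = d o\<^sub>L adj w"
      using w by (simp add: d'_def flip: comp_assoc)
    finally show ?thesis by (simp add: u_def comp_assoc)
  qed
  have "unitary u" using uA 1 2 by (simp add: unitary_def)
  then show ?thesis using 3 by blast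
qed

text \<open>The product \<open>u \<phi>(u) ... \<phi>\<^sup>n\<^sup>-\<^sup>1(u)\<close> is the
  value at \<open>n\<close> of the cocycle over the powers of \<phi> whose value at 1 is
  \<open>u\<close>.\<close>

primrec norm_prod :: "('x oper \<Rightarrow> 'x oper) \<Rightarrow> 'x oper \<Rightarrow> nat \<Rightarrow> 'x oper" where
  "norm_prod \<phi> u 0 = id_blinfun"
| "norm_prod \<phi> u (Suc n) = norm_prod \<phi> u n o\<^sub>L (\<phi> ^^ n) u"

lemma unitary_norm_prod:
  "star_automorphism A \<phi> \<Longrightarrow> unitary u \<Longrightarrow> unitary (norm_prod \<phi> u n)"
  by (induction n)
    (simp_all add: unitary_id unitary_comp unitary_auto[OF star_automorphism_funpow])

lemma norm_prod_add:
  assumes \<phi>: "star_automorphism A \<phi>" and u: "unitary u"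
  shows "norm_prod \<phi> u (m + n) = norm_prod \<phi> u m o\<^sub>L (\<phi> ^^ m) (norm_prod \<phi> u n)"
proof (induction n)
  case 0
  show ?case by (simp add: auto_id[OF star_automorphism_funpow[OF \<phi>]])
next
  case (Suc n)
  have "(\<phi> ^^ m) (norm_prod \<phi> u n o\<^sub>L (\<phi> ^^ n) u)
      = (\<phi> ^^ m) (norm_prod \<phi> u n) o\<^sub>L (\<phi> ^^ m) ((\<phi> ^^ n) u)"
    using unitaryD(1)[OF unitary_norm_prod[OF \<phi> u]] unitaryD(1)[OF u]
      star_automorphismD(1)[OF star_automorphism_funpow[OF \<phi>]]
    by (intro star_automorphismD(3)[OF star_automorphism_funpow[OF \<phi>]])
  then show ?case
    using Suc by (simp add: comp_assoc funpow_add)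
qed

text \<open>The hypothesis says that \<open>Ad u o \<phi>\<close> fixes \<open>D\<close>. Its n-th
  iterate is conjugation by the n-fold product after the n-th power of \<phi>, so that fixes
  \<open>D\<close> as well.\<close>

lemma norm_prod_intertwines:
  assumes \<phi>: "star_automorphism A \<phi>" and u: "unitary u"
    and int: "\<And>d. d \<in> D \<Longrightarrow> u o\<^sub>L \<phi> d = d o\<^sub>L u" and d: "d \<in> D"
  shows "norm_prod \<phi> u n o\<^sub>L (\<phi> ^^ n) d = d o\<^sub>L norm_prod \<phi> u n"
proof (induction n)
  case (Suc n)
  note comp = star_automorphismD(3)[OF star_automorphism_funpow[OF \<phi>, of n]]
  have "(\<phi> ^^ n) u o\<^sub>L (\<phi> ^^ n) (\<phi> d) = (\<phi> ^^ n) (u o\<^sub>L \<phi> d)"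
    by (rule comp[symmetric]) (use d unitaryD(1)[OF u] star_automorphismD(1)[OF \<phi>] in auto)
  also have "\<dots> = (\<phi> ^^ n) d o\<^sub>L (\<phi> ^^ n) u"
    unfolding int[OF d] by (rule comp) (use d unitaryD(1)[OF u] in auto)
  finally have "norm_prod \<phi> u (Suc n) o\<^sub>L (\<phi> ^^ Suc n) d
      = (norm_prod \<phi> u n o\<^sub>L (\<phi> ^^ n) d) o\<^sub>L (\<phi> ^^ n) u"
    by (simp add: comp_assoc funpow_swap1)
  then show ?case using Suc by (simp add: comp_assoc)
qed simp

text \<open>
  The \<open>n\<close>-fold product of an intertwining unitary lies in \<open>D\<close>, and \<open>Ad u \<circ> \<phi>\<close> fixes \<open>D\<close>, so it can be
  cancelled by an \<open>n\<close>-th root in \<open>D\<close>.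
\<close>

lemma normalized_intertwining_unitary:
  assumes \<phi>: "star_automorphism A \<phi>" and per: "\<And>a. a \<in> A \<Longrightarrow> (\<phi> ^^ n) a = a" and n: "0 < n"
    and b: "b \<in> A" "b \<noteq> 0" and bint: "\<And>d. d \<in> D \<Longrightarrow> d o\<^sub>L b = b o\<^sub>L \<phi> d"
  shows "\<exists>u. unitary u \<and> (\<forall>d\<in>D. u o\<^sub>L \<phi> d = d o\<^sub>L u) \<and> norm_prod \<phi> u n = id_blinfun"
proof -
  obtain u where u: "unitary u" and int: "\<And>d. d \<in> D \<Longrightarrow> u o\<^sub>L \<phi> d = d o\<^sub>L u"
    using intertwining_unitary[OF \<phi> b bint] by blast
  define z where "z = norm_prod \<phi> u n"
  have z: "unitary z" unfolding z_def by (rule unitary_norm_prod[OF \<phi> u])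
  \<comment> \<open>As the n-th power of \<phi> is the identity on \<open>A\<close>, intertwining by
    the full product is plain commutation with \<open>D\<close>.\<close>
  have "z o\<^sub>L d = d o\<^sub>L z" if "d \<in> D" for d
    using norm_prod_intertwines[OF \<phi> u int that, of n] that by (simp add: per z_def)
  then have zD: "z \<in> D" using D_commutant[OF unitaryD(1)[OF z]] by blast
  \<comment> \<open>The root is taken of the adjoint of \<open>z\<close>, because its n-th power has
    to cancel \<open>z\<close> from the left.\<close>
  have "adj (adj z) o\<^sub>L adj z = id_blinfun"
    using unitaryD(3)[OF z] unitaryD(1)[OF z] by simp
  then obtain c where c: "c \<in> D" "adj c o\<^sub>L c = id_blinfun"
    and cn: "((\<lambda>b. b o\<^sub>L c) ^^ n) id_blinfun = adj z"
    using unitary_root[OF D_adj[OF zD] _ n] by blast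
  have cu: "unitary c"
    using c D_commute[OF c(1) D_adj[OF c(1)]] by (simp add: unitary_def)
  define u' where "u' = c o\<^sub>L u"
  have u': "unitary u'" unfolding u'_def by (rule unitary_comp[OF cu u])
  have int': "u' o\<^sub>L \<phi> d = d o\<^sub>L u'" if d: "d \<in> D" for d
    using D_commute[OF d c(1)] int[OF d]
    by (simp add: u'_def comp_assoc) (simp flip: comp_assoc)
  \<comment> \<open>The m-fold product of \<open>u\<close> turns the twisted factor
    \<open>(\<phi> ^^ m) c\<close> into an untwisted \<open>c\<close> on its left, so the
    corrections collect into a power of \<open>c\<close>.\<close>
  have "norm_prod \<phi> u' m = ((\<lambda>b. b o\<^sub>L c) ^^ m) id_blinfun o\<^sub>L norm_prod \<phi> u m" for m
  proof (induction m)
    case (Suc m)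
    have "(\<phi> ^^ m) u' = (\<phi> ^^ m) c o\<^sub>L (\<phi> ^^ m) u"
      unfolding u'_def using c unitaryD(1)[OF u]
      by (simp add: star_automorphismD(3)[OF star_automorphism_funpow[OF \<phi>]])
    then have "norm_prod \<phi> u' (Suc m) = ((\<lambda>b. b o\<^sub>L c) ^^ m) id_blinfun o\<^sub>L
        (norm_prod \<phi> u m o\<^sub>L (\<phi> ^^ m) c) o\<^sub>L (\<phi> ^^ m) u"
      using Suc by (simp add: comp_assoc)
    also have "norm_prod \<phi> u m o\<^sub>L (\<phi> ^^ m) c = c o\<^sub>L norm_prod \<phi> u m"
      by (rule norm_prod_intertwines[OF \<phi> u int c(1)])
    finally show ?case by (simp add: comp_assoc)
  qed simp
  then have "norm_prod \<phi> u' n = id_blinfun"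
    using cn unitaryD(2)[OF z] by (simp add: z_def)
  then show ?thesis using u' int' by blast
qed

end

section \<open>Maximality of the diagonal in the crossed product\<close>

locale regular_masa_action = regular_masa A D + finite_cstar_action A \<Gamma> \<alpha>
  for A :: "'x oper set" and D :: "'x oper set" and \<Gamma> :: "'k monoid" (structure)
    and \<alpha> :: "'k \<Rightarrow> 'x oper \<Rightarrow> 'x oper"
begin

lemma action_cocycle_iff:
  "action_cocycle \<Gamma> A \<alpha> u \<longleftrightarrow> (\<forall>\<gamma>\<in>carrier \<Gamma>. unitary (u \<gamma>)) \<and>
    (\<forall>\<gamma>\<in>carrier \<Gamma>. \<forall>\<delta>\<in>carrier \<Gamma>. u (\<gamma> \<otimes> \<delta>) = u \<gamma> o\<^sub>L \<alpha> \<gamma> (u \<delta>))"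
  unfolding action_cocycle_def multiplier_unitary_eq
  by (auto simp: multiplier_ext_eq[OF auto] unitaryD(1))

lemma cstar_action_perturbed:
  assumes u: "\<And>\<gamma>. \<gamma> \<in> carrier \<Gamma> \<Longrightarrow> unitary (u \<gamma>)"
    and coc: "\<And>\<gamma> \<delta>. \<gamma> \<in> carrier \<Gamma> \<Longrightarrow> \<delta> \<in> carrier \<Gamma> \<Longrightarrow> u (\<gamma> \<otimes> \<delta>) = u \<gamma> o\<^sub>L \<alpha> \<gamma> (u \<delta>)"
  shows "cstar_action \<Gamma> A (\<lambda>\<gamma> a. u \<gamma> o\<^sub>L \<alpha> \<gamma> a o\<^sub>L adj (u \<gamma>))"
  unfolding cstar_action_def
proof (intro conjI ballI)
  show "star_automorphism A (\<lambda>a. u \<gamma> o\<^sub>L \<alpha> \<gamma> a o\<^sub>L adj (u \<gamma>))" if "\<gamma> \<in> carrier \<Gamma>" for \<gamma>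
    using star_automorphism_comp[OF star_automorphism_conj[OF u[OF that]] auto[OF that]] .
  show "u \<one> o\<^sub>L \<alpha> \<one> a o\<^sub>L adj (u \<one>) = a" if a: "a \<in> A" for a
  proof -
    \<comment> \<open>The cocycle identity at the neutral element makes \<open>u \<one>\<close> an
      idempotent, and an idempotent unitary is the identity.\<close>
    have "u \<one> = u \<one> o\<^sub>L u \<one>"
      using coc[of \<one> \<one>] unitaryD(1)[OF u] by (simp add: act_one)
    then have "u \<one> = id_blinfun"
      using unitaryD(2,4)[OF u[OF one_closed]] by metis
    then show ?thesis using a by (simp add: act_one)
  qed
  show "u (\<gamma> \<otimes> \<delta>) o\<^sub>L \<alpha> (\<gamma> \<otimes> \<delta>) a o\<^sub>L adj (u (\<gamma> \<otimes> \<delta>))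
      = u \<gamma> o\<^sub>L \<alpha> \<gamma> (u \<delta> o\<^sub>L \<alpha> \<delta> a o\<^sub>L adj (u \<delta>)) o\<^sub>L adj (u \<gamma>)"
    if \<gamma>: "\<gamma> \<in> carrier \<Gamma>" and \<delta>: "\<delta> \<in> carrier \<Gamma>" and a: "a \<in> A" for \<gamma> \<delta> a
    using unitaryD(1)[OF u] \<gamma> \<delta> a
    by (simp add: coc act_mult act_comp act_adj adj_compose comp_assoc)
qed

abbreviation single :: "'x oper \<Rightarrow> 'k \<Rightarrow> 'x oper" where
  "single d \<equiv> \<lambda>\<delta>. if \<delta> = \<one> then d else 0"

lemma crossed_op_single_right:
  assumes a: "\<And>\<delta>. \<delta> \<in> carrier \<Gamma> \<Longrightarrow> a \<delta> \<in> A" and d: "d \<in> A"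
  shows "crossed_op a o\<^sub>L crossed_op (single d) = crossed_op (\<lambda>\<epsilon>. a \<epsilon> o\<^sub>L \<alpha> \<epsilon> d)"
proof -
  have "crossed_op a o\<^sub>L crossed_op (single d)
      = crossed_op (\<lambda>\<epsilon>. \<Sum>\<delta>\<in>carrier \<Gamma>. a \<delta> o\<^sub>L \<alpha> \<delta> (single d (inv \<delta> \<otimes> \<epsilon>)))"
    using a d by (intro crossed_op_comp) auto
  also have "\<dots> = crossed_op (\<lambda>\<epsilon>. a \<epsilon> o\<^sub>L \<alpha> \<epsilon> d)"
  proof (rule crossed_op_cong)
    fix \<epsilon> assume \<epsilon>: "\<epsilon> \<in> carrier \<Gamma>"
    have "inv \<delta> \<otimes> \<epsilon> = \<one> \<longleftrightarrow> \<epsilon> = \<delta>" if "\<delta> \<in> carrier \<Gamma>" for \<delta>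
      using that \<epsilon> by (metis inv_closed inv_equality inv_inv l_inv)
    then have "(\<Sum>\<delta>\<in>carrier \<Gamma>. a \<delta> o\<^sub>L \<alpha> \<delta> (single d (inv \<delta> \<otimes> \<epsilon>)))
        = (\<Sum>\<delta>\<in>carrier \<Gamma>. if \<epsilon> = \<delta> then a \<delta> o\<^sub>L \<alpha> \<delta> d else 0)"
      by (intro sum.cong) auto
    then show "(\<Sum>\<delta>\<in>carrier \<Gamma>. a \<delta> o\<^sub>L \<alpha> \<delta> (single d (inv \<delta> \<otimes> \<epsilon>))) = a \<epsilon> o\<^sub>L \<alpha> \<epsilon> d"
      using \<epsilon> fin by simp
  qed
  finally show ?thesis .
qed

lemma crossed_op_single_left:
  assumes a: "\<And>\<delta>. \<delta> \<in> carrier \<Gamma> \<Longrightarrow> a \<delta> \<in> A" and d: "d \<in> A"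
  shows "crossed_op (single d) o\<^sub>L crossed_op a = crossed_op (\<lambda>\<epsilon>. d o\<^sub>L a \<epsilon>)"
proof -
  have "crossed_op (single d) o\<^sub>L crossed_op a
      = crossed_op (\<lambda>\<epsilon>. \<Sum>\<delta>\<in>carrier \<Gamma>. single d \<delta> o\<^sub>L \<alpha> \<delta> (a (inv \<delta> \<otimes> \<epsilon>)))"
    using a d by (intro crossed_op_comp) auto
  also have "\<dots> = crossed_op (\<lambda>\<epsilon>. d o\<^sub>L a \<epsilon>)"
  proof (rule crossed_op_cong)
    fix \<epsilon> assume \<epsilon>: "\<epsilon> \<in> carrier \<Gamma>"
    have "(\<Sum>\<delta>\<in>carrier \<Gamma>. single d \<delta> o\<^sub>L \<alpha> \<delta> (a (inv \<delta> \<otimes> \<epsilon>)))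
        = (\<Sum>\<delta>\<in>carrier \<Gamma>. if \<delta> = \<one> then d o\<^sub>L a \<epsilon> else 0)"
      using a \<epsilon> by (intro sum.cong) (auto simp: act_one)
    then show "(\<Sum>\<delta>\<in>carrier \<Gamma>. single d \<delta> o\<^sub>L \<alpha> \<delta> (a (inv \<delta> \<otimes> \<epsilon>))) = d o\<^sub>L a \<epsilon>"
      using fin by simp
  qed
  finally show ?thesis .
qed

lemma image_D_eq: "crossed_image \<Gamma> \<alpha> D = {crossed_op (single d) | d. d \<in> D}"
  unfolding crossed_image_eq[OF D_sub]
proof (intro equalityI subsetI)
  fix T assume "T \<in> graded (\<lambda>\<delta>. if \<delta> = \<one> then D else {0})"
  then obtain a where a: "\<And>\<delta>. \<delta> \<in> carrier \<Gamma> \<Longrightarrow> a \<delta> \<in> (if \<delta> = \<one> then D else {0})"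
    and T: "T = crossed_op a"
    by (elim gradedE) blast
  have "T = crossed_op (single (a \<one>))"
    unfolding T by (rule crossed_op_cong) (use a in \<open>force split: if_splits\<close>)
  moreover have "a \<one> \<in> D" using a[of \<one>] by simp
  ultimately show "T \<in> {crossed_op (single d) | d. d \<in> D}" by blast
next
  fix T assume "T \<in> {crossed_op (single d) | d. d \<in> D}"
  then obtain d where "d \<in> D" "T = crossed_op (single d)" by blast
  then show "T \<in> graded (\<lambda>\<delta>. if \<delta> = \<one> then D else {0})"
    by (auto intro!: gradedI)
qed

lemma image_D_cstar: "cstar_algebra (crossed_image \<Gamma> \<alpha> D)"
  unfolding crossed_image_eq[OF D_sub]
proof (rule cstar_graded)
  show "a o\<^sub>L \<alpha> \<delta> b \<in> (if \<delta> \<otimes> \<epsilon> = \<one> then D else {0})"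
    if "\<delta> \<in> carrier \<Gamma>" "\<epsilon> \<in> carrier \<Gamma>" "a \<in> (if \<delta> = \<one> then D else {0})" "b \<in> (if \<epsilon> = \<one> then D else {0})"
    for \<delta> \<epsilon> a b
    using that by (auto split: if_splits simp: act_one D_comp)
  show "\<alpha> (inv \<delta>) (adj a) \<in> (if inv \<delta> = \<one> then D else {0})"
    if "\<delta> \<in> carrier \<Gamma>" "a \<in> (if \<delta> = \<one> then D else {0})" for \<delta> a
    using that by (auto split: if_splits simp: act_one D_adj)
qed (auto simp: closed_D D_add D_scalar split: if_splits)

lemma image_D_abelian: "abelian (crossed_image \<Gamma> \<alpha> D)"
proof -
  have P: "crossed_op (single d) o\<^sub>L crossed_op (single d') = crossed_op (single (d o\<^sub>L d'))"
    if "d \<in> D" "d' \<in> D" for d d'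
  proof -
    have "crossed_op (single d) o\<^sub>L crossed_op (single d') = crossed_op (\<lambda>\<epsilon>. d o\<^sub>L single d' \<epsilon>)"
      using that by (intro crossed_op_single_left) auto
    then show ?thesis by (simp add: if_distrib cong: if_cong)
  qed
  have "crossed_op (single d) o\<^sub>L crossed_op (single d') = crossed_op (single d') o\<^sub>L crossed_op (single d)"
    if "d \<in> D" "d' \<in> D" for d d'
    using arg_cong[OF D_commute[OF that], of "\<lambda>x. crossed_op (single x)"]
    by (simp only: P[OF that] P[OF that(2,1)])
  then show ?thesis
    unfolding abelian_def image_D_eq by blast
qed

lemma image_D_sub: "crossed_image \<Gamma> \<alpha> D \<subseteq> crossed_product \<Gamma> A \<alpha>"
  unfolding crossed_product_eq image_D_eq by (auto intro!: gradedI)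

lemma not_masa_intertwiner:
  assumes "\<not> is_masa (crossed_image \<Gamma> \<alpha> D) (crossed_product \<Gamma> A \<alpha>)"
  shows "\<exists>\<gamma>\<in>carrier \<Gamma>. \<gamma> \<noteq> \<one> \<and> (\<exists>b\<in>A. b \<noteq> 0 \<and> (\<forall>d\<in>D. d o\<^sub>L b = b o\<^sub>L \<alpha> \<gamma> d))"
proof -
  obtain B where B: "B \<subseteq> crossed_product \<Gamma> A \<alpha>" "abelian B" "crossed_image \<Gamma> \<alpha> D \<subseteq> B"
    "B \<noteq> crossed_image \<Gamma> \<alpha> D"
    using assms image_D_sub image_D_cstar image_D_abelian unfolding is_masa_def by blast
  then obtain T where T: "T \<in> B" "T \<notin> crossed_image \<Gamma> \<alpha> D" by blast
  then obtain a where a: "\<And>\<delta>. \<delta> \<in> carrier \<Gamma> \<Longrightarrow> a \<delta> \<in> A" and Ta: "T = crossed_op a"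
    using B(1) unfolding crossed_product_eq by (meson gradedE subsetD)
  have int: "d o\<^sub>L a \<delta> = a \<delta> o\<^sub>L \<alpha> \<delta> d" if d: "d \<in> D" and \<delta>: "\<delta> \<in> carrier \<Gamma>" for d \<delta>
  proof -
    have "crossed_op (single d) \<in> B" using B(3) d unfolding image_D_eq by blast
    then have "crossed_op (single d) o\<^sub>L crossed_op a = crossed_op a o\<^sub>L crossed_op (single d)"
      using B(2) T(1) unfolding abelian_def Ta by blast
    then have "crossed_op (\<lambda>\<epsilon>. d o\<^sub>L a \<epsilon>) = crossed_op (\<lambda>\<epsilon>. a \<epsilon> o\<^sub>L \<alpha> \<epsilon> d)"
      using crossed_op_single_left[OF a] crossed_op_single_right[OF a] d by simp
    then show ?thesis
      using coeff_crossed_op[OF \<delta>, of "\<lambda>\<epsilon>. d o\<^sub>L a \<epsilon>"]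
        coeff_crossed_op[OF \<delta>, of "\<lambda>\<epsilon>. a \<epsilon> o\<^sub>L \<alpha> \<epsilon> d"] a[OF \<delta>] d \<delta>
      by simp
  qed
  have "\<exists>\<gamma>\<in>carrier \<Gamma>. \<gamma> \<noteq> \<one> \<and> a \<gamma> \<noteq> 0"
  proof (rule ccontr)
    assume "\<not> ?thesis"
    then have "T = crossed_op (single (a \<one>))"
      unfolding Ta by (intro crossed_op_cong) auto
    \<comment> \<open>In degree \<open>\<one>\<close> the twist disappears, and the relation says
      that the coefficient commutes with \<open>D\<close>.\<close>
    moreover have "a \<one> \<in> D"
      using int[of _ \<one>] a[of \<one>] by (subst D_commutant) (auto simp: act_one)
    ultimately show False using T(2) unfolding image_D_eq by blast
  qed
  then show ?thesis using a int by blast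
qed

text \<open>The elements \<open>u \<delta> \<lambda>\<^sub>\<delta>\<close> multiply like the group
  by the cocycle identity, and they commute with \<open>D\<close> because the perturbed action fixes
  it. Their span with coefficients in \<open>D\<close> is therefore a group algebra over
  \<open>D\<close>, abelian since \<open>D\<close> and \<Gamma> both are.\<close>

lemma exterior_fixing_not_masa:
  assumes \<gamma>: "\<gamma> \<in> carrier \<Gamma>" "\<gamma> \<noteq> \<one>"
    and ext: "exterior_equivalent \<Gamma> A \<alpha> \<beta>"
    and fix_D: "\<And>\<delta> d. \<delta> \<in> carrier \<Gamma> \<Longrightarrow> d \<in> D \<Longrightarrow> \<beta> \<delta> d = d"
  shows "\<not> is_masa (crossed_image \<Gamma> \<alpha> D) (crossed_product \<Gamma> A \<alpha>)"
proof
  assume masa: "is_masa (crossed_image \<Gamma> \<alpha> D) (crossed_product \<Gamma> A \<alpha>)"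
  obtain u where u: "\<And>\<delta>. \<delta> \<in> carrier \<Gamma> \<Longrightarrow> unitary (u \<delta>)"
    and coc: "\<And>\<delta> \<epsilon>. \<delta> \<in> carrier \<Gamma> \<Longrightarrow> \<epsilon> \<in> carrier \<Gamma> \<Longrightarrow> u (\<delta> \<otimes> \<epsilon>) = u \<delta> o\<^sub>L \<alpha> \<delta> (u \<epsilon>)"
    and \<beta>: "\<And>\<delta> a. \<delta> \<in> carrier \<Gamma> \<Longrightarrow> a \<in> A \<Longrightarrow> \<beta> \<delta> a = u \<delta> o\<^sub>L \<alpha> \<delta> a o\<^sub>L adj (u \<delta>)"
    using ext unfolding exterior_equivalent_def action_cocycle_iff by blast
  note uA [simp] = unitaryD(1)[OF u]
  have u1: "u \<one> = id_blinfun"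
  proof -
    have "u \<one> = u \<one> o\<^sub>L u \<one>"
      using coc[of \<one> \<one>] by (simp add: act_one)
    then show ?thesis
      using unitaryD(2,4)[OF u[OF one_closed]] by metis
  qed
  have int: "u \<delta> o\<^sub>L \<alpha> \<delta> d = d o\<^sub>L u \<delta>" if \<delta>: "\<delta> \<in> carrier \<Gamma>" and d: "d \<in> D" for \<delta> d
  proof -
    have "d o\<^sub>L u \<delta> = (u \<delta> o\<^sub>L \<alpha> \<delta> d o\<^sub>L adj (u \<delta>)) o\<^sub>L u \<delta>"
      using fix_D[OF \<delta> d] \<beta>[OF \<delta>, of d] d by simp
    then show ?thesis by (simp add: comp_assoc unitaryD(2)[OF u[OF \<delta>]])
  qed
  define E where "E \<delta> = {d o\<^sub>L u \<delta> | d. d \<in> D}" for \<delta>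
  define B where "B = graded E"
  \<comment> \<open>Multiplying by the adjoint of the unitary reduces closedness and the linear
    structure of \<open>E \<delta>\<close> to those of \<open>D\<close>.\<close>
  have E_iff: "a \<in> E \<delta> \<longleftrightarrow> a o\<^sub>L adj (u \<delta>) \<in> D" if "\<delta> \<in> carrier \<Gamma>" for a \<delta>
  proof
    assume "a \<in> E \<delta>"
    then show "a o\<^sub>L adj (u \<delta>) \<in> D"
      using unitaryD(3)[OF u[OF that]] unfolding E_def by (auto simp: comp_assoc)
  next
    assume "a o\<^sub>L adj (u \<delta>) \<in> D"
    moreover have "a = (a o\<^sub>L adj (u \<delta>)) o\<^sub>L u \<delta>"
      using unitaryD(2)[OF u[OF that]] by (simp add: comp_assoc)
    ultimately show "a \<in> E \<delta>" unfolding E_def by blast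
  qed
  have twist: "(d o\<^sub>L u \<delta>) o\<^sub>L \<alpha> \<delta> (d' o\<^sub>L u \<epsilon>) = (d o\<^sub>L d') o\<^sub>L u (\<delta> \<otimes> \<epsilon>)"
    if \<delta>: "\<delta> \<in> carrier \<Gamma>" and \<epsilon>: "\<epsilon> \<in> carrier \<Gamma>" and d: "d \<in> D" "d' \<in> D" for \<delta> \<epsilon> d d'
  proof -
    have "(d o\<^sub>L u \<delta>) o\<^sub>L \<alpha> \<delta> (d' o\<^sub>L u \<epsilon>) = d o\<^sub>L (u \<delta> o\<^sub>L \<alpha> \<delta> d') o\<^sub>L \<alpha> \<delta> (u \<epsilon>)"
      using \<delta> \<epsilon> d by (simp add: act_comp comp_assoc)
    then show ?thesis by (simp add: int[OF \<delta> d(2)] coc[OF \<delta> \<epsilon>] comp_assoc)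
  qed
  have "cstar_algebra B"
    unfolding B_def
  proof (rule cstar_graded)
    fix \<delta> assume \<delta>: "\<delta> \<in> carrier \<Gamma>"
    show "E \<delta> \<subseteq> A" using \<delta> unfolding E_def by auto
    show "closed (E \<delta>)"
      unfolding closed_sequential_limits
    proof (intro allI impI, elim conjE)
      fix X T assume X: "\<forall>n. X n \<in> E \<delta>" and lim: "X \<longlonglongrightarrow> T"
      have "(\<lambda>n. X n o\<^sub>L adj (u \<delta>)) \<longlonglongrightarrow> (T o\<^sub>L adj (u \<delta>))"
        by (intro tendsto_compose_oper lim tendsto_const)
      moreover have "X n o\<^sub>L adj (u \<delta>) \<in> D" for n
        using X E_iff[OF \<delta>] by blast
      ultimately show "T \<in> E \<delta>"
        unfolding E_iff[OF \<delta>] by (rule closed_sequentially[OF closed_D, rotated])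
    qed
    show "0 \<in> E \<delta>" by (simp add: E_iff[OF \<delta>])
    show "a + b \<in> E \<delta>" if "a \<in> E \<delta>" "b \<in> E \<delta>" for a b
      using that by (simp add: E_iff[OF \<delta>] comp_add_left D_add)
    show "scalar_op c o\<^sub>L a \<in> E \<delta>" if "a \<in> E \<delta>" for a c
      using that by (simp add: E_iff[OF \<delta>] comp_assoc D_scalar)
    show "a o\<^sub>L \<alpha> \<delta> b \<in> E (\<delta> \<otimes> \<epsilon>)" if \<epsilon>: "\<epsilon> \<in> carrier \<Gamma>" and "a \<in> E \<delta>" "b \<in> E \<epsilon>" for \<epsilon> a b
      using that(2,3) twist[OF \<delta> \<epsilon>] D_comp unfolding E_def by fastforce
    show "\<alpha> (inv \<delta>) (adj a) \<in> E (inv \<delta>)" if aE: "a \<in> E \<delta>" for a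
    proof -
      obtain d where d: "d \<in> D" and a: "a = d o\<^sub>L u \<delta>" using aE unfolding E_def by blast
      have \<delta>': "inv \<delta> \<in> carrier \<Gamma>" using \<delta> by simp
      \<comment> \<open>The cocycle identity for an element and its inverse identifies
        \<open>\<alpha> (inv \<delta>) (u \<delta>)\<close> with the adjoint of
        \<open>u (inv \<delta>)\<close>, which brings the adjoint of an element of degree \<delta>
        into the required form.\<close>
      have 1: "u (inv \<delta>) o\<^sub>L \<alpha> (inv \<delta>) (u \<delta>) = id_blinfun"
        using coc[OF \<delta>' \<delta>] \<delta> u1 by simp
      have "\<alpha> (inv \<delta>) (u \<delta>) = adj (u (inv \<delta>))"
        using arg_cong[OF 1, of "\<lambda>x. adj (u (inv \<delta>)) o\<^sub>L x"]
          unitaryD(4)[OF u[OF \<delta>'], of "\<alpha> (inv \<delta>) (u \<delta>)"] by simp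
      then have 2: "adj (\<alpha> (inv \<delta>) (u \<delta>)) = u (inv \<delta>)"
        using \<delta>' by simp
      have "\<alpha> (inv \<delta>) (adj a) = u (inv \<delta>) o\<^sub>L \<alpha> (inv \<delta>) (adj d)"
        using \<delta> \<delta>' d by (simp add: a adj_compose act_comp) (simp add: act_adj 2)
      also have "\<dots> = adj d o\<^sub>L u (inv \<delta>)"
        by (rule int[OF \<delta>' D_adj[OF d]])
      finally show ?thesis using D_adj[OF d] unfolding E_def by blast
    qed
  qed
  moreover have "abelian B"
    unfolding abelian_def
  proof (intro ballI)
    fix S T assume ST: "S \<in> B" "T \<in> B"
    obtain a b where S: "S = crossed_op a" and T: "T = crossed_op b"
      and ab: "\<And>\<delta>. \<delta> \<in> carrier \<Gamma> \<Longrightarrow> a \<delta> \<in> E \<delta>" "\<And>\<delta>. \<delta> \<in> carrier \<Gamma> \<Longrightarrow> b \<delta> \<in> E \<delta>"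
      using ST unfolding B_def by (elim gradedE) blast
    then have "\<forall>\<delta>\<in>carrier \<Gamma>. \<exists>c c'. c \<in> D \<and> c' \<in> D \<and> a \<delta> = c o\<^sub>L u \<delta> \<and> b \<delta> = c' o\<^sub>L u \<delta>"
      unfolding E_def by blast
    then obtain c c' where c: "\<And>\<delta>. \<delta> \<in> carrier \<Gamma> \<Longrightarrow> c \<delta> \<in> D" "\<And>\<delta>. \<delta> \<in> carrier \<Gamma> \<Longrightarrow> c' \<delta> \<in> D"
      and a: "\<And>\<delta>. \<delta> \<in> carrier \<Gamma> \<Longrightarrow> a \<delta> = c \<delta> o\<^sub>L u \<delta>"
      and b: "\<And>\<delta>. \<delta> \<in> carrier \<Gamma> \<Longrightarrow> b \<delta> = c' \<delta> o\<^sub>L u \<delta>"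
      by metis
    \<comment> \<open>Relative to the unitaries \<open>u \<delta> \<lambda>\<^sub>\<delta>\<close>
      the coefficients from \<open>D\<close> multiply by untwisted convolution.\<close>
    have prod: "crossed_op x o\<^sub>L crossed_op y = crossed_op (\<lambda>\<epsilon>. (\<Sum>\<delta>\<in>carrier \<Gamma>. k \<delta> o\<^sub>L l (inv \<delta> \<otimes> \<epsilon>)) o\<^sub>L u \<epsilon>)"
      if k: "\<And>\<delta>. \<delta> \<in> carrier \<Gamma> \<Longrightarrow> k \<delta> \<in> D" and l: "\<And>\<delta>. \<delta> \<in> carrier \<Gamma> \<Longrightarrow> l \<delta> \<in> D"
        and x: "\<And>\<delta>. \<delta> \<in> carrier \<Gamma> \<Longrightarrow> x \<delta> = k \<delta> o\<^sub>L u \<delta>"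
        and y: "\<And>\<delta>. \<delta> \<in> carrier \<Gamma> \<Longrightarrow> y \<delta> = l \<delta> o\<^sub>L u \<delta>" for x y k l
    proof -
      have "crossed_op x o\<^sub>L crossed_op y
          = crossed_op (\<lambda>\<epsilon>. \<Sum>\<delta>\<in>carrier \<Gamma>. x \<delta> o\<^sub>L \<alpha> \<delta> (y (inv \<delta> \<otimes> \<epsilon>)))"
        using k l by (intro crossed_op_comp) (auto simp: x y)
      also have "\<dots> = crossed_op (\<lambda>\<epsilon>. (\<Sum>\<delta>\<in>carrier \<Gamma>. k \<delta> o\<^sub>L l (inv \<delta> \<otimes> \<epsilon>)) o\<^sub>L u \<epsilon>)"
        unfolding comp_sum_left
      proof (intro crossed_op_cong sum.cong refl)
        fix \<epsilon> \<delta> assume \<epsilon>: "\<epsilon> \<in> carrier \<Gamma>" and \<delta>: "\<delta> \<in> carrier \<Gamma>"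
        have "\<delta> \<otimes> (inv \<delta> \<otimes> \<epsilon>) = \<epsilon>" using \<epsilon> \<delta> by (simp flip: m_assoc)
        then show "x \<delta> o\<^sub>L \<alpha> \<delta> (y (inv \<delta> \<otimes> \<epsilon>)) = k \<delta> o\<^sub>L l (inv \<delta> \<otimes> \<epsilon>) o\<^sub>L u \<epsilon>"
          using twist[of \<delta> "inv \<delta> \<otimes> \<epsilon>" "k \<delta>" "l (inv \<delta> \<otimes> \<epsilon>)"] \<epsilon> \<delta> by (simp add: x y k l)
      qed
      finally show ?thesis .
    qed
    have ST_eq: "S o\<^sub>L T = crossed_op (\<lambda>\<epsilon>. (\<Sum>\<delta>\<in>carrier \<Gamma>. c \<delta> o\<^sub>L c' (inv \<delta> \<otimes> \<epsilon>)) o\<^sub>L u \<epsilon>)"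
      unfolding S T by (rule prod) (simp_all add: c a b)
    have TS_eq: "T o\<^sub>L S = crossed_op (\<lambda>\<epsilon>. (\<Sum>\<delta>\<in>carrier \<Gamma>. c' \<delta> o\<^sub>L c (inv \<delta> \<otimes> \<epsilon>)) o\<^sub>L u \<epsilon>)"
      unfolding S T by (rule prod) (simp_all add: c a b)
    show "S o\<^sub>L T = T o\<^sub>L S"
      unfolding ST_eq TS_eq
    proof (rule crossed_op_cong)
      fix \<epsilon> assume \<epsilon>: "\<epsilon> \<in> carrier \<Gamma>"
      \<comment> \<open>The substitution of \<open>\<epsilon> \<otimes> inv \<delta>\<close> for
        \<delta> exchanges the two factors of the convolution; commutativity of \<Gamma> and of
        \<open>D\<close> does the rest.\<close>
      have "(\<Sum>\<delta>\<in>carrier \<Gamma>. c' \<delta> o\<^sub>L c (inv \<delta> \<otimes> \<epsilon>))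
          = (\<Sum>\<delta>\<in>carrier \<Gamma>. c' (\<epsilon> \<otimes> inv \<delta>) o\<^sub>L c (inv (\<epsilon> \<otimes> inv \<delta>) \<otimes> \<epsilon>))"
        by (rule sum.reindex_bij_betw[OF bij_quotient[OF \<epsilon>], symmetric])
      also have "\<dots> = (\<Sum>\<delta>\<in>carrier \<Gamma>. c \<delta> o\<^sub>L c' (inv \<delta> \<otimes> \<epsilon>))"
      proof (rule sum.cong)
        fix \<delta> assume \<delta>: "\<delta> \<in> carrier \<Gamma>"
        have "inv (\<epsilon> \<otimes> inv \<delta>) \<otimes> \<epsilon> = \<delta>"
          using \<epsilon> \<delta> by (simp add: inv_mult_group m_assoc)
        moreover have "\<epsilon> \<otimes> inv \<delta> = inv \<delta> \<otimes> \<epsilon>"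
          using \<epsilon> \<delta> by (simp add: m_comm)
        ultimately show "c' (\<epsilon> \<otimes> inv \<delta>) o\<^sub>L c (inv (\<epsilon> \<otimes> inv \<delta>) \<otimes> \<epsilon>) = c \<delta> o\<^sub>L c' (inv \<delta> \<otimes> \<epsilon>)"
          using \<epsilon> \<delta> c by (simp add: D_commute)
      qed simp
      finally show "(\<Sum>\<delta>\<in>carrier \<Gamma>. c \<delta> o\<^sub>L c' (inv \<delta> \<otimes> \<epsilon>)) o\<^sub>L u \<epsilon>
          = (\<Sum>\<delta>\<in>carrier \<Gamma>. c' \<delta> o\<^sub>L c (inv \<delta> \<otimes> \<epsilon>)) o\<^sub>L u \<epsilon>" by simp
    qed
  qed
  moreover have "B \<subseteq> crossed_product \<Gamma> A \<alpha>"
  proof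
    fix T assume "T \<in> B"
    then obtain a where a: "\<And>\<delta>. \<delta> \<in> carrier \<Gamma> \<Longrightarrow> a \<delta> \<in> E \<delta>" and T: "T = crossed_op a"
      unfolding B_def by (elim gradedE) blast
    have "a \<delta> \<in> A" if "\<delta> \<in> carrier \<Gamma>" for \<delta>
      using a[OF that] uA[OF that] unfolding E_def by auto
    then show "T \<in> crossed_product \<Gamma> A \<alpha>"
      unfolding T crossed_product_eq by (rule gradedI)
  qed
  moreover have "crossed_image \<Gamma> \<alpha> D \<subseteq> B"
  proof
    fix T assume "T \<in> crossed_image \<Gamma> \<alpha> D"
    then obtain d where d: "d \<in> D" and T: "T = crossed_op (single d)"
      unfolding image_D_eq by blast
    have "single d \<delta> \<in> E \<delta>" if "\<delta> \<in> carrier \<Gamma>" for \<delta>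
      using d that by (auto simp: E_iff u1)
    then show "T \<in> B" unfolding B_def T by (rule gradedI)
  qed
  ultimately have B: "B = crossed_image \<Gamma> \<alpha> D"
    using masa unfolding is_masa_def by blast
  \<comment> \<open>The witness of strictness is \<open>u \<gamma> \<lambda>\<^sub>\<gamma>\<close>:
    elements of the copy of \<open>D\<close> have coefficient 0 in degree \<gamma>, and a unitary is
    not 0.\<close>
  define a where "a \<delta> = (if \<delta> = \<gamma> then u \<gamma> else 0)" for \<delta>
  have a: "a \<delta> \<in> E \<delta>" if "\<delta> \<in> carrier \<Gamma>" for \<delta>
    using that unitaryD(3)[OF u[OF \<gamma>(1)]] by (auto simp: a_def E_iff)
  then have "crossed_op a \<in> crossed_image \<Gamma> \<alpha> D"
    unfolding B[symmetric] B_def by (rule gradedI)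
  then obtain d where d: "d \<in> D" "crossed_op a = crossed_op (single d)"
    unfolding image_D_eq by blast
  have "u \<gamma> = block \<one> (inv \<gamma>) (crossed_op a)"
    using coeff_crossed_op[OF \<gamma>(1), of a] \<gamma> by (simp add: a_def)
  also have "\<dots> = 0"
    unfolding d(2) using coeff_crossed_op[OF \<gamma>(1), of "single d"] \<gamma> by simp
  finally show False
    using unitaryD(2)[OF u[OF \<gamma>(1)]] id_neq_zero[where 'x='x] by simp
qed

end

section \<open>Actions of cyclic groups of prime order\<close>

lemma finite_integer_mod_group: "0 < p \<Longrightarrow> finite (carrier (integer_mod_group p))"
  by (simp add: carrier_integer_mod_group)

text \<open>For the construction of the perturbed action, \<phi> is the automorphism at the degree
  \<open>g\<close> of a nonzero coefficient. Every residue is a multiple of \<open>g\<close>, so the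
  cocycle is prescribed by the number of steps of \<phi> needed to reach it.\<close>

lemma (in regular_masa) cyclic_not_masa_iff:
  assumes p: "prime p" and act: "cstar_action (integer_mod_group p) A \<alpha>"
  shows "\<not> is_masa (crossed_image (integer_mod_group p) \<alpha> D) (crossed_product (integer_mod_group p) A \<alpha>)
    \<longleftrightarrow> (\<exists>\<beta>. cstar_action (integer_mod_group p) A \<beta> \<and>
          (\<forall>\<gamma>\<in>carrier (integer_mod_group p). \<forall>a\<in>D. \<beta> \<gamma> a = a) \<and>
          exterior_equivalent (integer_mod_group p) A \<alpha> \<beta>)"
    (is "?L \<longleftrightarrow> ?R")
proof -
  have p1: "1 < p" using p by (rule prime_gt_1_nat)
  define Z where "Z = integer_mod_group p"
  have carr: "carrier Z = {0..<int p}"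
    using p1 by (simp add: Z_def carrier_integer_mod_group)
  have mult: "x \<otimes>\<^bsub>Z\<^esub> y = (x + y) mod int p" for x y
    by (simp add: Z_def)
  have one: "\<one>\<^bsub>Z\<^esub> = 0" by (simp add: Z_def)
  interpret ext: regular_masa_action A D Z \<alpha>
    unfolding Z_def
    by (intro regular_masa_action.intro finite_cstar_action.intro finite_cstar_action_axioms.intro
        regular_masa_axioms unital_cstar_axioms act finite_integer_mod_group)
      (use p1 in auto)
  show ?thesis
    unfolding Z_def[symmetric]
  proof
    assume "\<exists>\<beta>. cstar_action Z A \<beta> \<and> (\<forall>\<gamma>\<in>carrier Z. \<forall>a\<in>D. \<beta> \<gamma> a = a) \<and> exterior_equivalent Z A \<alpha> \<beta>"
    moreover have "1 \<in> carrier Z" "1 \<noteq> \<one>\<^bsub>Z\<^esub>"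
      using p1 by (auto simp: carr one)
    ultimately show "\<not> is_masa (crossed_image Z \<alpha> D) (crossed_product Z A \<alpha>)"
      using ext.exterior_fixing_not_masa by blast
  next
    assume "\<not> is_masa (crossed_image Z \<alpha> D) (crossed_product Z A \<alpha>)"
    then obtain g b where g: "g \<in> carrier Z" "g \<noteq> 0"
      and b: "b \<in> A" "b \<noteq> 0" "\<And>d. d \<in> D \<Longrightarrow> d o\<^sub>L b = b o\<^sub>L \<alpha> g d"
      using ext.not_masa_intertwiner unfolding one by blast
    define \<phi> where "\<phi> = \<alpha> g"
    have \<phi>: "star_automorphism A \<phi>" unfolding \<phi>_def by (rule ext.auto[OF g(1)])
    have pow: "(\<phi> ^^ n) a = \<alpha> ((int n * g) mod int p) a" if a: "a \<in> A" for n a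
    proof (induction n)
      case 0
      then show ?case using ext.act_one[OF a] by (simp add: one)
    next
      case (Suc n)
      have "(int n * g) mod int p \<in> carrier Z" using p1 by (simp add: carr)
      then have "\<alpha> (g \<otimes>\<^bsub>Z\<^esub> ((int n * g) mod int p)) a = \<phi> (\<alpha> ((int n * g) mod int p) a)"
        unfolding \<phi>_def using ext.act_mult[OF g(1)] a by blast
      moreover have "g \<otimes>\<^bsub>Z\<^esub> ((int n * g) mod int p) = (int (Suc n) * g) mod int p"
        by (simp add: mult mod_add_right_eq algebra_simps)
      ultimately show ?case using Suc by simp
    qed
    have per: "(\<phi> ^^ p) a = a" if "a \<in> A" for a
      using pow[OF that, of p] ext.act_one[OF that] by (simp add: one)
    obtain u where u: "unitary u" and int: "\<And>d. d \<in> D \<Longrightarrow> u o\<^sub>L \<phi> d = d o\<^sub>L u"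
      and np: "norm_prod \<phi> u p = id_blinfun"
      using normalized_intertwining_unitary[OF \<phi> per _ b(1,2)] b(3) p1 unfolding \<phi>_def
      by (metis (no_types, lifting) less_trans zero_less_one)
    note U = unitary_norm_prod[OF \<phi> u]
    \<comment> \<open>The p-fold product is the identity, so the products are periodic and depend
      only on residues of their length.\<close>
    have np_mod: "norm_prod \<phi> u (n mod p) = norm_prod \<phi> u n" for n
    proof -
      have "norm_prod \<phi> u (p * k) = id_blinfun" for k
      proof (induction k)
        case (Suc k)
        have "norm_prod \<phi> u (p + p * k) = norm_prod \<phi> u p o\<^sub>L (\<phi> ^^ p) (norm_prod \<phi> u (p * k))"
          by (rule norm_prod_add[OF \<phi> u])
        then show ?case using Suc by (simp add: np per)
      qed simp
      then have "norm_prod \<phi> u (n mod p + p * (n div p)) = norm_prod \<phi> u (n mod p)"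
        unfolding norm_prod_add[OF \<phi> u]
        by (simp add: auto_id[OF star_automorphism_funpow[OF \<phi>]])
      then show ?thesis by simp
    qed
    \<comment> \<open>This is the step that uses primality of the group order.\<close>
    have "coprime g (int p)"
    proof -
      have "\<not> int p dvd g"
        using g p1 by (auto simp: carr dest: zdvd_imp_le)
      then show ?thesis
        using p prime_imp_coprime[of "int p" g] by (simp add: coprime_commute)
    qed
    then obtain q where q: "[g * q = 1] (mod int p)"
      using cong_solve_coprime_int by blast
    \<comment> \<open>With \<open>q\<close> inverse to \<open>g\<close> modulo \<open>p\<close>, the
      number \<open>m k\<close> solves \<open>m k * g = k\<close> modulo \<open>p\<close>; hence
      \<open>\<alpha> k\<close> is the power \<open>m k\<close> of \<phi>.\<close>
    define m where "m k = nat ((k * q) mod int p)" for k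
    have im: "int (m k) = (k * q) mod int p" for k
      using p1 by (simp add: m_def)
    have mg: "(int (m k) * g) mod int p = k" if "k \<in> carrier Z" for k
    proof -
      have "[k * q * g = k * 1] (mod int p)"
        using cong_scalar_left[OF q, of k] by (simp add: mult_ac)
      then show ?thesis
        using that by (simp add: im cong_def carr mod_mult_left_eq)
    qed
    define v where "v k = norm_prod \<phi> u (m k)" for k
    have \<alpha>: "\<alpha> k a = (\<phi> ^^ m k) a" if "k \<in> carrier Z" "a \<in> A" for k a
      using pow[OF that(2), of "m k"] mg[OF that(1)] by simp
    have v: "unitary (v k)" for k unfolding v_def by (rule U)
    \<comment> \<open>The length \<open>m\<close> is additive only modulo \<open>p\<close>.
      Periodicity of the products absorbs the wrap-around, and \<open>norm_prod_add\<close> supplies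
      the cocycle identity.\<close>
    have coc: "v (k \<otimes>\<^bsub>Z\<^esub> l) = v k o\<^sub>L \<alpha> k (v l)" if k: "k \<in> carrier Z" and l: "l \<in> carrier Z" for k l
    proof -
      have "int (m (k \<otimes>\<^bsub>Z\<^esub> l)) = int ((m k + m l) mod p)"
        by (simp add: im mult zmod_int mod_mult_left_eq mod_add_eq distrib_right)
      then have "m (k \<otimes>\<^bsub>Z\<^esub> l) = (m k + m l) mod p" by linarith
      then have "v (k \<otimes>\<^bsub>Z\<^esub> l) = norm_prod \<phi> u (m k + m l)"
        by (simp add: v_def np_mod)
      then show ?thesis
        using norm_prod_add[OF \<phi> u] \<alpha>[OF k unitaryD(1)[OF v]] by (simp add: v_def)
    qed
    define \<beta> where "\<beta> k a = v k o\<^sub>L \<alpha> k a o\<^sub>L adj (v k)" for k a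
    have "cstar_action Z A \<beta>"
      unfolding \<beta>_def using ext.cstar_action_perturbed[OF v coc] .
    moreover have "\<beta> k d = d" if k: "k \<in> carrier Z" and d: "d \<in> D" for k d
      using norm_prod_intertwines[OF \<phi> u int d, of "m k"] \<alpha>[OF k, of d] d unitaryD(3)[OF v]
      by (simp add: \<beta>_def v_def comp_assoc)
    moreover have "exterior_equivalent Z A \<alpha> \<beta>"
      unfolding exterior_equivalent_def ext.action_cocycle_iff using v coc \<beta>_def by blast
    ultimately show "\<exists>\<beta>. cstar_action Z A \<beta> \<and> (\<forall>\<gamma>\<in>carrier Z. \<forall>a\<in>D. \<beta> \<gamma> a = a) \<and>
        exterior_equivalent Z A \<alpha> \<beta>" by blast
  qed
qed

section \<open>Cantor sets\<close>

lemma compact_UNIV_nat_bool: "compact (UNIV :: (nat \<Rightarrow> bool) set)"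
proof -
  have "compact (UNIV :: bool set)" by (simp add: finite_imp_compact)
  then have "compact_space (euclidean :: bool topology)"
    by (simp add: compact_space_def)
  then have "compact_space (product_topology (\<lambda>i::nat. euclidean :: bool topology) UNIV)"
    by (simp add: compact_space_product_topology)
  then show ?thesis
    unfolding euclidean_product_topology by (simp add: compact_space_def)
qed

lemma nat_bool_clopen_base:
  fixes x :: "nat \<Rightarrow> bool"
  assumes "open U" "x \<in> U"
  shows "\<exists>Z. x \<in> Z \<and> Z \<subseteq> U \<and> open Z \<and> closed Z"
proof -
  obtain X where X: "x \<in> (\<Pi>\<^sub>E i\<in>UNIV. X i)" "finite {i. X i \<noteq> UNIV}" "(\<Pi>\<^sub>E i\<in>UNIV. X i) \<subseteq> U"
    using product_topology_open_contains_basis[of "\<lambda>i::nat. euclidean :: bool topology" UNIV U x] assms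
    by (auto simp: open_fun_def)
  define I where "I = {i. X i \<noteq> UNIV}"
  \<comment> \<open>This is the cylinder of all sequences agreeing with \<open>x\<close> on the
    finitely many coordinates that the basic open set restricts.\<close>
  define Z where "Z = {f. \<forall>i\<in>I. f i \<in> {x i}}"
  have "open Z"
    unfolding Z_def using product_topology_basis'[of I "\<lambda>i. {x i}" "\<lambda>i. i"] X(2)
    by (simp add: I_def open_discrete)
  moreover have "closed Z"
  proof -
    have eq: "Z = (\<Inter>i\<in>I. {f. f i = x i})" by (auto simp: Z_def)
    show ?thesis
      unfolding eq
      by (intro closed_INT ballI closed_Collect_eq continuous_on_product_coordinates continuous_on_const)
  qed
  moreover have "Z \<subseteq> U"
  proof
    fix f assume f: "f \<in> Z"
    have "f i \<in> X i" for i
    proof (cases "i \<in> I")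
      case True
      then have "f i = x i" using f by (simp add: Z_def)
      moreover have "x i \<in> X i" using X(1) by (rule PiE_mem) simp
      ultimately show ?thesis by simp
    qed (simp add: I_def)
    then have "f \<in> (\<Pi>\<^sub>E i\<in>UNIV. X i)" by (simp add: PiE_iff)
    then show "f \<in> U" using X(3) by (rule subsetD[rotated])
  qed
  moreover have "x \<in> Z" by (simp add: Z_def)
  ultimately show ?thesis by (intro exI[of _ Z] conjI)
qed

lemma cantor_clopen_base:
  fixes S :: "'a::t2_space set"
  assumes S: "S homeomorphic (UNIV :: (nat \<Rightarrow> bool) set)"
    and U: "openin (top_of_set S) U" "x \<in> U"
  shows "\<exists>Z. x \<in> Z \<and> Z \<subseteq> U \<and> openin (top_of_set S) Z \<and> compact Z"
proof -
  obtain f g where hom: "homeomorphism S (UNIV :: (nat \<Rightarrow> bool) set) f g"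
    using S unfolding homeomorphic_def by blast
  have "open (f ` U)"
    using homeomorphism_imp_open_map[OF hom U(1)] by simp
  then obtain Z where Z: "f x \<in> Z" "Z \<subseteq> f ` U" "open Z" "closed Z"
    using nat_bool_clopen_base[of "f ` U" "f x"] U(2) by blast
  have US: "U \<subseteq> S" using U(1) by (rule openin_imp_subset)
  have gf: "g (f y) = y" if "y \<in> S" for y
    using hom that by (simp add: homeomorphism_def)
  have "openin (top_of_set S) (g ` Z)"
    using homeomorphism_imp_open_map[OF homeomorphism_symD[OF hom], of Z] Z(3) by simp
  moreover have "compact (g ` Z)"
    using hom Z(4) compact_UNIV_nat_bool
    by (intro compact_continuous_image)
      (auto simp: homeomorphism_def intro: continuous_on_subset compact_Int_closed[of UNIV, simplified])
  moreover have "g ` Z \<subseteq> U"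
  proof
    fix y assume "y \<in> g ` Z"
    then obtain u where "u \<in> U" "y = g (f u)" using Z(2) by blast
    then show "y \<in> U" using gf[of u] US by auto
  qed
  moreover have "x \<in> g ` Z"
    using Z(1) gf[of x] U(2) US by (metis imageI subsetD)
  ultimately show ?thesis by (intro exI[of _ "g ` Z"] conjI)
qed

section \<open>Etale groupoids over the Cantor set\<close>

lemma homeomorphism_inverse:
  assumes "homeomorphism S T f f'"
  shows "x \<in> S \<Longrightarrow> f' (f x) = x" "y \<in> T \<Longrightarrow> f (f' y) = y" "y \<in> T \<Longrightarrow> f' y \<in> S" "continuous_on T f'"
  using assms unfolding homeomorphism_def by auto

lemma continuous_extend_zero:
  fixes f :: "'a::topological_space \<Rightarrow> complex"
  assumes "open S" "closed S" "continuous_on S f"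
  shows "continuous_on UNIV (\<lambda>x. if x \<in> S then f x else 0)"
proof -
  have "continuous_on (S \<union> - S) (\<lambda>x. if x \<in> S then f x else 0)"
    using assms
    by (intro continuous_on_open_Un)
      (auto simp: open_Compl cong: continuous_on_cong_simp intro: continuous_on_eq[of _ f] continuous_on_eq[of _ "\<lambda>_. 0"])
  then show ?thesis by (simp add: Un_commute)
qed

locale cantor_groupoid = topological_groupoid G for G :: "'g::t2_space gpd" +
  assumes etale: "etale_groupoid G"
    and cantor: "units G homeomorphic (UNIV :: (nat \<Rightarrow> bool) set)"
begin

abbreviation r where "r \<equiv> rng G"
abbreviation s where "s \<equiv> src G"
abbreviation iv where "iv \<equiv> ginv G"
abbreviation mul (infixl "\<cdot>" 70) where "g \<cdot> h \<equiv> gmult G g h"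
abbreviation X where "X \<equiv> units G"

lemma units_iff: "x \<in> X \<longleftrightarrow> r x = x"
  unfolding units_def using rng_rng by (metis rangeE rangeI)

lemma units_iff_src: "x \<in> X \<longleftrightarrow> s x = x"
  unfolding units_iff by (metis rng_src src_rng)

lemma rng_units [simp]: "r g \<in> X" and src_units [simp]: "s g \<in> X"
  by (simp_all add: units_iff rng_rng rng_src)

lemma unit_simps [simp]: "x \<in> X \<Longrightarrow> r x = x" "x \<in> X \<Longrightarrow> s x = x"
  using units_iff units_iff_src by auto

declare rng_inv [simp] src_inv [simp] rng_mult [simp] src_mult [simp] mult_inv [simp] inv_mult [simp]
  mult_rng [simp] mult_src [simp]

lemma cancel_left [simp]: "s g = r h \<Longrightarrow> iv g \<cdot> (g \<cdot> h) = h"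
  using mult_assoc[of "iv g" g h] by simp

lemma cancel_right [simp]: "s g = r h \<Longrightarrow> (g \<cdot> h) \<cdot> iv h = g"
proof -
  assume *: "s g = r h"
  then have "(g \<cdot> h) \<cdot> iv h = g \<cdot> (h \<cdot> iv h)" by (simp add: mult_assoc)
  then show ?thesis using * mult_src[of g] by simp
qed

lemma cancel_right_inv [simp]: "s g = s h \<Longrightarrow> (g \<cdot> iv h) \<cdot> h = g"
proof -
  assume *: "s g = s h"
  then have "(g \<cdot> iv h) \<cdot> h = g \<cdot> (iv h \<cdot> h)" by (simp add: mult_assoc)
  then show ?thesis using * mult_src[of g] by simp
qed

lemma cancel_left_inv [simp]: "r g = r h \<Longrightarrow> g \<cdot> (iv g \<cdot> h) = h"
proof -
  assume *: "r g = r h"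
  then have "g \<cdot> (iv g \<cdot> h) = (g \<cdot> iv g) \<cdot> h" by (intro mult_assoc[symmetric]) simp_all
  then show ?thesis using * mult_rng[of h] by simp
qed

lemma inv_inv_g [simp]: "iv (iv g) = g"
  using cancel_left[of "iv g" g] mult_src[of "iv (iv g)"] by simp

lemma inv_eqI: "s g = r h \<Longrightarrow> g \<cdot> h = r g \<Longrightarrow> iv g = h"
  using cancel_left[of g h] mult_src[of "iv g"] by simp

lemma inv_unit [simp]: "x \<in> X \<Longrightarrow> iv x = x"
  by (rule inv_eqI) (use mult_src[of x] in auto)

lemma inv_prod: "s g = r h \<Longrightarrow> iv (g \<cdot> h) = iv h \<cdot> iv g"
proof (rule inv_eqI)
  assume *: "s g = r h"
  have "(g \<cdot> h) \<cdot> (iv h \<cdot> iv g) = ((g \<cdot> h) \<cdot> iv h) \<cdot> iv g"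
    using * by (intro mult_assoc[symmetric]) simp_all
  then show "(g \<cdot> h) \<cdot> (iv h \<cdot> iv g) = r (g \<cdot> h)" using * by simp
qed simp

lemma quotient_quotient: "s g = s h \<Longrightarrow> s h = s k \<Longrightarrow> (g \<cdot> iv k) \<cdot> iv (h \<cdot> iv k) = g \<cdot> iv h"
proof -
  assume *: "s g = s h" "s h = s k"
  have "(g \<cdot> iv k) \<cdot> (k \<cdot> iv h) = ((g \<cdot> iv k) \<cdot> k) \<cdot> iv h"
    using * by (intro mult_assoc[symmetric]) simp_all
  then show ?thesis using * by (simp add: inv_prod)
qed

lemma quotient_unit_iff: "s g = s h \<Longrightarrow> g \<cdot> iv h \<in> X \<longleftrightarrow> g = h"
proof
  assume *: "s g = s h" and u: "g \<cdot> iv h \<in> X"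
  have "r (g \<cdot> iv h) = r g" "s (g \<cdot> iv h) = r h" using * by simp_all
  then have "r g = g \<cdot> iv h" "r h = g \<cdot> iv h" using u by simp_all
  moreover have "g = (g \<cdot> iv h) \<cdot> h" using * by simp
  ultimately show "g = h" using mult_rng[of h] by metis
qed simp

subsection \<open>Topology\<close>

lemma cont_mult:
  assumes "continuous_on S f" "continuous_on S k" "\<And>x. x \<in> S \<Longrightarrow> s (f x) = r (k x)"
  shows "continuous_on S (\<lambda>x. f x \<cdot> k x)"
  using continuous_on_compose2[OF continuous_mult continuous_on_Pair[OF assms(1,2)]] assms(3) by auto

lemma cont_inv: "continuous_on S f \<Longrightarrow> continuous_on S (\<lambda>x. iv (f x))"
  using continuous_on_compose2[OF continuous_inv] by blast

lemma cont_rng: "continuous_on S r"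
  using cont_mult[of UNIV "\<lambda>g. g" iv] continuous_on_subset continuous_inv by (auto simp: continuous_on_id)

lemma cont_src: "continuous_on S s"
  using cont_mult[of UNIV iv "\<lambda>g. g"] continuous_on_subset continuous_inv by (auto simp: continuous_on_id)

lemma rng_chart: "\<exists>U r'. open U \<and> g \<in> U \<and> openin (top_of_set X) (r ` U) \<and> homeomorphism U (r ` U) r r'"
  and src_chart: "\<exists>U s'. open U \<and> g \<in> U \<and> openin (top_of_set X) (s ` U) \<and> homeomorphism U (s ` U) s s'"
  using etale unfolding etale_groupoid_def local_homeomorphism_onto_def by blast+

lemma closed_units: "closed X"
proof -
  have eq: "X = {g. r g = g}" using units_iff by blast
  show ?thesis
    unfolding eq by (rule closed_Collect_eq[OF cont_rng continuous_on_id])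
qed

text \<open>Near a unit the range map is injective. An arrow \<open>g\<close> and the unit
  \<open>r g\<close> have the same range, so they coincide as soon as both lie in one chart.\<close>

lemma open_units: "open X"
proof (subst open_subopen, intro ballI)
  fix x assume x: "x \<in> X"
  obtain U r' where U: "open U" "x \<in> U" "homeomorphism U (r ` U) r r'"
    using rng_chart by blast
  have inj: "inj_on r U" using U(3) by (metis homeomorphism_def inj_on_inverseI)
  define V where "V = U \<inter> r -` U"
  have "open V"
    unfolding V_def using U(1) cont_rng[of UNIV] by (simp add: open_Int open_vimage)
  moreover have "x \<in> V" using U(2) x by (simp add: V_def)
  moreover have "V \<subseteq> X"
  proof
    fix g assume "g \<in> V"
    then have "g \<in> U" "r g \<in> U" "r (r g) = r g" by (auto simp: V_def rng_rng)
    then have "r g = g" using inj by (metis inj_onD)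
    then show "g \<in> X" by (simp add: units_iff)
  qed
  ultimately show "\<exists>T. open T \<and> x \<in> T \<and> T \<subseteq> X" by blast
qed

lemma compact_units: "compact X"
  using homeomorphic_compactness[OF cantor] compact_UNIV_nat_bool by blast

lemma openin_units: "openin (top_of_set X) U \<longleftrightarrow> open U \<and> U \<subseteq> X"
  using openin_open_eq[OF open_units] by blast

text \<open>As \<open>X\<close> is open, compact and Hausdorff, these are its clopen subsets.
  Compactness and openness are the properties that images of compact open bisections visibly
  have.\<close>

definition clop :: "'g set \<Rightarrow> bool" where
  "clop Z \<longleftrightarrow> Z \<subseteq> X \<and> open Z \<and> compact Z"

lemma clopD: "clop Z \<Longrightarrow> Z \<subseteq> X" "clop Z \<Longrightarrow> open Z" "clop Z \<Longrightarrow> compact Z" "clop Z \<Longrightarrow> closed Z"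
  by (auto simp: clop_def compact_imp_closed)

lemma clop_units: "clop X"
  by (simp add: clop_def open_units compact_units)

lemma clop_empty: "clop {}"
  by (simp add: clop_def)

lemma clop_Un: "clop Y \<Longrightarrow> clop Z \<Longrightarrow> clop (Y \<union> Z)"
  by (auto simp: clop_def compact_Un)

lemma clop_Diff: "clop Y \<Longrightarrow> clop Z \<Longrightarrow> clop (Y - Z)"
  by (auto simp: clop_def open_Diff compact_diff compact_imp_closed)

lemma clop_base:
  assumes "open U" "x \<in> U" "x \<in> X"
  shows "\<exists>Z. clop Z \<and> x \<in> Z \<and> Z \<subseteq> U"
  using cantor_clopen_base[OF cantor, of "U \<inter> X" x] assms open_units
  by (auto simp: openin_units clop_def)

lemma open_map_src: "open U \<Longrightarrow> open (s ` U)"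
  and open_map_rng: "open U \<Longrightarrow> open (r ` U)"
proof -
  assume U: "open U"
  have *: "open (f ` U)"
    if chart: "\<And>g. \<exists>V f'. open V \<and> g \<in> V \<and> openin (top_of_set X) (f ` V) \<and> homeomorphism V (f ` V) f f'"
    for f :: "'g \<Rightarrow> 'g"
  proof (subst open_subopen, intro ballI)
    fix y assume "y \<in> f ` U"
    then obtain g where g: "g \<in> U" "y = f g" by blast
    obtain V f' where V: "open V" "g \<in> V" "openin (top_of_set X) (f ` V)" "homeomorphism V (f ` V) f f'"
      using chart by blast
    have "openin (top_of_set (f ` V)) (f ` (V \<inter> U))"
      using V(4) by (rule homeomorphism_imp_open_map) (simp add: U openin_open_Int)
    then have "openin (top_of_set X) (f ` (V \<inter> U))"
      using V(3) openin_trans by blast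
    then have "open (f ` (V \<inter> U))" by (simp add: openin_units)
    then show "\<exists>T. open T \<and> y \<in> T \<and> T \<subseteq> f ` U" using g V(2) by blast
  qed
  show "open (s ` U)" by (rule *) (rule src_chart)
  show "open (r ` U)" by (rule *) (rule rng_chart)
qed

lemma bisectionD:
  assumes "compact_open_bisection G W"
  shows "compact W" "open W" "inj_on r W" "inj_on s W" "clop (s ` W)" "clop (r ` W)"
proof -
  show 1: "compact W" "open W" "inj_on r W" "inj_on s W"
    using assms by (auto simp: compact_open_bisection_def)
  then show "clop (s ` W)" "clop (r ` W)"
    unfolding clop_def
    by (auto intro: open_map_src open_map_rng compact_continuous_image cont_src cont_rng)
qed

text \<open>A neighbourhood contained in charts of both maps is shrunk through its sources: the part
  of the source chart over a clopen set is open as a preimage and compact as the image of that set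
  under the continuous section.\<close>

lemma bisection_base:
  assumes "open U" "g \<in> U"
  shows "\<exists>W. compact_open_bisection G W \<and> g \<in> W \<and> W \<subseteq> U"
proof -
  obtain V1 s' where V1: "open V1" "g \<in> V1" "openin (top_of_set X) (s ` V1)" "homeomorphism V1 (s ` V1) s s'"
    using src_chart by blast
  obtain V2 r' where V2: "open V2" "g \<in> V2" "homeomorphism V2 (r ` V2) r r'"
    using rng_chart by blast
  define N where "N = V1 \<inter> V2 \<inter> U"
  have N: "open N" "g \<in> N" using assms V1 V2 by (auto simp: N_def open_Int)
  \<comment> \<open>Choosing \<open>Z\<close> inside the sources of \<open>N\<close> matters: with
    the source map injective on \<open>V1\<close>, everything in \<open>V1\<close> over
    \<open>Z\<close> already lies in \<open>N\<close>, hence in the range chart and in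
    \<open>U\<close>.\<close>
  obtain Z where Z: "clop Z" "s g \<in> Z" "Z \<subseteq> s ` N"
    using clop_base[OF open_map_src[OF N(1)], of "s g"] N(2) by auto
  define W where "W = V1 \<inter> s -` Z"
  have s's: "s' (s h) = h" if "h \<in> V1" for h using V1(4) that by (simp add: homeomorphism_def)
  have inj1: "inj_on s V1" using s's by (metis inj_on_inverseI)
  have WN: "W \<subseteq> N"
  proof
    fix h assume h: "h \<in> W"
    then obtain n where n: "n \<in> N" "s h = s n" using Z(3) by (auto simp: W_def)
    then have "h = n" using inj1 h by (auto simp: W_def N_def dest: inj_onD)
    then show "h \<in> N" using n by simp
  qed
  have "W = s' ` Z"
  proof
    show "W \<subseteq> s' ` Z" using s's by (force simp: W_def)
    show "s' ` Z \<subseteq> W"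
    proof
      fix h assume "h \<in> s' ` Z"
      then obtain n where "n \<in> N" "s n \<in> Z" "h = s' (s n)" using Z(3) by blast
      then show "h \<in> W" using s's by (auto simp: W_def N_def)
    qed
  qed
  moreover have "continuous_on Z s'"
    using V1(4) Z(3) by (auto simp: homeomorphism_def N_def intro: continuous_on_subset)
  ultimately have "compact W" using clopD(3)[OF Z(1)] by (simp add: compact_continuous_image)
  moreover have "open W"
    unfolding W_def using V1(1) clopD(2)[OF Z(1)] cont_src[of UNIV] by (simp add: open_Int open_vimage)
  moreover have "inj_on s W" using inj1 by (rule inj_on_subset) (auto simp: W_def)
  moreover have "inj_on r W"
  proof (rule inj_on_subset)
    show "inj_on r V2" using V2(3) by (metis homeomorphism_def inj_on_inverseI)
  qed (use WN in \<open>auto simp: N_def\<close>)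
  moreover have "g \<in> W" using V1(2) Z(2) by (simp add: W_def)
  ultimately show ?thesis
    using WN by (auto simp: compact_open_bisection_def N_def)
qed

lemma bisection_sections:
  assumes W: "compact_open_bisection G W"
  obtains \<sigma> \<rho> where "homeomorphism W (s ` W) s \<sigma>" "homeomorphism W (r ` W) r \<rho>"
  using homeomorphism_compact[OF bisectionD(1)[OF W] cont_src refl bisectionD(4)[OF W]]
    homeomorphism_compact[OF bisectionD(1)[OF W] cont_rng refl bisectionD(3)[OF W]] that by blast

lemma CcI:
  assumes "continuous_on UNIV f" "compact K" "{g. f g \<noteq> 0} \<subseteq> K"
  shows "f \<in> Cc G"
proof -
  have "closure {g. f g \<noteq> 0} \<subseteq> K"
    using assms by (simp add: closure_minimal compact_imp_closed)
  then have "compact (closure {g. f g \<noteq> 0})"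
    using assms(2) compact_Int_closed[of K "closure {g. f g \<noteq> 0}"] by (simp add: Int_absorb1)
  then show ?thesis using assms(1) by (simp add: Cc_def)
qed

lemma CcD:
  assumes "f \<in> Cc G"
  shows "continuous_on UNIV f" "compact (closure {g. f g \<noteq> 0})"
  using assms by (auto simp: Cc_def)

subsection \<open>The reduced C*-algebra\<close>

lemma regular_rep_linear:
  assumes "is_regular_rep G f T"
  shows "complex_linear T"
  unfolding complex_linear_def
proof (intro allI ell2_eqI)
  fix c \<xi> g
  have "Rep_ell2 (T (scaleC_ell2 c \<xi>)) g
      = (\<Sum>\<^sub>\<infinity>h | s h = s g. c * (f (g \<cdot> iv h) * Rep_ell2 \<xi> h))"
    using assms by (simp add: is_regular_rep_def mult.left_commute)
  also have "\<dots> = Rep_ell2 (scaleC_ell2 c (T \<xi>)) g"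
    using assms unfolding infsum_cmult_right' by (simp add: is_regular_rep_def)
  finally show "Rep_ell2 (T (scaleC_ell2 c \<xi>)) g = Rep_ell2 (scaleC_ell2 c (T \<xi>)) g" .
qed

lemma regular_rep_ket:
  assumes "is_regular_rep G f T"
  shows "Rep_ell2 (T (ket h)) g = (if s h = s g then f (g \<cdot> iv h) else 0)"
proof -
  have "Rep_ell2 (T (ket h)) g = (\<Sum>\<^sub>\<infinity>k | s k = s g. f (g \<cdot> iv k) * Rep_ell2 (ket h) k)"
    using assms by (simp add: is_regular_rep_def)
  also have "\<dots> = (\<Sum>\<^sub>\<infinity>k\<in>(if s h = s g then {h} else {}). f (g \<cdot> iv k))"
    by (rule infsum_cong_neutral) (auto split: if_splits)
  finally show ?thesis by simp
qed

text \<open>The defining sum over a source fibre is the expansion of a coordinate of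
  \<open>T \<xi>\<close> in matrix entries, so algebraic identities between representations need
  checking only on entries.\<close>

lemma regular_repI:
  assumes T: "complex_linear T"
    and ket: "\<And>g h. Rep_ell2 (T (ket h)) g = (if s h = s g then f (g \<cdot> iv h) else 0)"
  shows "is_regular_rep G f T"
  unfolding is_regular_rep_def
proof (intro allI)
  fix \<xi> g
  have "Rep_ell2 (T \<xi>) g = (\<Sum>\<^sub>\<infinity>h. Rep_ell2 (T (ket h)) g * Rep_ell2 \<xi> h)"
    by (rule Rep_oper[OF T])
  also have "\<dots> = (\<Sum>\<^sub>\<infinity>h | s h = s g. f (g \<cdot> iv h) * Rep_ell2 \<xi> h)"
    unfolding ket by (rule infsum_cong_neutral) auto
  finally show "Rep_ell2 (T \<xi>) g = (\<Sum>\<^sub>\<infinity>h | s h = s g. f (g \<cdot> iv h) * Rep_ell2 \<xi> h)" .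
qed

lemma regular_rep_unique: "is_regular_rep G f S \<Longrightarrow> is_regular_rep G f T \<Longrightarrow> S = T"
  by (rule oper_ext) (simp_all add: regular_rep_linear regular_rep_ket)

text \<open>Evaluating at the basis vector of a unit recovers the function from the
  operator.\<close>

lemma regular_rep_coeff: "is_regular_rep G f T \<Longrightarrow> Rep_ell2 (T (ket (s k))) k = f k"
  by (simp add: regular_rep_ket)

abbreviation Cr where "Cr \<equiv> reduced_cstar G"
abbreviation D where "D \<equiv> unit_functions G"

lemma Cr_sequence:
  assumes "T \<in> Cr"
  obtains Y f where "Y \<longlonglongrightarrow> T" "\<And>n::nat. f n \<in> Cc G" "\<And>n. is_regular_rep G (f n) (Y n)"
  using assms unfolding reduced_cstar_def closure_sequential mem_Collect_eq Bex_def by metis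

lemma Cr_limit:
  assumes "Y \<longlonglongrightarrow> T" "\<And>n::nat. f n \<in> Cc G" "\<And>n. is_regular_rep G (f n) (Y n)"
  shows "T \<in> Cr"
  using assms unfolding reduced_cstar_def closure_sequential by blast

lemma Cr_rep: "f \<in> Cc G \<Longrightarrow> is_regular_rep G f T \<Longrightarrow> T \<in> Cr"
  unfolding reduced_cstar_def by (rule subsetD[OF closure_subset]) blast

text \<open>Coefficients are bounded by the operator norm, so norm convergence of operators forces
  uniform convergence of their functions. The limit function is continuous, which later permits
  arguments about its open support; compactness of the support is not preserved.\<close>

lemma Cr_symbol:
  assumes "T \<in> Cr"
  obtains f where "continuous_on UNIV f" "is_regular_rep G f T"
proof -
  obtain Y f where Y: "Y \<longlonglongrightarrow> T" and f: "\<And>n::nat. f n \<in> Cc G" and rep: "\<And>n. is_regular_rep G (f n) (Y n)"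
    using Cr_sequence[OF assms] by blast
  define j where "j k = Rep_ell2 (T (ket (s k))) k" for k
  have T: "complex_linear T"
    using tendsto_complex_linear[OF Y] regular_rep_linear[OF rep] by blast
  have "uniform_limit UNIV f j sequentially"
    unfolding uniform_limit_sequentially_iff
  proof (intro allI impI)
    fix e :: real assume "e > 0"
    then obtain N where N: "\<And>n. n \<ge> N \<Longrightarrow> norm (Y n - T) < e"
      using LIMSEQ_D[OF Y] by blast
    have "dist (f n k) (j k) < e" if "n \<ge> N" for n k
    proof -
      have "f n k - j k = Rep_ell2 ((Y n - T) (ket (s k))) k"
        by (simp add: j_def blinfun.diff_left regular_rep_coeff[OF rep])
      also have "cmod \<dots> \<le> norm ((Y n - T) (ket (s k)))"
        by (rule cmod_le_norm_ell2)
      also have "\<dots> \<le> norm (Y n - T) * norm (ket (s k))"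
        by (rule norm_blinfun)
      also have "\<dots> < e" using N[OF that] by simp
      finally show ?thesis by (simp add: dist_norm)
    qed
    then show "\<exists>N. \<forall>n\<ge>N. \<forall>k\<in>UNIV. dist (f n k) (j k) < e" by blast
  qed
  then have cont: "continuous_on UNIV j"
    by (rule uniform_limit_theorem[rotated]) (use CcD(1)[OF f] in auto)
  have "is_regular_rep G j T"
  proof (rule regular_repI[OF T])
    fix g h
    have 1: "(\<lambda>n. Rep_ell2 (Y n (ket h)) g) \<longlonglongrightarrow> Rep_ell2 (T (ket h)) g" for g h
      by (intro bounded_linear.tendsto[OF bounded_linear_Rep_ell2]
          bounded_linear.tendsto[OF blinfun.bounded_linear_left] Y)
    show "Rep_ell2 (T (ket h)) g = (if s h = s g then j (g \<cdot> iv h) else 0)"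
    proof (cases "s h = s g")
      case True
      \<comment> \<open>For each approximant the entry at \<open>(g, h)\<close> equals the
        coefficient at the quotient of \<open>g\<close> by \<open>h\<close>, and this equality
        passes to the limit.\<close>
      have "(\<lambda>n. Rep_ell2 (Y n (ket h)) g) = (\<lambda>n. Rep_ell2 (Y n (ket (s (g \<cdot> iv h)))) (g \<cdot> iv h))"
        unfolding regular_rep_coeff[OF rep] using True by (simp add: regular_rep_ket[OF rep])
      then show ?thesis
        using LIMSEQ_unique[OF 1[of h g]] 1[of "s (g \<cdot> iv h)" "g \<cdot> iv h"] True by (simp add: j_def)
    next
      case False
      then have "(\<lambda>n. Rep_ell2 (Y n (ket h)) g) = (\<lambda>n. 0)"
        by (simp add: regular_rep_ket[OF rep])
      then show ?thesis
        using LIMSEQ_unique[OF 1[of h g], of 0] False by simp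
    qed
  qed
  then show ?thesis using cont that by blast
qed

lemma Cr_linear: "T \<in> Cr \<Longrightarrow> complex_linear T"
  by (metis Cr_symbol regular_rep_linear)

lemma Cc_add:
  assumes "f \<in> Cc G" "f' \<in> Cc G"
  shows "(\<lambda>g. f g + f' g) \<in> Cc G"
proof (rule CcI)
  show "compact (closure {g. f g \<noteq> 0} \<union> closure {g. f' g \<noteq> 0})"
    using assms by (intro compact_Un CcD(2))
  show "{g. f g + f' g \<noteq> 0} \<subseteq> closure {g. f g \<noteq> 0} \<union> closure {g. f' g \<noteq> 0}"
    using closure_subset[of "{g. f g \<noteq> 0}"] closure_subset[of "{g. f' g \<noteq> 0}"] by fastforce
qed (intro continuous_on_add CcD(1) assms)

lemma Cc_scale:
  assumes "f \<in> Cc G"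
  shows "(\<lambda>g. c * f g) \<in> Cc G"
proof (rule CcI)
  show "{g. c * f g \<noteq> 0} \<subseteq> closure {g. f g \<noteq> 0}"
    using closure_subset[of "{g. f g \<noteq> 0}"] by fastforce
qed (intro continuous_on_mult continuous_on_const CcD assms)+

lemma Cc_star:
  assumes "f \<in> Cc G"
  shows "(\<lambda>g. cnj (f (iv g))) \<in> Cc G"
proof (rule CcI)
  show "continuous_on UNIV (\<lambda>g. cnj (f (iv g)))"
    by (intro continuous_on_cnj continuous_on_compose2[OF CcD(1)[OF assms]] continuous_inv) auto
  show "compact (iv ` closure {g. f g \<noteq> 0})"
    by (intro compact_continuous_image CcD(2)[OF assms] continuous_on_subset[OF continuous_inv]) auto
  show "{g. cnj (f (iv g)) \<noteq> 0} \<subseteq> iv ` closure {g. f g \<noteq> 0}"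
  proof
    fix g assume "g \<in> {g. cnj (f (iv g)) \<noteq> 0}"
    then have "iv g \<in> closure {g. f g \<noteq> 0}"
      using closure_subset[of "{g. f g \<noteq> 0}"] by auto
    then show "g \<in> iv ` closure {g. f g \<noteq> 0}"
      by (metis image_eqI inv_inv_g)
  qed
qed

section \<open>Convolution of compactly supported functions\<close>

definition conv :: "('g \<Rightarrow> complex) \<Rightarrow> ('g \<Rightarrow> complex) \<Rightarrow> 'g \<Rightarrow> complex" where
  "conv f f' g = (\<Sum>\<^sub>\<infinity>k | s k = s g. f (g \<cdot> iv k) * f' k)"

lemma finite_fibre:
  assumes "finite \<W>" "\<And>W. W \<in> \<W> \<Longrightarrow> compact_open_bisection G W"
  shows "finite {k \<in> \<Union>\<W>. s k = x}"
proof -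
  have "finite {k \<in> W. s k = x}" if "W \<in> \<W>" for W
  proof -
    have "{k \<in> W. s k = x} \<subseteq> {the_inv_into W s x}"
      using bisectionD(4)[OF assms(2)[OF that]] by (auto simp: the_inv_into_f_f)
    then show ?thesis by (rule finite_subset) simp
  qed
  moreover have "{k \<in> \<Union>\<W>. s k = x} = (\<Union>W\<in>\<W>. {k \<in> W. s k = x})" by auto
  ultimately show ?thesis using assms(1) by simp
qed

text \<open>A bisection meets each source fibre at most once, so the fibre sum reduces to its value
  at \<open>\<sigma> (s g)\<close>. It is nonzero only over the clopen set \<open>P\<close>, where
  that section is continuous.\<close>

lemma continuous_conv_bisection:
  assumes f: "continuous_on UNIV f" and f': "continuous_on UNIV f'"
    and W: "compact_open_bisection G W"
  shows "continuous_on UNIV (conv f (\<lambda>k. if k \<in> W then f' k else 0))"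
proof -
  obtain \<sigma> \<rho> where hom: "homeomorphism W (s ` W) s \<sigma>"
    using bisection_sections[OF W] by blast
  note \<sigma> = homeomorphism_inverse[OF hom]
  define P where "P = s -` (s ` W)"
  have P: "open P" "closed P"
    unfolding P_def using bisectionD(5)[OF W] clopD(2,4) cont_src[of UNIV]
    by (auto intro: open_vimage closed_vimage)
  have "conv f (\<lambda>k. if k \<in> W then f' k else 0) g
      = (if g \<in> P then f (g \<cdot> iv (\<sigma> (s g))) * f' (\<sigma> (s g)) else 0)" for g
  proof -
    have "conv f (\<lambda>k. if k \<in> W then f' k else 0) g
        = (\<Sum>\<^sub>\<infinity>k\<in>(if g \<in> P then {\<sigma> (s g)} else {}). f (g \<cdot> iv k) * f' k)"
      unfolding conv_def
    proof (rule infsum_cong_neutral)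
      fix k assume k: "k \<in> {k. s k = s g} - (if g \<in> P then {\<sigma> (s g)} else {})"
      have "k \<notin> W"
      proof
        assume "k \<in> W"
        then have "s k \<in> s ` W" "\<sigma> (s k) = k" using \<sigma>(1) by (auto intro: imageI)
        moreover have "s k = s g" using k by simp
        ultimately have "s g \<in> s ` W" "\<sigma> (s g) = k" by simp_all
        then show False using k by (simp add: P_def)
      qed
      then show "f (g \<cdot> iv k) * (if k \<in> W then f' k else 0) = 0" by simp
    qed (use \<sigma>(2,3)[of "s g"] in \<open>auto simp: P_def split: if_splits\<close>)
    then show ?thesis by simp
  qed
  moreover have "continuous_on P (\<lambda>g. f (g \<cdot> iv (\<sigma> (s g))) * f' (\<sigma> (s g)))"
  proof -
    have 1: "continuous_on P (\<lambda>g. \<sigma> (s g))"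
      by (rule continuous_on_compose2[OF \<sigma>(4) cont_src]) (auto simp: P_def)
    have 2: "s (\<sigma> (s g)) = s g" if "g \<in> P" for g
      using that \<sigma>(2) by (simp add: P_def)
    have "continuous_on P (\<lambda>g. g \<cdot> iv (\<sigma> (s g)))"
      using 1 2 by (intro cont_mult cont_inv continuous_on_id) simp_all
    then show ?thesis
      using 1 by (intro continuous_on_mult continuous_on_compose2[OF f] continuous_on_compose2[OF f']) auto
  qed
  ultimately show ?thesis
    using continuous_extend_zero[OF P] by simp
qed

lemma conv_add:
  assumes "finite {k. s k = s g \<and> f' k \<noteq> 0}" "finite {k. s k = s g \<and> f'' k \<noteq> 0}"
  shows "conv f (\<lambda>k. f' k + f'' k) g = conv f f' g + conv f f'' g"
proof -
  have *: "(\<lambda>k. f (g \<cdot> iv k) * q k) summable_on {k. s k = s g}"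
    if "finite {k. s k = s g \<and> q k \<noteq> 0}" for q
  proof (rule finite_nonzero_values_imp_summable_on)
    have "{k \<in> {k. s k = s g}. f (g \<cdot> iv k) * q k \<noteq> 0} \<subseteq> {k. s k = s g \<and> q k \<noteq> 0}" by auto
    then show "finite {k \<in> {k. s k = s g}. f (g \<cdot> iv k) * q k \<noteq> 0}"
      using that finite_subset by blast
  qed
  show ?thesis
    unfolding conv_def distrib_left by (rule infsum_add[OF *[OF assms(1)] *[OF assms(2)]])
qed

text \<open>
  Splitting the second factor along finitely many bisections reduces continuity of the convolution
  to the case where every fibre sum has at most one term.
\<close>

lemma continuous_conv:
  assumes f: "continuous_on UNIV f" and fin: "finite \<W>"
    and W: "\<And>W. W \<in> \<W> \<Longrightarrow> compact_open_bisection G W"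
    and f': "continuous_on UNIV f'" "{k. f' k \<noteq> 0} \<subseteq> \<Union>\<W>"
  shows "continuous_on UNIV (conv f f')"
  using fin W f'
proof (induction \<W> arbitrary: f' rule: finite_induct)
  case empty
  then have "f' k = 0" for k by auto
  then have "conv f f' = (\<lambda>g. 0)" by (simp add: conv_def fun_eq_iff)
  then show ?case by simp
next
  case (insert W \<W>)
  define f1 where "f1 k = (if k \<in> W then f' k else 0)" for k
  define f2 where "f2 k = (if k \<in> - W then f' k else 0)" for k
  have bW: "compact_open_bisection G W" using insert.prems by simp
  have "closed W" "open W" using bisectionD[OF bW] by (auto simp: compact_imp_closed)
  then have cont2: "continuous_on UNIV f2"
    unfolding f2_def using insert.prems(2)
    by (intro continuous_extend_zero) (auto intro: continuous_on_subset)
  have supp2: "{k. f2 k \<noteq> 0} \<subseteq> \<Union>\<W>"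
    using insert.prems(3) by (auto simp: f2_def)
  have "continuous_on UNIV (conv f f2)"
    using insert.IH[OF _ cont2 supp2] insert.prems(1) by simp
  moreover have "continuous_on UNIV (conv f f1)"
    unfolding f1_def by (rule continuous_conv_bisection[OF f insert.prems(2) bW])
  moreover have "conv f f' = (\<lambda>g. conv f f1 g + conv f f2 g)"
  proof
    fix g
    have fin: "finite {k. s k = s g \<and> f' k \<noteq> 0}"
      by (rule finite_subset[OF _ finite_fibre[of "insert W \<W>" "s g"]]) (use insert in auto)
    have "f' = (\<lambda>k. f1 k + f2 k)" by (auto simp: f1_def f2_def)
    then have "conv f f' g = conv f (\<lambda>k. f1 k + f2 k) g"
      by (rule arg_cong[where f = "\<lambda>q. conv f q g"])
    moreover have "finite {k. s k = s g \<and> f1 k \<noteq> 0}" "finite {k. s k = s g \<and> f2 k \<noteq> 0}"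
      by (auto intro!: finite_subset[OF _ fin] simp: f1_def f2_def)
    ultimately show "conv f f' g = conv f f1 g + conv f f2 g"
      by (simp add: conv_add)
  qed
  ultimately show ?case by (simp add: continuous_on_add)
qed

lemma Cc_conv:
  assumes f: "f \<in> Cc G" and f': "f' \<in> Cc G"
  shows "conv f f' \<in> Cc G"
proof (rule CcI)
  define K where "K = closure {g. f g \<noteq> 0}"
  define L where "L = closure {g. f' g \<noteq> 0}"
  have K: "compact K" "f g \<noteq> 0 \<Longrightarrow> g \<in> K" for g
    using CcD(2)[OF f] closure_subset[of "{g. f g \<noteq> 0}"] by (auto simp: K_def)
  have L: "compact L" "f' g \<noteq> 0 \<Longrightarrow> g \<in> L" for g
    using CcD(2)[OF f'] closure_subset[of "{g. f' g \<noteq> 0}"] by (auto simp: L_def)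
  have "L \<subseteq> \<Union>{W. compact_open_bisection G W}"
    using bisection_base[OF open_UNIV] by blast
  then obtain \<W> where "\<W> \<subseteq> {W. compact_open_bisection G W}" "finite \<W>" "L \<subseteq> \<Union>\<W>"
    using compactE[OF L(1)] bisectionD(2) by (metis mem_Collect_eq)
  then show "continuous_on UNIV (conv f f')"
    using L(2) by (intro continuous_conv[OF CcD(1)[OF f] _ _ CcD(1)[OF f'], of \<W>]) auto
  \<comment> \<open>The support of the convolution lies in the product of the two supports.
    Composability is a closed condition, so the composable pairs form a compact set with compact
    image under multiplication.\<close>
  define M where "M = (K \<times> L) \<inter> {(g, h). s g = r h}"
  have "closed {p :: 'g \<times> 'g. s (fst p) = r (snd p)}"
    by (intro closed_Collect_eq continuous_on_compose2[OF cont_src[of UNIV]]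
        continuous_on_compose2[OF cont_rng[of UNIV]] continuous_on_fst continuous_on_snd continuous_on_id) auto
  then have "compact M"
    unfolding M_def by (intro compact_Int_closed compact_Times K(1) L(1)) (simp add: case_prod_unfold)
  then show "compact ((\<lambda>(g, h). g \<cdot> h) ` M)"
    by (rule compact_continuous_image[rotated]) (auto simp: M_def intro: continuous_on_subset[OF continuous_mult])
  show "{g. conv f f' g \<noteq> 0} \<subseteq> (\<lambda>(g, h). g \<cdot> h) ` M"
  proof
    fix g assume "g \<in> {g. conv f f' g \<noteq> 0}"
    then have "conv f f' g \<noteq> 0" by simp
    then obtain k where k: "s k = s g" "f (g \<cdot> iv k) * f' k \<noteq> 0"
      unfolding conv_def by (metis (mono_tags, lifting) infsum_0 mem_Collect_eq)
    then have "(g \<cdot> iv k, k) \<in> M" using K(2) L(2) by (auto simp: M_def)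
    moreover have "g = (g \<cdot> iv k) \<cdot> k" using k(1) by simp
    ultimately show "g \<in> (\<lambda>(g, h). g \<cdot> h) ` M" by (metis (mono_tags, lifting) case_prod_conv image_eqI)
  qed
qed

lemma regular_rep_comp:
  assumes S: "is_regular_rep G f S" and T: "is_regular_rep G f' T"
  shows "is_regular_rep G (conv f f') (S o\<^sub>L T)"
proof (rule regular_repI)
  show "complex_linear (S o\<^sub>L T)"
    by (rule complex_linear_intros(6)[OF regular_rep_linear[OF S] regular_rep_linear[OF T]])
  fix g h
  have "Rep_ell2 ((S o\<^sub>L T) (ket h)) g = (\<Sum>\<^sub>\<infinity>k | s k = s g. f (g \<cdot> iv k) * Rep_ell2 (T (ket h)) k)"
    using S by (simp add: is_regular_rep_def)
  also have "\<dots> = (\<Sum>\<^sub>\<infinity>k | s k = s g. f (g \<cdot> iv k) * (if s h = s g then f' (k \<cdot> iv h) else 0))"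
    by (rule infsum_cong) (simp add: regular_rep_ket[OF T])
  also have "\<dots> = (if s h = s g then conv f f' (g \<cdot> iv h) else 0)"
  proof (cases "s h = s g")
    case True
    \<comment> \<open>Right translation by the inverse of \<open>h\<close> carries the fibre of sums
      for the operator product to the fibre of sums for the convolution.\<close>
    have bij: "bij_betw (\<lambda>k. k \<cdot> iv h) {k. s k = s g} {k. s k = s (g \<cdot> iv h)}"
    proof (rule bij_betwI[where g = "\<lambda>k. k \<cdot> h"])
      show "(x \<cdot> h) \<cdot> iv h = x" if "x \<in> {k. s k = s (g \<cdot> iv h)}" for x
        using that True by simp
    qed (use True in auto)
    have "conv f f' (g \<cdot> iv h)
        = (\<Sum>\<^sub>\<infinity>k | s k = s g. f ((g \<cdot> iv h) \<cdot> iv (k \<cdot> iv h)) * f' (k \<cdot> iv h))"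
      unfolding conv_def by (rule infsum_reindex_bij_betw[OF bij, symmetric])
    also have "\<dots> = (\<Sum>\<^sub>\<infinity>k | s k = s g. f (g \<cdot> iv k) * f' (k \<cdot> iv h))"
      using True by (intro infsum_cong) (simp add: quotient_quotient)
    finally show ?thesis using True by simp
  qed simp
  finally show "Rep_ell2 ((S o\<^sub>L T) (ket h)) g = (if s h = s g then conv f f' (g \<cdot> iv h) else 0)" .
qed

lemma regular_rep_add:
  assumes S: "is_regular_rep G f S" and T: "is_regular_rep G f' T"
  shows "is_regular_rep G (\<lambda>g. f g + f' g) (S + T)"
proof (rule regular_repI)
  show "complex_linear (S + T)"
    by (rule complex_linear_intros(4)[OF regular_rep_linear[OF S] regular_rep_linear[OF T]])
qed (simp add: blinfun.add_left regular_rep_ket[OF S] regular_rep_ket[OF T])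

lemma regular_rep_scalar:
  assumes T: "is_regular_rep G f T"
  shows "is_regular_rep G (\<lambda>g. c * f g) (scalar_op c o\<^sub>L T)"
proof (rule regular_repI)
  show "complex_linear (scalar_op c o\<^sub>L T)"
    by (rule complex_linear_intros(6)[OF complex_linear_intros(3) regular_rep_linear[OF T]])
qed (simp add: scalar_op.rep_eq regular_rep_ket[OF T])

lemma regular_rep_adj:
  assumes T: "is_regular_rep G f T"
  shows "is_regular_rep G (\<lambda>g. cnj (f (iv g))) (adj T)"
proof (rule regular_repI)
  show "complex_linear (adj T)"
    by (rule complex_linear_adj[OF regular_rep_linear[OF T]])
qed (auto simp: Rep_adj[OF regular_rep_linear[OF T]] regular_rep_ket[OF T] inv_prod)

lemma Cr_cstar: "cstar_algebra Cr"
  unfolding cstar_algebra_def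
proof (intro conjI ballI allI)
  show "closed Cr" by (simp add: reduced_cstar_def)
  have "is_regular_rep G (\<lambda>_. 0) 0" by (rule regular_repI) (simp_all add: complex_linear_intros)
  moreover have "(\<lambda>_. 0) \<in> Cc G" by (simp add: Cc_def)
  ultimately show "0 \<in> Cr" by (rule Cr_rep[rotated])
  fix T assume T: "T \<in> Cr"
  show "complex_linear T" using T by (rule Cr_linear)
  obtain Y f where Y: "Y \<longlonglongrightarrow> T" and f: "\<And>n::nat. f n \<in> Cc G" and rep: "\<And>n. is_regular_rep G (f n) (Y n)"
    using Cr_sequence[OF T] by blast
  show "adj T \<in> Cr"
    using tendsto_adj[OF Y regular_rep_linear[OF rep]] Cc_star[OF f] regular_rep_adj[OF rep]
    by (rule Cr_limit)
  have "(\<lambda>n. scalar_op c o\<^sub>L Y n) \<longlonglongrightarrow> (scalar_op c o\<^sub>L T)" for c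
    by (intro tendsto_compose_oper Y tendsto_const)
  then show "scalar_op c o\<^sub>L T \<in> Cr" for c
    using Cc_scale[OF f] regular_rep_scalar[OF rep] by (rule Cr_limit)
  fix T' assume T': "T' \<in> Cr"
  obtain Y' f' where Y': "Y' \<longlonglongrightarrow> T'" and f': "\<And>n::nat. f' n \<in> Cc G"
    and rep': "\<And>n. is_regular_rep G (f' n) (Y' n)"
    using Cr_sequence[OF T'] by blast
  show "T + T' \<in> Cr"
    using tendsto_add[OF Y Y'] Cc_add[OF f f'] regular_rep_add[OF rep rep'] by (rule Cr_limit)
  show "T o\<^sub>L T' \<in> Cr"
    using tendsto_compose_oper[OF Y Y'] Cc_conv[OF f f'] regular_rep_comp[OF rep rep'] by (rule Cr_limit)
qed

subsection \<open>The diagonal\<close>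

text \<open>
  Multiplication by \<open>\<phi> \<circ> r\<close>; meaningful only for \<open>\<phi>\<close> continuous, hence bounded, on the unit space.
\<close>

definition dop :: "('g \<Rightarrow> complex) \<Rightarrow> 'g oper" where
  "dop \<phi> = (SOME T. complex_linear T \<and> (\<forall>\<xi> g. Rep_ell2 (T \<xi>) g = \<phi> (r g) * Rep_ell2 \<xi> g))"

lemma dop:
  assumes "continuous_on X \<phi>"
  shows "complex_linear (dop \<phi>)" "Rep_ell2 (dop \<phi> \<xi>) g = \<phi> (r g) * Rep_ell2 \<xi> g"
proof -
  have "compact (\<phi> ` X)" using assms compact_units by (rule compact_continuous_image)
  then obtain B where B: "\<And>x. x \<in> X \<Longrightarrow> cmod (\<phi> x) \<le> B"
    using compact_imp_bounded bounded_iff by (metis imageI)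
  have "\<exists>T :: 'g oper. complex_linear T \<and> (\<forall>\<xi> g. Rep_ell2 (T \<xi>) g = \<phi> (r g) * Rep_ell2 \<xi> g)"
    using weighted_composition_op[of "\<lambda>g. \<phi> (r g)" B "\<lambda>g. g"] B by simp
  from someI_ex[OF this] show "complex_linear (dop \<phi>)" "Rep_ell2 (dop \<phi> \<xi>) g = \<phi> (r g) * Rep_ell2 \<xi> g"
    unfolding dop_def by blast+
qed

lemma dop_eqI:
  assumes "continuous_on X \<phi>" "\<And>\<xi> g. Rep_ell2 (blinfun_apply T \<xi>) g = \<phi> (r g) * Rep_ell2 \<xi> g"
  shows "T = dop \<phi>"
  by (rule oper_eqI) (simp add: assms dop)

lemma dop_cong:
  assumes "continuous_on X \<phi>" "\<And>x. x \<in> X \<Longrightarrow> \<phi> x = \<psi> x"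
  shows "dop \<phi> = dop \<psi>"
proof (rule dop_eqI)
  show "continuous_on X \<psi>" using assms continuous_on_cong by blast
qed (use assms in \<open>simp add: dop\<close>)

lemma dop_comp:
  assumes "continuous_on X \<phi>" "continuous_on X \<psi>"
  shows "dop \<phi> o\<^sub>L dop \<psi> = dop (\<lambda>x. \<phi> x * \<psi> x)"
  by (rule dop_eqI) (auto intro!: continuous_on_mult assms simp: dop assms)

lemma dop_add:
  assumes "continuous_on X \<phi>" "continuous_on X \<psi>"
  shows "dop \<phi> + dop \<psi> = dop (\<lambda>x. \<phi> x + \<psi> x)"
  by (rule dop_eqI) (auto intro!: continuous_on_add assms simp: dop assms blinfun.add_left distrib_right)

lemma dop_adj:
  assumes "continuous_on X \<phi>"
  shows "adj (dop \<phi>) = dop (\<lambda>x. cnj (\<phi> x))"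
proof (rule adj_eqI)
  have "continuous_on X (\<lambda>x. cnj (\<phi> x))" using assms by (rule continuous_on_cnj)
  then show "cinner_ell2 (dop (\<lambda>x. cnj (\<phi> x)) \<xi>) \<eta> = cinner_ell2 \<xi> (dop \<phi> \<eta>)" for \<xi> \<eta>
    unfolding cinner_ell2_def by (simp add: dop assms mult_ac)
qed

lemma dop_one: "dop (\<lambda>_. 1) = id_blinfun"
  by (rule dop_eqI[symmetric]) auto

lemma dop_zero: "dop (\<lambda>_. 0) = 0"
  by (rule dop_eqI[symmetric]) auto

text \<open>For arrows with a common source, the quotient of \<open>g\<close> by \<open>h\<close> is
  a unit only if they are equal, and then it is \<open>r g\<close>. The matrix is thus
  diagonal.\<close>

lemma dop_regular_rep:
  assumes "continuous_on X \<phi>"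
  shows "is_regular_rep G (\<lambda>g. if g \<in> X then \<phi> g else 0) (dop \<phi>)"
proof (rule regular_repI)
  show "complex_linear (dop \<phi>)" using assms by (rule dop)
  show "Rep_ell2 (dop \<phi> (ket h)) g = (if s h = s g then if g \<cdot> iv h \<in> X then \<phi> (g \<cdot> iv h) else 0 else 0)" for g h
    using quotient_unit_iff[of g h] by (auto simp: dop assms)
qed

lemma D_iff: "T \<in> D \<longleftrightarrow> (\<exists>\<phi>. continuous_on X \<phi> \<and> T = dop \<phi>)"
  unfolding unit_functions_def using dop_regular_rep regular_rep_unique by blast

lemma dop_mem: "continuous_on X \<phi> \<Longrightarrow> dop \<phi> \<in> D"
  using D_iff by blast

lemma DE:
  assumes "d \<in> D" obtains \<phi> where "continuous_on X \<phi>" "d = dop \<phi>"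
  using assms D_iff by blast

lemma D_sub_Cr: "D \<subseteq> Cr"
proof
  fix T assume "T \<in> D"
  then obtain \<phi> where \<phi>: "continuous_on X \<phi>" "T = dop \<phi>" by (rule DE)
  have "(\<lambda>g. if g \<in> X then \<phi> g else 0) \<in> Cc G"
    by (rule CcI[OF continuous_extend_zero[OF open_units closed_units \<phi>(1)] compact_units]) auto
  then show "T \<in> Cr" using dop_regular_rep[OF \<phi>(1)] unfolding \<phi>(2) by (rule Cr_rep)
qed

definition ind :: "'g set \<Rightarrow> 'g \<Rightarrow> complex" where
  "ind Z x = (if x \<in> Z then 1 else 0)"

lemma continuous_ind: "clop Z \<Longrightarrow> continuous_on S (ind Z)"
proof -
  assume "clop Z"
  then have "continuous_on UNIV (\<lambda>x. if x \<in> Z then 1 else 0 :: complex)"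
    using clopD by (intro continuous_extend_zero) auto
  then show ?thesis
    unfolding ind_def by (rule continuous_on_subset) simp
qed

text \<open>Commuting with indicators that separate \<open>s g\<close> from \<open>r g\<close>
  confines the support of \<open>f\<close> to isotropy. Its part outside the units is open, so its
  sources would be an open set; density then gives a point with trivial isotropy there, leaving no
  arrow outside \<open>X\<close> for it to come from.\<close>

lemma D_commutant_Cr:
  assumes tp: "topologically_principal G" and T: "T \<in> Cr"
    and comm: "\<And>d. d \<in> D \<Longrightarrow> T o\<^sub>L d = d o\<^sub>L T"
  shows "T \<in> D"
proof -
  obtain f where f: "continuous_on UNIV f" "is_regular_rep G f T"
    using Cr_symbol[OF T] by blast
  define O' where "O' = {g. f g \<noteq> 0} - X"
  have iso: "s g = r g" if fg: "f g \<noteq> 0" for g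
  proof (rule ccontr)
    assume ne: "s g \<noteq> r g"
    obtain Z where Z: "clop Z" "s g \<in> Z" "Z \<subseteq> - {r g}"
      using clop_base[of "- {r g}" "s g"] ne by (auto simp: open_Compl)
    note ci = continuous_ind[OF Z(1)]
    have "Rep_ell2 ((T o\<^sub>L dop (ind Z)) (ket (s g))) g = Rep_ell2 ((dop (ind Z) o\<^sub>L T) (ket (s g))) g"
      by (simp add: comm[OF dop_mem[OF ci]])
    moreover have "dop (ind Z) (ket (s g)) = ket (s g)"
      using Z(2) by (intro ell2_eqI) (auto simp: dop[OF ci] ind_def)
    ultimately have "f g = 0"
      using Z(3) by (auto simp: dop[OF ci] ind_def regular_rep_coeff[OF f(2)])
    then show False using fg by simp
  qed
  have "O' = {}"
  proof (rule ccontr)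
    assume "O' \<noteq> {}"
    then obtain g where g: "g \<in> O'" by blast
    have "open O'"
      unfolding O'_def using f(1) closed_units
      by (intro open_Diff open_Collect_neq) auto
    then have "open (s ` O')" by (rule open_map_src)
    moreover have "s g \<in> closure {x \<in> X. {g. r g = x \<and> s g = x} = {x}}"
      using tp unfolding topologically_principal_def by (meson src_units subsetD)
    ultimately obtain x where x: "x \<in> s ` O'" "{g. r g = x \<and> s g = x} = {x}" "x \<in> X"
      using g unfolding closure_iff_nhds_not_empty by blast
    then obtain h where h: "h \<in> O'" "x = s h" by blast
    then have "r h = x" using iso[of h] by (simp add: O'_def)
    moreover have "s h = x" using h(2) by (rule sym)
    ultimately have "h \<in> {g. r g = x \<and> s g = x}" by blast
    then have "h = x" unfolding x(2) by (rule singletonD)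
    then show False using h(1) x(3) by (simp add: O'_def)
  qed
  then have "f g = (if g \<in> X then f g else 0)" for g
    by (auto simp: O'_def)
  then have eq: "f = (\<lambda>g. if g \<in> X then f g else 0)" by (rule ext)
  have "is_regular_rep G (\<lambda>g. if g \<in> X then f g else 0) T"
    by (rule subst[where P = "\<lambda>q. is_regular_rep G q T", OF eq f(2)])
  then show ?thesis
    unfolding unit_functions_def using continuous_on_subset[OF f(1), of X] by blast
qed


subsection \<open>Projections and isometries\<close>

lemma Cr_ops:
  assumes "S \<in> Cr" "T \<in> Cr"
  shows "S + T \<in> Cr" "S o\<^sub>L T \<in> Cr" "adj T \<in> Cr"
  using Cr_cstar assms unfolding cstar_algebra_def by blast+

lemma diagonal_adj: "d \<in> D \<Longrightarrow> adj d \<in> D"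
  by (elim DE) (simp add: dop_adj dop_mem continuous_on_cnj)

lemma diagonal_comp: "d \<in> D \<Longrightarrow> d' \<in> D \<Longrightarrow> d o\<^sub>L d' \<in> D"
  by (elim DE) (simp add: dop_comp dop_mem continuous_on_mult)

lemma diagonal_add: "d \<in> D \<Longrightarrow> d' \<in> D \<Longrightarrow> d + d' \<in> D"
  by (elim DE) (simp add: dop_add dop_mem continuous_on_add)

lemma diagonal_commute: "d \<in> D \<Longrightarrow> d' \<in> D \<Longrightarrow> d o\<^sub>L d' = d' o\<^sub>L d"
  by (elim DE) (simp add: dop_comp mult.commute)

abbreviation proj :: "'g set \<Rightarrow> 'g oper" where "proj Z \<equiv> dop (ind Z)"

lemma proj_mem: "clop Z \<Longrightarrow> proj Z \<in> D"
  by (intro dop_mem continuous_ind)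

lemma proj_comp: "clop Y \<Longrightarrow> clop Z \<Longrightarrow> proj Y o\<^sub>L proj Z = proj (Y \<inter> Z)"
  unfolding dop_comp[OF continuous_ind continuous_ind]
  by (rule dop_cong) (auto simp: ind_def intro!: continuous_on_mult continuous_ind[unfolded ind_def])

lemma proj_adj: "clop Y \<Longrightarrow> adj (proj Y) = proj Y"
  unfolding dop_adj[OF continuous_ind]
  by (rule dop_cong) (auto simp: ind_def intro!: continuous_on_cnj continuous_ind[unfolded ind_def])

lemma proj_add: "clop Y \<Longrightarrow> clop Z \<Longrightarrow> Y \<inter> Z = {} \<Longrightarrow> proj Y + proj Z = proj (Y \<union> Z)"
  unfolding dop_add[OF continuous_ind continuous_ind]
  by (rule dop_cong) (auto simp: ind_def intro!: continuous_on_add continuous_ind[unfolded ind_def])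

lemma proj_units: "proj X = id_blinfun"
  unfolding dop_one[symmetric]
  by (rule dop_cong) (auto simp: ind_def intro: continuous_ind[OF clop_units, unfolded ind_def])

lemma proj_empty: "proj {} = 0"
  unfolding dop_zero[symmetric] by (rule dop_cong) (auto simp: ind_def)

text \<open>The operator is the one of the indicator function of \<open>W\<close>. It sends the
  basis vector of \<open>h\<close> to that of the product of the arrow of \<open>W\<close> starting
  at \<open>r h\<close> with \<open>h\<close>, and to 0 if there is none.\<close>

lemma bisection_op:
  assumes W: "compact_open_bisection G W"
  obtains t where "t \<in> Cr" "adj t o\<^sub>L t = proj (s ` W)" "\<And>d. d \<in> D \<Longrightarrow> t o\<^sub>L d o\<^sub>L adj t \<in> D"
    "\<And>Y. clop Y \<Longrightarrow> r ` W \<subseteq> Y \<Longrightarrow> proj Y o\<^sub>L t = t"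
proof -
  obtain \<sigma> \<rho> where "homeomorphism W (s ` W) s \<sigma>" "homeomorphism W (r ` W) r \<rho>"
    using bisection_sections[OF W] by blast
  note \<sigma> = homeomorphism_inverse[OF this(1)] and \<rho> = homeomorphism_inverse[OF this(2)]
  define m :: "'g \<Rightarrow> complex" where "m g = (if r g \<in> r ` W then 1 else 0)" for g
  \<comment> \<open>This undoes left translation by \<open>W\<close>; weighted composition needs the
    inverse because it acts on coordinates.\<close>
  define \<tau> where "\<tau> g = iv (\<rho> (r g)) \<cdot> g" for g
  have \<tau>: "s (\<tau> g) = s g" "r (\<tau> g) = s (\<rho> (r g))" "\<rho> (r g) \<cdot> \<tau> g = g" "\<rho> (r g) \<in> W" "r (\<rho> (r g)) = r g"
    if "r g \<in> r ` W" for g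
    using \<rho>(2,3)[OF that] by (simp_all add: \<tau>_def)
  \<comment> \<open>Both sides describe the same partial bijection between arrows, read backwards
    through the range section and forwards through the source section.\<close>
  have key: "r g \<in> r ` W \<and> \<tau> g = h \<longleftrightarrow> r h \<in> s ` W \<and> g = \<sigma> (r h) \<cdot> h" for g h
  proof
    assume *: "r g \<in> r ` W \<and> \<tau> g = h"
    have "r h = s (\<rho> (r g))" "\<rho> (r g) \<in> W" "\<rho> (r g) \<cdot> h = g" using \<tau>[of g] * by auto
    then show "r h \<in> s ` W \<and> g = \<sigma> (r h) \<cdot> h" using \<sigma>(1)[of "\<rho> (r g)"] by auto
  next
    assume *: "r h \<in> s ` W \<and> g = \<sigma> (r h) \<cdot> h"
    then have w: "\<sigma> (r h) \<in> W" "s (\<sigma> (r h)) = r h" using \<sigma>(2,3) by blast+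
    then have rg: "r g = r (\<sigma> (r h))" using * by simp
    then have "\<rho> (r g) = \<sigma> (r h)" using \<rho>(1)[OF w(1)] by simp
    then have "\<tau> g = h" using * w by (simp add: \<tau>_def)
    then show "r g \<in> r ` W \<and> \<tau> g = h" using rg w(1) by auto
  qed
  have key': "r h \<in> s ` W \<and> g = \<sigma> (r h) \<cdot> h \<longleftrightarrow> s h = s g \<and> g \<cdot> iv h \<in> W" for g h
  proof
    assume *: "r h \<in> s ` W \<and> g = \<sigma> (r h) \<cdot> h"
    then have w: "\<sigma> (r h) \<in> W" "s (\<sigma> (r h)) = r h" using \<sigma>(2,3) by blast+
    then show "s h = s g \<and> g \<cdot> iv h \<in> W" using * by simp
  next
    assume *: "s h = s g \<and> g \<cdot> iv h \<in> W"
    then have "s (g \<cdot> iv h) = r h" by simp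
    then have "r h \<in> s ` W" "\<sigma> (r h) = g \<cdot> iv h" using * \<sigma>(1)[of "g \<cdot> iv h"] by (auto intro: rev_image_eqI)
    then show "r h \<in> s ` W \<and> g = \<sigma> (r h) \<cdot> h" using * by simp
  qed
  have inj: "inj_on \<tau> {g. m g \<noteq> 0}"
  proof (rule inj_onI)
    fix g g' assume "g \<in> {g. m g \<noteq> 0}" "g' \<in> {g. m g \<noteq> 0}" "\<tau> g = \<tau> g'"
    then have "r g \<in> r ` W \<and> \<tau> g = \<tau> g'" "r g' \<in> r ` W \<and> \<tau> g' = \<tau> g'"
      by (auto simp: m_def split: if_splits)
    from this[THEN key[THEN iffD1], THEN conjunct2] show "g = g'"
      by (rule trans[OF _ sym])
  qed
  have m_le: "cmod (m g) \<le> 1" for g by (simp add: m_def)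
  obtain t where t: "complex_linear t" and app: "\<And>\<xi> g. Rep_ell2 (t \<xi>) g = m g * Rep_ell2 \<xi> (\<tau> g)"
    using weighted_composition_op[OF _ inj, of 1] m_le by blast
  have ket: "t (ket h) = (if r h \<in> s ` W then ket (\<sigma> (r h) \<cdot> h) else 0)" for h
  proof (rule ell2_eqI)
    fix g
    have "Rep_ell2 (t (ket h)) g = (if r g \<in> r ` W \<and> \<tau> g = h then 1 else 0)"
      by (simp add: app m_def)
    then show "Rep_ell2 (t (ket h)) g = Rep_ell2 (if r h \<in> s ` W then ket (\<sigma> (r h) \<cdot> h) else 0) g"
      unfolding key by simp
  qed
  have rep: "is_regular_rep G (\<lambda>g. if g \<in> W then 1 else 0) t"
  proof (rule regular_repI[OF t])
    fix g h
    have "Rep_ell2 (t (ket h)) g = (if r g \<in> r ` W \<and> \<tau> g = h then 1 else 0)"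
      by (simp add: app m_def)
    then show "Rep_ell2 (t (ket h)) g = (if s h = s g then if g \<cdot> iv h \<in> W then 1 else 0 else 0)"
      unfolding key key' by simp
  qed
  have "(\<lambda>g. if g \<in> W then 1 else 0) \<in> Cc G"
    using bisectionD(1,2)[OF W]
    by (intro CcI[OF continuous_extend_zero]) (auto simp: compact_imp_closed)
  then have mem: "t \<in> Cr" using rep by (rule Cr_rep)
  have adj: "Rep_ell2 (adj t \<eta>) h = (if r h \<in> s ` W then Rep_ell2 \<eta> (\<sigma> (r h) \<cdot> h) else 0)" for \<eta> h
    using cinner_adj_right[OF t, of "ket h" \<eta>] by (simp add: ket)
  have 1: "adj t o\<^sub>L t = proj (s ` W)"
  proof (rule dop_eqI[OF continuous_ind[OF bisectionD(5)[OF W]]])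
    fix \<xi> h
    show "Rep_ell2 ((adj t o\<^sub>L t) \<xi>) h = ind (s ` W) (r h) * Rep_ell2 \<xi> h"
    proof (cases "r h \<in> s ` W")
      case True
      then have "r (\<sigma> (r h) \<cdot> h) \<in> r ` W \<and> \<tau> (\<sigma> (r h) \<cdot> h) = h" unfolding key by simp
      then show ?thesis using True by (simp add: adj app ind_def m_def)
    qed (simp add: adj ind_def)
  qed
  have 2: "t o\<^sub>L d o\<^sub>L adj t \<in> D" if d: "d \<in> D" for d
  proof -
    obtain \<phi> where \<phi>: "continuous_on X \<phi>" "d = dop \<phi>" using d by (rule DE)
    \<comment> \<open>Conjugation transports \<phi> along the partial homeomorphism from sources to
      ranges of \<open>W\<close>, with value 0 off the clopen range.\<close>
    define \<psi> where "\<psi> x = (if x \<in> r ` W then \<phi> (s (\<rho> x)) else 0)" for x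
    have "continuous_on UNIV \<psi>"
      unfolding \<psi>_def using bisectionD(6)[OF W] clopD(2,4)
      by (intro continuous_extend_zero continuous_on_compose2[OF \<phi>(1)]
          continuous_on_compose2[OF cont_src[of UNIV] \<rho>(4)]) auto
    then have \<psi>: "continuous_on X \<psi>" by (rule continuous_on_subset) simp
    have "t o\<^sub>L d o\<^sub>L adj t = dop \<psi>"
    proof (rule dop_eqI[OF \<psi>])
      fix \<xi> g
      show "Rep_ell2 ((t o\<^sub>L d o\<^sub>L adj t) \<xi>) g = \<psi> (r g) * Rep_ell2 \<xi> g"
      proof (cases "r g \<in> r ` W")
        case True
        then have "r (\<tau> g) \<in> s ` W \<and> g = \<sigma> (r (\<tau> g)) \<cdot> \<tau> g" unfolding key[symmetric] by simp
        then show ?thesis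
          using True \<tau>(2)[OF True] by (simp add: app adj \<phi>(2) dop[OF \<phi>(1)] m_def \<psi>_def)
      qed (simp add: app m_def \<psi>_def)
    qed
    then show ?thesis using dop_mem[OF \<psi>] by simp
  qed
  have 3: "proj Y o\<^sub>L t = t" if "clop Y" "r ` W \<subseteq> Y" for Y
    using that by (intro oper_eqI) (auto simp: dop[OF continuous_ind] app m_def ind_def)
  show ?thesis using that[OF mem 1 2 3] by blast
qed

text \<open>The part \<open>x\<close> of \<open>w\<close> that vanishes on the projection satisfies
  \<open>adj x o\<^sub>L x = (1 - P) P (1 - P) = 0\<close> with \<open>P = proj Z\<close>.\<close>

lemma isometry_support:
  assumes w: "complex_linear w" and Z: "clop Z" and ww: "adj w o\<^sub>L w = proj Z"
  shows "w o\<^sub>L proj Z = w"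
proof -
  define x where "x = w - (w o\<^sub>L proj Z)"
  have P: "complex_linear (proj Z)" using dop(1)[OF continuous_ind[OF Z]] .
  have x: "complex_linear x" unfolding x_def using w P by (intro complex_linear_intros(5,6))
  have ax: "adj x = adj w - (proj Z o\<^sub>L adj w)"
    unfolding x_def using w P by (simp add: adj_diff adj_compose proj_adj Z complex_linear_intros)
  have PP: "proj Z o\<^sub>L proj Z = proj Z" using Z by (simp add: proj_comp)
  have "adj x o\<^sub>L x = (adj w o\<^sub>L w) - ((adj w o\<^sub>L w) o\<^sub>L proj Z)
      - ((proj Z o\<^sub>L (adj w o\<^sub>L w)) - (proj Z o\<^sub>L (adj w o\<^sub>L w) o\<^sub>L proj Z))"
    unfolding ax unfolding x_def
    by (simp only: comp_diff_left comp_diff_right comp_assoc) (simp add: algebra_simps)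
  then have "adj x o\<^sub>L x = 0" by (simp add: ww PP)
  then have "x = 0" by (rule adj_compose_self_eq_0[OF x])
  then show ?thesis by (simp add: x_def)
qed

text \<open>\<open>1\<^sub>Z\<close> is subequivalent to \<open>1\<^sub>Y\<close> via a partial isometry normalizing the diagonal.\<close>

definition reach :: "'g set \<Rightarrow> 'g set \<Rightarrow> bool" where
  "reach Y Z \<longleftrightarrow> (\<exists>w\<in>Cr. adj w o\<^sub>L w = proj Z \<and> (\<forall>d\<in>D. w o\<^sub>L d o\<^sub>L adj w \<in> D) \<and> proj Y o\<^sub>L w = w)"

lemma reach_bisection: "compact_open_bisection G W \<Longrightarrow> clop Y \<Longrightarrow> r ` W \<subseteq> Y \<Longrightarrow> reach Y (s ` W)"
  unfolding reach_def by (metis bisection_op)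

lemma reach_empty: "reach Y {}"
proof -
  have "0 \<in> D" using proj_mem[OF clop_empty] by (simp add: proj_empty)
  then show ?thesis
    unfolding reach_def using D_sub_Cr by (intro bexI[of _ 0]) (auto simp: proj_empty)
qed

text \<open>Pure infiniteness yields \<open>a\<close> and \<open>b\<close> whose source projections
  are \<open>proj Y\<close> and whose ranges are orthogonal below it. They make room inside
  \<open>Y\<close> to put the partial isometries for \<open>Z1\<close> and \<open>Z2\<close> side by
  side.\<close>

lemma reach_Un:
  assumes pi: "purely_infinite G" and Y: "clop Y" and Z1: "clop Z1" and Z2: "clop Z2"
    and reach: "reach Y Z1" "reach Y Z2"
  shows "reach Y (Z1 \<union> Z2)"
proof -
  have "openin (top_of_set X) Y \<and> closedin (top_of_set X) Y"
    using clopD[OF Y] by (auto simp: openin_units closed_subset)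
  then obtain U V where U: "compact_open_bisection G U" "s ` U = Y" and V: "compact_open_bisection G V" "s ` V = Y"
    and UV: "r ` U \<union> r ` V \<subseteq> Y" "r ` U \<inter> r ` V = {}"
    using pi unfolding purely_infinite_def by metis
  have cU: "clop (r ` U)" and cV: "clop (r ` V)"
    using bisectionD(6) U(1) V(1) by blast+
  obtain a where a: "a \<in> Cr" "adj a o\<^sub>L a = proj Y" and aD: "\<And>d. d \<in> D \<Longrightarrow> a o\<^sub>L d o\<^sub>L adj a \<in> D"
    and aY: "\<And>Y. clop Y \<Longrightarrow> r ` U \<subseteq> Y \<Longrightarrow> proj Y o\<^sub>L a = a"
    using bisection_op[OF U(1)] unfolding U(2) by metis
  obtain b where b: "b \<in> Cr" "adj b o\<^sub>L b = proj Y" and bD: "\<And>d. d \<in> D \<Longrightarrow> b o\<^sub>L d o\<^sub>L adj b \<in> D"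
    and bY: "\<And>Y. clop Y \<Longrightarrow> r ` V \<subseteq> Y \<Longrightarrow> proj Y o\<^sub>L b = b"
    using bisection_op[OF V(1)] unfolding V(2) by metis
  obtain w1 where w1: "w1 \<in> Cr" "adj w1 o\<^sub>L w1 = proj Z1" "proj Y o\<^sub>L w1 = w1"
    and w1D: "\<And>d. d \<in> D \<Longrightarrow> w1 o\<^sub>L d o\<^sub>L adj w1 \<in> D"
    using reach(1) unfolding reach_def by blast
  obtain w2 where w2: "w2 \<in> Cr" "adj w2 o\<^sub>L w2 = proj Z2" "proj Y o\<^sub>L w2 = w2"
    and w2D: "\<And>d. d \<in> D \<Longrightarrow> w2 o\<^sub>L d o\<^sub>L adj w2 \<in> D"
    using reach(2) unfolding reach_def by blast
  \<comment> \<open>Removing \<open>Z1\<close> from \<open>Z2\<close> makes the two source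
    projections orthogonal, so that they add up to the projection of the union.\<close>
  define E where "E = proj (Z2 - Z1)"
  have Z: "clop (Z2 - Z1)" using Z1 Z2 by (rule clop_Diff[rotated])
  have ED: "E \<in> D" unfolding E_def using Z by (rule proj_mem)
  have ECr: "E \<in> Cr" using ED D_sub_Cr by blast
  note lin = Cr_linear[OF a(1)] Cr_linear[OF b(1)] Cr_linear[OF w1(1)] Cr_linear[OF w2(1)] Cr_linear[OF ECr]
  have ab: "adj a o\<^sub>L b = 0"
  proof -
    have "adj a o\<^sub>L b = adj (proj (r ` U) o\<^sub>L a) o\<^sub>L (proj (r ` V) o\<^sub>L b)"
      by (simp add: aY[OF cU] bY[OF cV])
    also have "\<dots> = adj a o\<^sub>L (proj (r ` U) o\<^sub>L proj (r ` V)) o\<^sub>L b"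
      using lin dop(1)[OF continuous_ind[OF cU]] by (simp add: adj_compose proj_adj cU comp_assoc)
    finally show ?thesis by (simp add: proj_comp cU cV UV(2) proj_empty)
  qed
  have "adj (adj a o\<^sub>L b) = adj b o\<^sub>L a"
    using lin by (simp add: adj_compose complex_linear_adj)
  then have ba: "adj b o\<^sub>L a = 0" by (simp add: ab)
  define w where "w = (a o\<^sub>L w1) + (b o\<^sub>L (w2 o\<^sub>L E))"
  have wCr: "w \<in> Cr" unfolding w_def by (intro Cr_ops a b w1 w2 ECr)
  have adjE: "adj E = E" unfolding E_def using Z by (rule proj_adj)
  have adjw: "adj w = (adj w1 o\<^sub>L adj a) + (E o\<^sub>L (adj w2 o\<^sub>L adj b))"
    unfolding w_def using lin
    by (simp add: adj_add adj_compose complex_linear_intros adjE comp_assoc)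
  have red: "adj a o\<^sub>L (a o\<^sub>L x) = proj Y o\<^sub>L x" "adj b o\<^sub>L (b o\<^sub>L x) = proj Y o\<^sub>L x"
    "adj a o\<^sub>L (b o\<^sub>L x) = 0" "adj b o\<^sub>L (a o\<^sub>L x) = 0" "proj Y o\<^sub>L (w2 o\<^sub>L x) = w2 o\<^sub>L x"
    "adj w2 o\<^sub>L (w2 o\<^sub>L x) = proj Z2 o\<^sub>L x" for x
    by (simp_all add: a b ab ba w2 flip: comp_assoc)
  have "proj Z2 o\<^sub>L E = E"
    unfolding E_def using Z2 Z by (simp add: proj_comp Int_absorb1)
  moreover have "E o\<^sub>L E = E"
    unfolding E_def using Z by (simp add: proj_comp)
  ultimately have "adj w o\<^sub>L w = proj Z1 + E"
    unfolding adjw unfolding w_def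
    by (simp add: comp_add_left comp_add_right comp_assoc red w1)
  also have "\<dots> = proj (Z1 \<union> Z2)"
    unfolding E_def using Z1 Z by (subst proj_add) auto
  finally have ww: "adj w o\<^sub>L w = proj (Z1 \<union> Z2)" .
  have w1Z: "w1 o\<^sub>L proj Z1 = w1" using isometry_support[OF lin(3) Z1 w1(2)] .
  then have w1Z': "proj Z1 o\<^sub>L adj w1 = adj w1"
    using adj_compose[OF lin(3) dop(1)[OF continuous_ind[OF Z1]]] Z1 by (simp add: proj_adj)
  have disj: "Z1 \<inter> (Z2 - Z1) = {}" "(Z2 - Z1) \<inter> Z1 = {}" by auto
  have "proj Z1 o\<^sub>L E = 0" "E o\<^sub>L proj Z1 = 0"
    unfolding E_def proj_comp[OF Z1 Z] proj_comp[OF Z Z1] disj by (simp_all add: proj_empty)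
  \<comment> \<open>These are the mixed terms of \<open>w o\<^sub>L d o\<^sub>L adj w\<close>. They
    vanish because \<open>d\<close> commutes with the disjoint source projections, so the conjugate
    is a sum of two elements of \<open>D\<close>.\<close>
  then have cross1: "w1 o\<^sub>L (d o\<^sub>L E) = 0" and cross2: "E o\<^sub>L (d o\<^sub>L adj w1) = 0" if "d \<in> D" for d
  proof -
    have dZ: "proj Z1 o\<^sub>L d = d o\<^sub>L proj Z1" using that proj_mem[OF Z1] by (rule diagonal_commute[rotated])
    have "w1 o\<^sub>L (d o\<^sub>L E) = w1 o\<^sub>L (proj Z1 o\<^sub>L d) o\<^sub>L E"
      by (subst w1Z[symmetric]) (simp add: comp_assoc)
    also have "\<dots> = w1 o\<^sub>L d o\<^sub>L (proj Z1 o\<^sub>L E)" unfolding dZ by (simp add: comp_assoc)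
    finally show "w1 o\<^sub>L (d o\<^sub>L E) = 0" by (simp add: \<open>proj Z1 o\<^sub>L E = 0\<close>)
    have "E o\<^sub>L (d o\<^sub>L adj w1) = E o\<^sub>L (d o\<^sub>L proj Z1) o\<^sub>L adj w1"
      by (subst w1Z'[symmetric]) (simp add: comp_assoc)
    also have "\<dots> = (E o\<^sub>L proj Z1) o\<^sub>L d o\<^sub>L adj w1" unfolding dZ[symmetric] by (simp add: comp_assoc)
    finally show "E o\<^sub>L (d o\<^sub>L adj w1) = 0" by (simp add: \<open>E o\<^sub>L proj Z1 = 0\<close>)
  qed
  have wD: "w o\<^sub>L d o\<^sub>L adj w \<in> D" if d: "d \<in> D" for d
  proof -
    have cross1': "w1 o\<^sub>L (d o\<^sub>L (E o\<^sub>L x)) = 0" for x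
      using arg_cong[OF cross1[OF d], of "\<lambda>y. y o\<^sub>L x"] by (simp add: comp_assoc)
    have cross2': "E o\<^sub>L (d o\<^sub>L (adj w1 o\<^sub>L x)) = 0" for x
      using arg_cong[OF cross2[OF d], of "\<lambda>y. y o\<^sub>L x"] by (simp add: comp_assoc)
    have "w o\<^sub>L d o\<^sub>L adj w = (a o\<^sub>L (w1 o\<^sub>L d o\<^sub>L adj w1) o\<^sub>L adj a)
        + (b o\<^sub>L (w2 o\<^sub>L (E o\<^sub>L d o\<^sub>L E) o\<^sub>L adj w2) o\<^sub>L adj b)"
      unfolding adjw unfolding w_def
      by (simp add: comp_add_left comp_add_right comp_assoc cross1' cross2')
    also have "\<dots> \<in> D"
      by (intro diagonal_add aD bD w1D w2D diagonal_comp ED d)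
    finally show ?thesis .
  qed
  have "proj Y o\<^sub>L a = a" "proj Y o\<^sub>L b = b" using aY bY Y UV(1) by auto
  then have "proj Y o\<^sub>L w = w"
    unfolding w_def by (simp add: comp_add_right flip: comp_assoc)
  then show ?thesis
    unfolding reach_def using wCr ww wD by blast
qed

text \<open>By minimality every orbit enters the open set \<open>Y\<close>, so the sources of
  compact open bisections with range in \<open>Y\<close> cover \<open>X\<close>. Compactness leaves
  finitely many of them, and \<open>reach_Un\<close> merges these.\<close>

lemma reach_units:
  assumes pi: "purely_infinite G" and mini: "minimal_groupoid G" and Y: "clop Y" "Y \<noteq> {}"
  shows "reach Y X"
proof -
  define \<B> where "\<B> = {W. compact_open_bisection G W \<and> r ` W \<subseteq> Y}"
  have cov: "X \<subseteq> (\<Union>W\<in>\<B>. s ` W)"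
  proof
    fix x assume x: "x \<in> X"
    obtain y where y: "y \<in> Y" using Y(2) by blast
    then have "y \<in> closure (r ` {g. s g = x})"
      using mini x clopD(1)[OF Y(1)] unfolding minimal_groupoid_def by blast
    then have "r ` {g. s g = x} \<inter> Y \<noteq> {}"
      using y clopD(2)[OF Y(1)] unfolding closure_iff_nhds_not_empty by blast
    then obtain g where g: "s g = x" "r g \<in> Y" by blast
    have "open (r -` Y)" using clopD(2)[OF Y(1)] cont_rng[of UNIV] by (simp add: open_vimage)
    then obtain W where "compact_open_bisection G W" "g \<in> W" "W \<subseteq> r -` Y"
      using bisection_base[of "r -` Y" g] g by blast
    then show "x \<in> (\<Union>W\<in>\<B>. s ` W)" using g by (auto simp: \<B>_def)
  qed
  have "open (s ` W)" if "W \<in> \<B>" for W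
    using that bisectionD(2) open_map_src by (auto simp: \<B>_def)
  from compactE_image[OF compact_units this cov]
  obtain \<C> where \<C>: "\<C> \<subseteq> \<B>" "finite \<C>" "X \<subseteq> (\<Union>W\<in>\<C>. s ` W)" by metis
  have "clop (\<Union>W\<in>\<C>. s ` W) \<and> reach Y (\<Union>W\<in>\<C>. s ` W)"
    using \<C>(2,1)
  proof (induction \<C> rule: finite_induct)
    case empty
    then show ?case by (simp add: reach_empty clop_empty)
  next
    case (insert W \<C>)
    have W: "compact_open_bisection G W" "r ` W \<subseteq> Y" using insert.prems by (auto simp: \<B>_def)
    have IH: "clop (\<Union>W\<in>\<C>. s ` W)" "reach Y (\<Union>W\<in>\<C>. s ` W)" using insert by auto
    show ?case
      using reach_Un[OF pi Y(1) bisectionD(5)[OF W(1)] IH(1) reach_bisection[OF W(1) Y(1) W(2)] IH(2)]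
        clop_Un[OF bisectionD(5)[OF W(1)] IH(1)] by simp
  qed
  moreover have "(\<Union>W\<in>\<C>. s ` W) = X" using \<C>(3) by auto
  ultimately show ?thesis by simp
qed

text \<open>The function \<psi> of \<open>b o\<^sub>L adj b\<close> is nonnegative and not
  identically 0. Scaling by its inverse square root on a clopen set where it does not vanish
  produces the projection \<open>e\<close> of that set.\<close>

lemma normalizing_isometry_Cr:
  assumes pi: "purely_infinite G" and mini: "minimal_groupoid G"
    and b: "b \<in> Cr" "b o\<^sub>L adj b \<in> D" "b \<noteq> 0"
  shows "\<exists>h\<in>D. \<exists>e. e = h o\<^sub>L b o\<^sub>L adj b o\<^sub>L adj h \<and> e o\<^sub>L e = e \<and>
    (\<exists>w\<in>Cr. adj w o\<^sub>L w = id_blinfun \<and> (\<forall>d\<in>D. w o\<^sub>L d o\<^sub>L adj w \<in> D) \<and> e o\<^sub>L w = w)"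
proof -
  have lin: "complex_linear b" using b(1) by (rule Cr_linear)
  obtain \<psi> where \<psi>: "continuous_on X \<psi>" "b o\<^sub>L adj b = dop \<psi>" using b(2) by (rule DE)
  have pos: "\<psi> x = of_real ((norm (adj b (ket x)))\<^sup>2)" if "x \<in> X" for x
  proof -
    have "\<psi> x = cinner_ell2 (ket x) ((b o\<^sub>L adj b) (ket x))"
      using that by (simp add: \<psi>(2) dop[OF \<psi>(1)])
    also have "\<dots> = cinner_ell2 (adj b (ket x)) (adj b (ket x))"
      by (simp add: cinner_adj_left[OF lin])
    finally show ?thesis by (simp add: cinner_self_norm)
  qed
  have "\<exists>x\<in>X. \<psi> x \<noteq> 0"
  proof (rule ccontr)
    assume "\<not> ?thesis"
    then have "dop \<psi> = dop (\<lambda>_. 0)" by (intro dop_cong \<psi>) auto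
    then have "adj (adj b) o\<^sub>L adj b = 0" using \<psi>(2) lin by (simp add: dop_zero)
    then have "adj b = 0" using adj_compose_self_eq_0[OF complex_linear_adj[OF lin]] by blast
    then show False using adj_adj[OF lin] b(3) by simp
  qed
  then obtain x0 where x0: "x0 \<in> X" "\<psi> x0 \<noteq> 0" by blast
  have "openin (top_of_set X) (X \<inter> \<psi> -` (- {0}))"
    using \<psi>(1) by (rule continuous_openin_preimage_gen) (simp add: open_Compl)
  then have "open (X \<inter> \<psi> -` (- {0}))" by (simp add: openin_units)
  then obtain Y where Y: "clop Y" "x0 \<in> Y" "Y \<subseteq> X \<inter> \<psi> -` (- {0})"
    using clop_base[of _ x0] x0 by blast
  \<comment> \<open>Since \<open>\<psi> x\<close> is the squared norm of
    \<open>adj b (ket x)\<close>, this is the inverse square root of \<psi> on \<open>Y\<close>;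
    continuity is checked in that form.\<close>
  define \<eta> where "\<eta> x = (if x \<in> Y then complex_of_real (1 / norm (adj b (ket x))) else 0)" for x
  have nz: "norm (adj b (ket x)) \<noteq> 0" if "x \<in> Y" for x
  proof
    assume "norm (adj b (ket x)) = 0"
    then have "\<psi> x = 0" using pos[of x] that Y(3) by auto
    then show False using that Y(3) by auto
  qed
  have "continuous_on Y (\<lambda>x. complex_of_real (1 / sqrt (Re (\<psi> x))))"
  proof (intro continuous_intros ballI)
    show "continuous_on Y \<psi>" using \<psi>(1) Y(3) by (auto intro: continuous_on_subset)
    show "sqrt (Re (\<psi> x)) \<noteq> 0" if "x \<in> Y" for x
      using that nz[OF that] pos[of x] Y(3) by auto
  qed
  moreover have "complex_of_real (1 / sqrt (Re (\<psi> x))) = complex_of_real (1 / norm (adj b (ket x)))"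
    if "x \<in> Y" for x
    using that pos[of x] Y(3) by auto
  ultimately have "continuous_on Y (\<lambda>x. complex_of_real (1 / norm (adj b (ket x))))"
    by (rule continuous_on_eq)
  then have "continuous_on UNIV \<eta>"
    unfolding \<eta>_def using clopD[OF Y(1)] by (intro continuous_extend_zero)
  then have \<eta>: "continuous_on X \<eta>" by (rule continuous_on_subset) simp
  define h where "h = dop \<eta>"
  have "h o\<^sub>L b o\<^sub>L adj b o\<^sub>L adj h = dop \<eta> o\<^sub>L dop \<psi> o\<^sub>L dop (\<lambda>x. cnj (\<eta> x))"
    unfolding h_def dop_adj[OF \<eta>] \<psi>(2)[symmetric] by (simp add: comp_assoc)
  also have "\<dots> = dop (\<lambda>x. \<eta> x * \<psi> x * cnj (\<eta> x))"
    by (simp add: dop_comp \<eta> \<psi>(1) continuous_on_mult continuous_on_cnj)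
  also have "\<dots> = proj Y"
  proof (rule dop_cong)
    show "continuous_on X (\<lambda>x. \<eta> x * \<psi> x * cnj (\<eta> x))"
      by (intro continuous_on_mult continuous_on_cnj \<eta> \<psi>(1))
    show "\<eta> x * \<psi> x * cnj (\<eta> x) = ind Y x" if "x \<in> X" for x
      using nz[of x] pos[OF that] by (auto simp: \<eta>_def ind_def power2_eq_square)
  qed
  finally have e: "h o\<^sub>L b o\<^sub>L adj b o\<^sub>L adj h = proj Y" .
  have "reach Y X" using Y by (intro reach_units[OF pi mini]) auto
  then have w: "\<exists>w\<in>Cr. adj w o\<^sub>L w = id_blinfun \<and> (\<forall>d\<in>D. w o\<^sub>L d o\<^sub>L adj w \<in> D) \<and> proj Y o\<^sub>L w = w"
    unfolding reach_def proj_units .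
  have h: "h \<in> D" unfolding h_def using \<eta> by (rule dop_mem)
  have PP: "proj Y o\<^sub>L proj Y = proj Y" using Y(1) by (simp add: proj_comp)
  show ?thesis
    by (rule bexI[OF _ h], rule exI[of _ "proj Y"], intro conjI e[symmetric] PP w)
qed

section \<open>Roots of unitaries of the diagonal\<close>

lemma clop_separation:
  assumes "compact K" "K \<subseteq> X" "open U" "K \<subseteq> U"
  shows "\<exists>Z. clop Z \<and> K \<subseteq> Z \<and> Z \<subseteq> U"
proof -
  define \<B> where "\<B> = {Z. clop Z \<and> Z \<subseteq> U}"
  have "K \<subseteq> \<Union>\<B>"
    using clop_base[OF assms(3)] assms(2,4) by (fastforce simp: \<B>_def)
  then obtain \<C> where \<C>: "\<C> \<subseteq> \<B>" "finite \<C>" "K \<subseteq> \<Union>\<C>"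
    using compactE[OF assms(1)] clopD(2) by (metis (no_types, lifting) \<B>_def mem_Collect_eq)
  have "clop (\<Union>\<C>) \<and> \<Union>\<C> \<subseteq> U"
    using \<C>(2,1)
  proof (induction \<C> rule: finite_induct)
    case (insert Z \<C>)
    then have "clop Z" "Z \<subseteq> U" "clop (\<Union>\<C>)" "\<Union>\<C> \<subseteq> U" by (simp_all add: \<B>_def)
    then show ?case by (simp add: clop_Un)
  qed (simp add: clop_empty)
  then show ?thesis using \<C>(3) by (intro exI[of _ "\<Union>\<C>"] conjI) simp_all
qed

text \<open>
  A clopen set separates the preimages of \<open>1\<close> and \<open>-1\<close>, and \<open>\<phi>\<close> has a continuous logarithm on each
  piece.
\<close>

lemma unimodular_root:
  fixes \<phi> :: "'g \<Rightarrow> complex"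
  assumes \<phi>: "continuous_on X \<phi>" and uni: "\<And>x. x \<in> X \<Longrightarrow> cmod (\<phi> x) = 1" and n: "0 < n"
  shows "\<exists>\<theta>. continuous_on X \<theta> \<and> (\<forall>x\<in>X. cmod (\<theta> x) = 1 \<and> \<theta> x ^ n = \<phi> x)"
proof -
  have "closedin (top_of_set X) (X \<inter> \<phi> -` {1})"
    using \<phi> by (rule continuous_closedin_preimage) simp
  then have K: "compact (X \<inter> \<phi> -` {1})" using compact_units by (rule closedin_compact[rotated])
  have "openin (top_of_set X) (X \<inter> \<phi> -` (- {-1}))"
    using \<phi> by (rule continuous_openin_preimage_gen) (simp add: open_Compl)
  then have "open (X \<inter> \<phi> -` (- {-1}))" by (simp add: openin_units)
  moreover have "X \<inter> \<phi> -` {1} \<subseteq> X \<inter> \<phi> -` (- {-1})" by auto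
  ultimately obtain Z where Z: "clop Z" "X \<inter> \<phi> -` {1} \<subseteq> Z" "Z \<subseteq> X \<inter> \<phi> -` (- {-1})"
    using clop_separation[OF K Int_lower1] by metis
  \<comment> \<open>The principal logarithm is continuous off the nonpositive axis, which meets the
    unit circle only at -1. Hence it applies to \<phi> on \<open>Z\<close> and to the negative of
    \<phi> off \<open>Z\<close>.\<close>
  have nonpos: "z = -1" if "z \<in> \<real>\<^sub>\<le>\<^sub>0" "cmod z = 1" for z
    using that by (auto elim!: nonpos_Reals_cases)
  define \<theta>1 where "\<theta>1 x = exp (Ln (\<phi> x) / of_nat n)" for x
  \<comment> \<open>The summand \<open>\<i> * of_real pi\<close> compensates for the sign: adding it
    to the logarithm of \<open>- \<phi> x\<close> gives a logarithm of
    \<open>\<phi> x\<close>.\<close>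
  define \<theta>2 where "\<theta>2 x = exp ((Ln (- \<phi> x) + \<i> * of_real pi) / of_nat n)" for x
  define \<theta> where "\<theta> x = (if x \<in> Z then \<theta>1 x else \<theta>2 x)" for x
  have c1: "continuous_on Z \<theta>1"
    unfolding \<theta>1_def
  proof (intro continuous_on_exp continuous_on_divide continuous_on_Ln' continuous_on_const ballI)
    show "continuous_on Z \<phi>" using \<phi> clopD(1)[OF Z(1)] by (rule continuous_on_subset)
    show "\<phi> x \<notin> \<real>\<^sub>\<le>\<^sub>0" if "x \<in> Z" for x
      using nonpos[of "\<phi> x"] uni[of x] Z(3) that by auto
  qed (use n in simp)
  have c2: "continuous_on (X - Z) \<theta>2"
    unfolding \<theta>2_def
  proof (intro continuous_on_exp continuous_on_divide continuous_on_add continuous_on_Ln' continuous_on_minus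
      continuous_on_const ballI)
    show "continuous_on (X - Z) \<phi>" using \<phi> by (rule continuous_on_subset) blast
    show "- \<phi> x \<notin> \<real>\<^sub>\<le>\<^sub>0" if "x \<in> X - Z" for x
      using nonpos[of "- \<phi> x"] uni[of x] Z(2) that by auto
  qed (use n in simp)
  have "continuous_on (Z \<union> (X - Z)) \<theta>"
  proof (rule continuous_on_open_Un)
    show "open Z" "open (X - Z)" using Z(1) clopD(2) clop_Diff[OF clop_units Z(1)] by blast+
    show "continuous_on Z \<theta>" using c1 by (rule continuous_on_eq) (simp add: \<theta>_def)
    show "continuous_on (X - Z) \<theta>" using c2 by (rule continuous_on_eq) (simp add: \<theta>_def)
  qed
  moreover have "Z \<union> (X - Z) = X" using clopD(1)[OF Z(1)] by blast
  ultimately have "continuous_on X \<theta>" by simp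
  moreover have "cmod (\<theta> x) = 1 \<and> \<theta> x ^ n = \<phi> x" if x: "x \<in> X" for x
  proof -
    have nz: "\<phi> x \<noteq> 0" using uni[OF x] by auto
    have Re: "Re (Ln (\<phi> x)) = 0" "Re (Ln (- \<phi> x)) = 0"
      using nz uni[OF x] by simp_all
    have p: "exp (z / of_nat n) ^ n = exp z" for z :: complex
      using n by (simp flip: exp_of_nat_mult)
    have "cmod (\<theta>1 x) = 1" "cmod (\<theta>2 x) = 1"
      using Re by (simp_all add: \<theta>1_def \<theta>2_def Re_divide_of_nat)
    moreover have "\<theta>1 x ^ n = \<phi> x" using nz by (simp add: \<theta>1_def p)
    moreover have "\<theta>2 x ^ n = \<phi> x"
      using nz by (simp add: \<theta>2_def p exp_add)
    ultimately show ?thesis by (simp add: \<theta>_def)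
  qed
  ultimately show ?thesis by blast
qed

lemma unitary_root_D:
  assumes d: "d \<in> D" "adj d o\<^sub>L d = id_blinfun" and n: "0 < n"
  shows "\<exists>c\<in>D. adj c o\<^sub>L c = id_blinfun \<and> ((\<lambda>b. b o\<^sub>L c) ^^ n) id_blinfun = d"
proof -
  obtain \<phi> where \<phi>: "continuous_on X \<phi>" "d = dop \<phi>" using d(1) by (rule DE)
  have c\<phi>: "continuous_on X (\<lambda>x. cnj (\<phi> x))" using \<phi>(1) by (rule continuous_on_cnj)
  have cmod_iff: "cnj z * z = 1 \<longleftrightarrow> cmod z = 1" for z
  proof -
    have "cnj z * z = of_real ((cmod z)\<^sup>2)" by (metis complex_norm_square mult.commute)
    then have "cnj z * z = 1 \<longleftrightarrow> (cmod z)\<^sup>2 = 1" by (metis of_real_eq_1_iff)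
    then show ?thesis by (simp add: power2_eq_1_iff) (use norm_ge_zero[of z] in linarith)
  qed
  have "cmod (\<phi> x) = 1" if "x \<in> X" for x
  proof -
    have "dop (\<lambda>x. cnj (\<phi> x) * \<phi> x) (ket x) = ket x"
      using d(2) by (simp add: \<phi>(2) dop_adj \<phi>(1) dop_comp c\<phi>)
    then have "Rep_ell2 (dop (\<lambda>x. cnj (\<phi> x) * \<phi> x) (ket x)) x = Rep_ell2 (ket x) x" by simp
    then have "cnj (\<phi> x) * \<phi> x = 1"
      using that by (subst (asm) dop) (simp_all add: continuous_on_mult c\<phi> \<phi>(1))
    then show ?thesis using cmod_iff by blast
  qed
  then obtain \<theta> where \<theta>: "continuous_on X \<theta>" and uni: "\<And>x. x \<in> X \<Longrightarrow> cmod (\<theta> x) = 1"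
    and pow: "\<And>x. x \<in> X \<Longrightarrow> \<theta> x ^ n = \<phi> x"
    using unimodular_root[OF \<phi>(1) _ n] by blast
  have c\<theta>: "continuous_on X (\<lambda>x. cnj (\<theta> x))" using \<theta> by (rule continuous_on_cnj)
  have cp: "continuous_on X (\<lambda>x. \<theta> x ^ k)" for k using \<theta> by (rule continuous_on_power)
  have "adj (dop \<theta>) o\<^sub>L dop \<theta> = dop (\<lambda>x. cnj (\<theta> x) * \<theta> x)"
    by (simp add: dop_adj \<theta> dop_comp c\<theta>)
  also have "\<dots> = dop (\<lambda>_. 1)"
    by (rule dop_cong) (use uni cmod_iff in \<open>simp_all add: continuous_on_mult c\<theta> \<theta>\<close>)
  finally have 1: "adj (dop \<theta>) o\<^sub>L dop \<theta> = id_blinfun" by (simp add: dop_one)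
  have "((\<lambda>b. b o\<^sub>L dop \<theta>) ^^ k) id_blinfun = dop (\<lambda>x. \<theta> x ^ k)" for k
    by (induction k) (simp_all add: dop_one dop_comp cp \<theta> mult.commute)
  then have "((\<lambda>b. b o\<^sub>L dop \<theta>) ^^ n) id_blinfun = d"
    unfolding \<phi>(2) using dop_cong[OF cp pow] by simp
  then show ?thesis using 1 dop_mem[OF \<theta>] by blast
qed

lemma regular_masa_unit_functions:
  assumes "topologically_principal G" "minimal_groupoid G" "purely_infinite G"
  shows "regular_masa Cr D"
proof -
  have "id_blinfun \<in> Cr"
    using D_sub_Cr proj_mem[OF clop_units] by (auto simp: proj_units)
  then have "unital_cstar Cr" by (intro unital_cstar.intro Cr_cstar)
  moreover have "regular_masa_axioms Cr D"
  proof
    show "a \<in> D \<longleftrightarrow> (\<forall>d\<in>D. a o\<^sub>L d = d o\<^sub>L a)" if "a \<in> Cr" for a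
      using D_commutant_Cr[OF assms(1) that] diagonal_commute by blast
  qed (use D_sub_Cr diagonal_adj normalizing_isometry_Cr[OF assms(3,2)] unitary_root_D in blast)+
  ultimately show ?thesis by (rule regular_masa.intro)
qed

end

theorem theorem1p5:
  fixes G :: "'g::{t2_space, second_countable_topology} gpd"
    and p :: nat
    and \<alpha> :: "int \<Rightarrow> 'g oper \<Rightarrow> 'g oper"
  assumes "etale_groupoid G"
    and "locally_compact_space (euclidean :: 'g topology)"
    and "topologically_principal G"
    and "minimal_groupoid G"
    and "purely_infinite G"
    and "units G homeomorphic (UNIV :: (nat \<Rightarrow> bool) set)"
    and "prime p"
    and "cstar_action (integer_mod_group p) (reduced_cstar G) \<alpha>"
  shows "\<not> is_masa (crossed_image (integer_mod_group p) \<alpha> (unit_functions G))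
                   (crossed_product (integer_mod_group p) (reduced_cstar G) \<alpha>)
         \<longleftrightarrow>
         (\<exists>\<beta>. cstar_action (integer_mod_group p) (reduced_cstar G) \<beta> \<and>
              (\<forall>\<gamma>\<in>carrier (integer_mod_group p). \<forall>a\<in>unit_functions G. \<beta> \<gamma> a = a) \<and>
              exterior_equivalent (integer_mod_group p) (reduced_cstar G) \<alpha> \<beta>)"
proof -
  have "topological_groupoid G" using assms(1) by (simp add: etale_groupoid_def)
  then interpret cantor_groupoid G
    using assms(1,6) by (intro cantor_groupoid.intro cantor_groupoid_axioms.intro)
  interpret regular_masa "reduced_cstar G" "unit_functions G"
    using assms(3,4,5) by (rule regular_masa_unit_functions)
  show ?thesis using assms(7,8) by (rule cyclic_not_masa_iff)
qed

end
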